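(* Assume that $V:\mathbb{R}^2\to\mathbb{R}^2$ is either (1) (shear flow) $V(x)=(v(x_2),0)$ for $x=(x_1,x_2)\in\mathbb{R}^2$, where $v:\mathbb{R}\to\mathbb{R}$ is a $1$-periodic smooth function with mean zero that is not identically zero; or (2) (cellular flow) $V(x)=(-K_{x_2}(x),K_{x_1}(x))$ with $K(x_1,x_2)=\sin(2\pi x_1)\sin(2\pi x_2)$ for $x=(x_1,x_2)\in\mathbb{R}^2$. Then for any fixed real $A\neq 0$, the level curve $S_A=\{p\in\mathbb{R}^2:\alpha_A(p)=1\}$ contains flat pieces, where $\alpha_A$ is the effective burning velocity associated with the flow velocity $AV$.
   Context: $\mathbb{T}^2=\mathbb{R}^2/\mathbb{Z}^2$. For a smooth, $\mathbb{Z}^2$-periodic, divergence-free, mean-zero vector field $W:\mathbb{R}^2\to\mathbb{R}^2$, the effective Hamiltonian $\overline H:\mathbb{R}^2\to\mathbb{R}$ associated with $W$ is defined as follows: for each $p\in\mathbb{R}^2$, $\overline H(p)$ is the unique real constant such that the cell problem $$|p+Du|^2+W(x)\cdot(p+Du)=\overline H(p)\quad\text{in }\mathbb{T}^2$$ admits a periodic viscosity solution $u\in C^{0,1}(\mathbb{T}^2)$. The effective burning velocity associated with the flow velocity $W$ is $$\alpha(p)=\inf_{\lambda>0}\frac{1+\overline H(\lambda p)}{\lambda},\qquad p\in\mathbb{R}^2.$$ "$S$ contains flat pieces" means that $S$ contains a nondegenerate line segment. *)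

theory Defs
  imports "HOL-Analysis.Analysis"
begin

text \<open>Functions on the torus are \<open>\<int>\<^sup>2\<close>-periodic functions on the plane.\<close>

definition torus_periodic :: "(real^2 \<Rightarrow> 'b) \<Rightarrow> bool" where
  "torus_periodic f \<longleftrightarrow> (\<forall>x i. f (x + axis i 1) = f x)"

definition C1_with_gradient :: "(real^2 \<Rightarrow> real) \<Rightarrow> (real^2 \<Rightarrow> real^2) \<Rightarrow> bool" where
  "C1_with_gradient \<phi> D\<phi> \<longleftrightarrow> (\<forall>x. GDERIV \<phi> x :> D\<phi> x) \<and> continuous_on UNIV D\<phi>"

text \<open>Viscosity solutions of \<open>F(x, Du(x)) = 0\<close>, tested with \<open>C\<^sup>1\<close> functions touching
  from above (local maximum of \<open>u - \<phi>\<close>) and from below (local minimum).\<close>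

definition viscosity_subsolution :: "(real^2 \<Rightarrow> real^2 \<Rightarrow> real) \<Rightarrow> (real^2 \<Rightarrow> real) \<Rightarrow> bool" where
  "viscosity_subsolution F u \<longleftrightarrow> continuous_on UNIV u \<and>
     (\<forall>\<phi> D\<phi> x. C1_with_gradient \<phi> D\<phi> \<longrightarrow>
        (\<forall>\<^sub>F y in nhds x. u y - \<phi> y \<le> u x - \<phi> x) \<longrightarrow> F x (D\<phi> x) \<le> 0)"

definition viscosity_supersolution :: "(real^2 \<Rightarrow> real^2 \<Rightarrow> real) \<Rightarrow> (real^2 \<Rightarrow> real) \<Rightarrow> bool" where
  "viscosity_supersolution F u \<longleftrightarrow> continuous_on UNIV u \<and>
     (\<forall>\<phi> D\<phi> x. C1_with_gradient \<phi> D\<phi> \<longrightarrow>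
        (\<forall>\<^sub>F y in nhds x. u y - \<phi> y \<ge> u x - \<phi> x) \<longrightarrow> F x (D\<phi> x) \<ge> 0)"

definition viscosity_solution :: "(real^2 \<Rightarrow> real^2 \<Rightarrow> real) \<Rightarrow> (real^2 \<Rightarrow> real) \<Rightarrow> bool" where
  "viscosity_solution F u \<longleftrightarrow> viscosity_subsolution F u \<and> viscosity_supersolution F u"

definition cell_problem_solvable :: "(real^2 \<Rightarrow> real^2) \<Rightarrow> real^2 \<Rightarrow> real \<Rightarrow> bool" where
  "cell_problem_solvable W p c \<longleftrightarrow>
     (\<exists>u. torus_periodic u \<and> (\<exists>L. L-lipschitz_on UNIV u) \<and>
          viscosity_solution (\<lambda>x q. (norm (p + q))\<^sup>2 + W x \<bullet> (p + q) - c) u)"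

text \<open>Meaningful for smooth, periodic, divergence-free, mean-zero \<open>W\<close>: then the
  constant \<open>c\<close> exists and is unique.\<close>

definition effective_Hamiltonian :: "(real^2 \<Rightarrow> real^2) \<Rightarrow> real^2 \<Rightarrow> real" where
  "effective_Hamiltonian W p = (THE c. cell_problem_solvable W p c)"

text \<open>For \<open>W\<close> as above the effective Hamiltonian is nonnegative, so the infimum is over a
  nonempty set of reals that is bounded below.\<close>

definition effective_burning_velocity :: "(real^2 \<Rightarrow> real^2) \<Rightarrow> real^2 \<Rightarrow> real" where
  "effective_burning_velocity W p =
     (INF l\<in>{0<..}. (1 + effective_Hamiltonian W (l *\<^sub>R p)) / l)"

definition smooth_real :: "(real \<Rightarrow> real) \<Rightarrow> bool" where
  "smooth_real v \<longleftrightarrow> (\<forall>n x. (deriv ^^ n) v differentiable (at x))"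

definition shear_flow :: "(real^2 \<Rightarrow> real^2) \<Rightarrow> bool" where
  "shear_flow V \<longleftrightarrow>
     (\<exists>v. smooth_real v \<and> (\<forall>t. v (t + 1) = v t) \<and> integral {0..1} v = 0 \<and>
          (\<exists>t. v t \<noteq> 0) \<and> V = (\<lambda>x. vector [v (x $ 2), 0]))"

definition partial_deriv :: "2 \<Rightarrow> (real^2 \<Rightarrow> real) \<Rightarrow> real^2 \<Rightarrow> real" where
  "partial_deriv i f x = frechet_derivative f (at x) (axis i 1)"

definition cellular_stream :: "real^2 \<Rightarrow> real" where
  "cellular_stream x = sin (2 * pi * x $ 1) * sin (2 * pi * x $ 2)"

definition cellular_flow :: "real^2 \<Rightarrow> real^2" where
  "cellular_flow x =
     vector [- partial_deriv 2 cellular_stream x, partial_deriv 1 cellular_stream x]"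

definition contains_flat_piece :: "(real^2) set \<Rightarrow> bool" where
  "contains_flat_piece S \<longleftrightarrow> (\<exists>a b. a \<noteq> b \<and> closed_segment a b \<subseteq> S)"

end

theory Submission
  imports Defs
begin

text \<open>
  Instead of working with viscosity solutions, call \<open>f\<close> dominated at level \<open>c\<close> if
  \<open>f y - f x\<close> is at most the value at \<open>y - x\<close> of the support function of
  \<open>{q. |q|\<^sup>2 + W x \<bullet> q \<le> c}\<close>, up to a quadratic error. This notion is stable under suprema, infima and
  convex combinations, and \<open>H\<close>, the effective Hamiltonian, is the least level at which some dominated
  \<open>f\<close> satisfies \<open>f (x + e\<^sub>i) = f x + p\<^sub>i\<close>: at that level some point admits no strict subsolution, and the
  Mane potential based there is a viscosity solution; uniqueness is the usual doubling of variables.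

  The level curve has a flat piece as soon as \<open>(1 + H p) / p\<^sub>1\<close> attains its minimum over \<open>p\<^sub>1 > 0\<close> along a
  nondegenerate vertical segment. For a shear with maximal velocity \<open>m > 0\<close>, following a fastest streamline
  gives \<open>H p \<ge> p\<^sub>1\<^sup>2 + m p\<^sub>1\<close>, with equality at \<open>p = (1, s)\<close> for small \<open>s\<close>, where a subsolution is explicit.

  For the cellular flow, convexity and the reflection symmetries reduce the claim to
  \<open>H (l, s) \<le> H (l, 0)\<close> for some \<open>s > 0\<close>, where \<open>(l, 0)\<close> is the minimiser. It suffices that subsolutions
  strict near the whole axis \<open>x\<^sub>2 = 0\<close> exist, because these can be tilted by adding a small multiple of a
  staircase in \<open>x\<^sub>2\<close> that is constant away from the axis and its translates. Otherwise some axis point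
  carries a forward and a backward solution, both even in \<open>x\<^sub>2\<close>, which touch there. Semiconcavity and a local
  barrier propagate the contact along the axis, so \<open>l\<close> would equal the mean over a period of the horizontal
  momentum of energy \<open>c = H (l, 0)\<close>. That mean exceeds \<open>sqrt c\<close>, whereas \<open>l \<le> sqrt c\<close> by \<open>H p \<ge> |p|\<^sup>2\<close>.
\<close>

section \<open>Dominated functions\<close>

text \<open>The error term in domination is quadratic, so it disappears under subdivision: a local
  bound with any constant improves itself to a global one with the constant \<open>M\<close> given
  by the Lipschitz bound of \<open>W\<close>. One common constant makes the class closed under
  pointwise limits, and differentiability almost everywhere is never invoked. Zero momentum has
  energy zero, so multiplying a subsolution by a factor below 1 lowers its level when
  \<open>c > 0\<close>; this slack pays for gluing, for moving the base point of a cone and for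
  averaging translates. For the cellular flow the obstacle is that a contact point of the two
  conjugate solutions might be isolated. Evenness makes the contact gradient horizontal, and a
  barrier with curvature of order 1/r beats any fixed semiconcavity constant once r is small. The
  step size does not depend on the point, so finitely many steps cover a period. The bound H p >=
  |p|^2 rests on incompressibility, used through shears that preserve the mean exactly.\<close>

lemma norm_vec2_sq: "(norm (x::real^2))\<^sup>2 = (x$1)\<^sup>2 + (x$2)\<^sup>2"
  unfolding power2_norm_eq_inner inner_vec_def sum_2 by (simp add: power2_eq_square)

lemma inner_vec2: "(x::real^2) \<bullet> y = x $ 1 * y $ 1 + x $ 2 * y $ 2"
  by (simp add: inner_vec_def sum_2)

locale drift =
  fixes W :: "real^2 \<Rightarrow> real^2" and M B :: real
  assumes W_lip: "norm (W x - W y) \<le> M * norm (x - y)"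
    and W_bound: "norm (W x) \<le> B"
    and W_periodic: "torus_periodic W"
begin

text \<open>The support function of the sublevel set \<open>{q. |q|\<^sup>2 + W x \<bullet> q \<le> c}\<close>.\<close>

definition cost :: "real \<Rightarrow> real^2 \<Rightarrow> real^2 \<Rightarrow> real" where
  "cost c x v = sqrt (c + (norm (W x))\<^sup>2 / 4) * norm v - (W x \<bullet> v) / 2"

text \<open>The sublevel set at \<open>x\<close> is the ball of centre - W x / 2 and radius sqrt (c
  + |W x|^2 / 4). For every \<open>x\<close> it contains the ball of radius
  \<open>cost_min c\<close> around 0 and lies in the one of radius
  \<open>cost_max c\<close>.\<close>

definition cost_min :: "real \<Rightarrow> real" where "cost_min c = sqrt (c + B\<^sup>2 / 4) - B / 2"

definition cost_max :: "real \<Rightarrow> real" where "cost_max c = sqrt (c + B\<^sup>2 / 4) + B / 2"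

section \<open>Size, concavity and level gaps of the support function\<close>

lemma B_nonneg: "0 \<le> B"
  using W_bound[of 0] norm_ge_zero[of "W 0"] by linarith

lemma M_nonneg: "0 \<le> M"
proof -
  have "0 \<le> M * norm (axis 1 1 - (0::real^2))"
    using W_lip[of "axis 1 1" 0] norm_ge_zero order_trans by blast
  then show ?thesis by simp
qed

lemma cost_scale: "0 \<le> a \<Longrightarrow> cost c x (a *\<^sub>R v) = a * cost c x v"
  unfolding cost_def by (simp add: algebra_simps)

lemma cost_zero [simp]: "cost c x 0 = 0"
  unfolding cost_def by simp

lemma cost_add_le: "0 \<le> c \<Longrightarrow> cost c x (v + w) \<le> cost c x v + cost c x w"
proof -
  assume "0 \<le> c"
  then have "sqrt (c + (norm (W x))\<^sup>2 / 4) * norm (v + w)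
      \<le> sqrt (c + (norm (W x))\<^sup>2 / 4) * (norm v + norm w)"
    by (intro mult_left_mono norm_triangle_ineq) auto
  then show ?thesis unfolding cost_def by (simp add: algebra_simps add_divide_distrib)
qed

lemma cost_mono: "c \<le> c' \<Longrightarrow> cost c x v \<le> cost c' x v"
  unfolding cost_def by (simp add: mult_right_mono)

text \<open>The derivative in \<open>a\<close> is a / (4 sqrt (c + a^2 / 4)), at most 1/2; arguing
  with squares also covers c = 0.\<close>

lemma sqrt_add_sq_lip:
  fixes a b c :: real
  assumes "0 \<le> a" "0 \<le> b" "0 \<le> c"
  shows "sqrt (c + a\<^sup>2 / 4) \<le> sqrt (c + b\<^sup>2 / 4) + \<bar>a - b\<bar> / 2"
proof -
  have "b / 2 \<le> sqrt (c + b\<^sup>2 / 4)"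
    by (rule real_le_rsqrt) (use assms in \<open>simp add: power_divide\<close>)
  then have "b * \<bar>a - b\<bar> \<le> 2 * sqrt (c + b\<^sup>2 / 4) * \<bar>a - b\<bar>"
    by (intro mult_right_mono) auto
  moreover have "a\<^sup>2 \<le> b\<^sup>2 + 2 * b * \<bar>a - b\<bar> + (\<bar>a - b\<bar>)\<^sup>2"
    using power_mono[of a "b + \<bar>a - b\<bar>" 2] assms abs_ge_self[of "a - b"]
    by (simp add: power2_sum algebra_simps)
  moreover have "(sqrt (c + b\<^sup>2 / 4))\<^sup>2 = c + b\<^sup>2 / 4" using assms by simp
  ultimately have "c + a\<^sup>2 / 4 \<le> (sqrt (c + b\<^sup>2 / 4) + \<bar>a - b\<bar> / 2)\<^sup>2"
    unfolding power2_sum by (simp add: power_divide algebra_simps)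
  then show ?thesis by (intro real_le_lsqrt) (use assms in auto)
qed

lemma cost_lip:
  assumes "0 \<le> c"
  shows "cost c x v \<le> cost c y v + M * norm (x - y) * norm v"
proof -
  have n: "\<bar>norm (W x) - norm (W y)\<bar> \<le> M * norm (x - y)"
    using norm_triangle_ineq3 W_lip order_trans by blast
  have "sqrt (c + (norm (W x))\<^sup>2 / 4) \<le> sqrt (c + (norm (W y))\<^sup>2 / 4) + M * norm (x - y) / 2"
    using sqrt_add_sq_lip[of "norm (W x)" "norm (W y)" c] n assms by auto
  then have "sqrt (c + (norm (W x))\<^sup>2 / 4) * norm v
      \<le> (sqrt (c + (norm (W y))\<^sup>2 / 4) + M * norm (x - y) / 2) * norm v"
    by (intro mult_right_mono) auto
  moreover have "\<bar>(W x - W y) \<bullet> v\<bar> \<le> M * norm (x - y) * norm v"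
    using Cauchy_Schwarz_ineq2[of "W x - W y" v] mult_right_mono[OF W_lip norm_ge_zero]
      order_trans by blast
  ultimately show ?thesis unfolding cost_def
    by (simp add: algebra_simps inner_diff_left abs_le_iff)
qed

lemma cost_min_le:
  assumes "0 \<le> c"
  shows "cost_min c * norm v \<le> cost c x v"
proof -
  have "sqrt (c + B\<^sup>2 / 4) \<le> sqrt (c + (norm (W x))\<^sup>2 / 4) + \<bar>B - norm (W x)\<bar> / 2"
    using sqrt_add_sq_lip B_nonneg assms by auto
  then have "cost_min c \<le> sqrt (c + (norm (W x))\<^sup>2 / 4) - norm (W x) / 2"
    unfolding cost_min_def using W_bound[of x] by (simp add: field_simps)
  then have "cost_min c * norm v \<le> (sqrt (c + (norm (W x))\<^sup>2 / 4) - norm (W x) / 2) * norm v"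
    by (intro mult_right_mono) auto
  moreover have "W x \<bullet> v \<le> norm (W x) * norm v" by (rule norm_cauchy_schwarz)
  ultimately show ?thesis unfolding cost_def by (simp add: algebra_simps)
qed

lemma cost_min_nonneg: "0 \<le> c \<Longrightarrow> 0 \<le> cost_min c"
  unfolding cost_min_def using real_le_rsqrt[of "B/2" "c + B\<^sup>2/4"] by (simp add: power_divide)

lemma cost_min_pos: "0 < c \<Longrightarrow> 0 < cost_min c"
  unfolding cost_min_def using real_less_rsqrt[of "B/2" "c + B\<^sup>2/4"] by (simp add: power_divide)

lemma cost_nonneg: "0 \<le> c \<Longrightarrow> 0 \<le> cost c x v"
  using cost_min_le cost_min_nonneg by (meson mult_nonneg_nonneg norm_ge_zero order_trans)

lemma cost_max_pos: "0 < c \<Longrightarrow> 0 < cost_max c"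
  unfolding cost_max_def using B_nonneg by (simp add: add_pos_nonneg)

lemma cost_max_nonneg: "0 \<le> c \<Longrightarrow> 0 \<le> cost_max c"
  unfolding cost_max_def using B_nonneg by simp

lemma cost_le_max: 
  assumes "0 \<le> c"
  shows "cost c x v \<le> cost_max c * norm v"
proof -
  have "sqrt (c + (norm (W x))\<^sup>2 / 4) \<le> sqrt (c + B\<^sup>2 / 4)"
    using power_mono[OF W_bound[of x], of 2] by simp
  then have "sqrt (c + (norm (W x))\<^sup>2 / 4) * norm v \<le> sqrt (c + B\<^sup>2 / 4) * norm v"
    by (intro mult_right_mono) auto
  moreover have "- (W x \<bullet> v) \<le> B * norm v"
    using Cauchy_Schwarz_ineq2[of "W x" v] mult_right_mono[OF W_bound[of x] norm_ge_zero[of v]] by linarith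
  ultimately show ?thesis unfolding cost_def cost_max_def by (simp add: algebra_simps)
qed

lemma sqrt_concave:
  fixes a b t :: real
  assumes "0 \<le> a" "0 \<le> b" "0 \<le> t" "t \<le> 1"
  shows "t * sqrt a + (1 - t) * sqrt b \<le> sqrt (t * a + (1 - t) * b)"
proof (rule real_le_rsqrt)
  have "(t * sqrt a + (1 - t) * sqrt b)\<^sup>2 
      = t * (sqrt a)\<^sup>2 + (1 - t) * (sqrt b)\<^sup>2 - t * (1 - t) * (sqrt a - sqrt b)\<^sup>2"
    by (simp add: power2_eq_square algebra_simps)
  also have "\<dots> \<le> t * (sqrt a)\<^sup>2 + (1 - t) * (sqrt b)\<^sup>2"
    using assms by simp
  finally show "(t * sqrt a + (1 - t) * sqrt b)\<^sup>2 \<le> t * a + (1 - t) * b" using assms by simp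
qed

text \<open>Concavity in the level: averaging a strict subsolution with a non-strict one keeps part
  of the strictness.\<close>

lemma cost_concave:
  assumes "0 \<le> a" "0 \<le> b" "0 \<le> t" "t \<le> 1"
  shows "t * cost a x v + (1 - t) * cost b x v \<le> cost (t * a + (1 - t) * b) x v"
proof -
  let ?n = "(norm (W x))\<^sup>2 / 4"
  have "t * sqrt (a + ?n) + (1 - t) * sqrt (b + ?n) \<le> sqrt (t * (a + ?n) + (1 - t) * (b + ?n))"
    by (rule sqrt_concave) (use assms in auto)
  also have "t * (a + ?n) + (1 - t) * (b + ?n) = (t * a + (1 - t) * b) + ?n"
    by (simp add: field_simps)
  finally have "(t * sqrt (a + ?n) + (1 - t) * sqrt (b + ?n)) * norm v
      \<le> sqrt ((t * a + (1 - t) * b) + ?n) * norm v" by (intro mult_right_mono) auto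
  then show ?thesis unfolding cost_def by (simp add: field_simps)
qed

text \<open>Concavity between level \<open>c\<close> and level 0, where the cost is nonnegative
  because zero momentum has energy zero.\<close>

lemma cost_shrink:
  assumes "0 \<le> c" "0 \<le> t" "t \<le> 1"
  shows "t * cost c x v \<le> cost (t * c) x v"
proof -
  have "0 \<le> (1 - t) * cost 0 x v" using assms cost_nonneg[of 0 x v] by simp
  then show ?thesis using cost_concave[of c 0 t x v] assms by simp
qed

text \<open>A drop in level frees a fixed slope, uniformly in \<open>x\<close>, to be spent on small
  Lipschitz perturbations of a strict subsolution.\<close>

lemma cost_gap:
  assumes "0 \<le> c'" "c' < c"
  obtains k where "0 < k" "\<And>x v. cost c' x v + k * norm v \<le> cost c x v"
proof
  \<comment> \<open>The difference of two square roots is \<open>c - c'\<close> divided by their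
    sum, and that sum is at most \<open>2 * sqrt (c + B\<^sup>2 / 4)\<close>.\<close>
  let ?k = "(c - c') / (2 * sqrt (c + B\<^sup>2 / 4))"
  have p: "0 < sqrt (c + B\<^sup>2 / 4)" using assms by (simp add: add_pos_nonneg)
  then show "0 < ?k" using assms by simp
  fix x v :: "real^2"
  let ?n = "(norm (W x))\<^sup>2 / 4"
  have le: "sqrt (c + ?n) \<le> sqrt (c + B\<^sup>2 / 4)" using power_mono[OF W_bound[of x], of 2] by simp
  have le': "sqrt (c' + ?n) \<le> sqrt (c + ?n)" using assms by simp
  have "c - c' = (sqrt (c + ?n))\<^sup>2 - (sqrt (c' + ?n))\<^sup>2" using assms by simp
  also have "\<dots> = (sqrt (c + ?n) - sqrt (c' + ?n)) * (sqrt (c + ?n) + sqrt (c' + ?n))"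
    by (simp add: power2_eq_square algebra_simps)
  also have "\<dots> \<le> (sqrt (c + ?n) - sqrt (c' + ?n)) * (2 * sqrt (c + B\<^sup>2 / 4))"
    using le le' by (intro mult_left_mono) linarith+
  finally have "?k \<le> sqrt (c + ?n) - sqrt (c' + ?n)" using p by (simp add: divide_le_eq)
  then have "?k * norm v \<le> (sqrt (c + ?n) - sqrt (c' + ?n)) * norm v" by (intro mult_right_mono) auto
  then show "cost c' x v + ?k * norm v \<le> cost c x v" unfolding cost_def by (simp add: algebra_simps)
qed

lemma hamiltonian_eq: "(norm q)\<^sup>2 + W x \<bullet> q = (norm (q + W x /\<^sub>R 2))\<^sup>2 - (norm (W x))\<^sup>2 / 4"
  by (simp add: power2_norm_eq_inner inner_add_left inner_add_right inner_commute)

lemma inner_le_cost: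
  assumes "(norm q)\<^sup>2 + W x \<bullet> q \<le> c"
  shows "q \<bullet> v \<le> cost c x v"
proof -
  have "norm (q + W x /\<^sub>R 2) \<le> sqrt (c + (norm (W x))\<^sup>2 / 4)"
    by (rule real_le_rsqrt) (use assms hamiltonian_eq[of q x] in simp)
  then have "(q + W x /\<^sub>R 2) \<bullet> v \<le> sqrt (c + (norm (W x))\<^sup>2 / 4) * norm v"
    using norm_cauchy_schwarz[of "q + W x /\<^sub>R 2" v] mult_right_mono[OF _ norm_ge_zero] order_trans by blast
  then show ?thesis unfolding cost_def by (simp add: inner_add_left)
qed

lemma hamiltonian_le:
  assumes "0 \<le> c" "\<And>v. q \<bullet> v \<le> cost c x v"
  shows "(norm q)\<^sup>2 + W x \<bullet> q \<le> c"
proof -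
  \<comment> \<open>The direction from the centre of the sublevel ball to \<open>q\<close>, in which
    the support function detects whether \<open>q\<close> lies outside.\<close>
  let ?v = "q + W x /\<^sub>R 2" and ?s = "sqrt (c + (norm (W x))\<^sup>2 / 4)"
  have "norm ?v * norm ?v = q \<bullet> ?v + (W x \<bullet> ?v) / 2"
    unfolding power2_norm_eq_inner power2_eq_square[symmetric] by (simp add: inner_add_left)
  then have "norm ?v * norm ?v \<le> ?s * norm ?v"
    using assms(2)[of ?v] unfolding cost_def by simp
  then have "norm ?v \<le> ?s"
    by (metis assms(1) mult_right_le_imp_le norm_ge_zero not_le add_nonneg_nonneg divide_nonneg_pos
        real_sqrt_ge_zero zero_le_power2 zero_less_numeral less_eq_real_def)
  then have "(norm ?v)\<^sup>2 \<le> ?s\<^sup>2" by (intro power_mono) auto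
  then show ?thesis using hamiltonian_eq[of q x] assms(1) by simp
qed

section \<open>Dominated functions: from local to global\<close>

definition dominated :: "real \<Rightarrow> (real^2 \<Rightarrow> real) \<Rightarrow> bool" where
  "dominated c f \<longleftrightarrow> (\<forall>x y. f y - f x \<le> cost c x (y - x) + M * (norm (y - x))\<^sup>2)"

lemma dominatedD: "dominated c f \<Longrightarrow> f y - f x \<le> cost c x (y - x) + M * (norm (y - x))\<^sup>2"
  unfolding dominated_def by blast

text \<open>Cutting the segment into \<open>n\<close> pieces leaves a total quadratic error of K
  |v|^2 / n, which vanishes; only the bound on the cost along the segment survives.\<close>

lemma chain_bound:
  assumes c: "0 \<le> c" and r: "0 < r" and "0 \<le> K"
    and loc: "\<And>x y. norm (y - x) < r \<Longrightarrow> f y - f x \<le> cost c x (y - x) + K * (norm (y - x))\<^sup>2"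
    and G: "\<And>t. 0 \<le> t \<Longrightarrow> t \<le> 1 \<Longrightarrow> cost c (x + t *\<^sub>R v) v \<le> G"
  shows "f (x + v) - f x \<le> G"
proof -
  have ev: "f (x + v) - f x \<le> G + K * (norm v)\<^sup>2 / real n" if n: "norm v / r < real n" for n
  proof -
    have n0: "0 < real n" using n r by (meson divide_nonneg_pos le_less_trans norm_ge_zero)
    let ?y = "\<lambda>i. x + (real i / real n) *\<^sub>R v"
    have d: "?y (Suc i) - ?y i = (1 / real n) *\<^sub>R v" for i
      using n0 by (simp add: field_simps flip: scaleR_left_distrib scaleR_left_diff_distrib)
    have step: "f (?y (Suc i)) - f (?y i) \<le> G / n + K * (norm v)\<^sup>2 / n\<^sup>2" if "i < n" for i
    proof -
      have "norm ((1 / real n) *\<^sub>R v) < r" using n n0 r by (simp add: field_simps)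
      then have "f (?y (Suc i)) - f (?y i) \<le> cost c (?y i) ((1 / real n) *\<^sub>R v) + K * (norm ((1 / real n) *\<^sub>R v))\<^sup>2"
        using loc[of "?y (Suc i)" "?y i"] unfolding d by blast
      also have "cost c (?y i) ((1 / real n) *\<^sub>R v) = cost c (?y i) v / n"
        by (subst cost_scale) (use n0 in auto)
      also have "\<dots> \<le> G / n" using G[of "real i / real n"] that n0 by (intro divide_right_mono) auto
      finally show ?thesis using n0 by (simp add: power_mult_distrib power_divide)
    qed
    have "f (x + v) - f x = (\<Sum>i<n. f (?y (Suc i)) - f (?y i))"
      using sum_lessThan_telescope[of "\<lambda>i. f (?y i)" n] n0 by simp
    also have "\<dots> \<le> (\<Sum>i<n. G / n + K * (norm v)\<^sup>2 / n\<^sup>2)" by (intro sum_mono step) auto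
    also have "\<dots> = G + K * (norm v)\<^sup>2 / n" using n0 by (simp add: field_simps power2_eq_square)
    finally show ?thesis .
  qed
  have "(\<lambda>n. G + K * (norm v)\<^sup>2 / real n) \<longlonglongrightarrow> G + 0"
    by (intro tendsto_add tendsto_const lim_const_over_n)
  moreover have "\<forall>\<^sub>F n in sequentially. f (x + v) - f x \<le> G + K * (norm v)\<^sup>2 / real n"
    using ev by (metis (mono_tags, lifting) eventually_sequentiallyI reals_Archimedean2 less_le_trans of_nat_le_iff)
  ultimately show ?thesis by (metis tendsto_lowerbound trivial_limit_sequentially add.right_neutral)
qed

text \<open>Subdivision removes the local error, whatever \<open>r\<close> and \<open>K\<close> are,
  and along the segment the cost changes by at most \<open>M\<close> times the squared length.
  Gluing arguments thus always return to the constant \<open>M\<close>.\<close>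

lemma dominatedI:
  assumes c: "0 \<le> c" and r: "0 < r"
    and loc: "\<And>x y. norm (y - x) < r \<Longrightarrow> f y - f x \<le> cost c x (y - x) + K * (norm (y - x))\<^sup>2"
  shows "dominated c f"
  unfolding dominated_def
proof (intro allI)
  fix x y
  have loc': "f y - f x \<le> cost c x (y - x) + \<bar>K\<bar> * (norm (y - x))\<^sup>2" if "norm (y - x) < r" for x y
    using loc[OF that] mult_right_mono[OF abs_ge_self, of "(norm (y - x))\<^sup>2" K] by simp
  have "f (x + (y - x)) - f x \<le> cost c x (y - x) + M * (norm (y - x))\<^sup>2"
  proof (rule chain_bound[OF c r _ loc'])
    fix t :: real assume t: "0 \<le> t" "t \<le> 1"
    have "cost c (x + t *\<^sub>R (y - x)) (y - x) \<le> cost c x (y - x) + M * (t * norm (y - x)) * norm (y - x)"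
      using cost_lip[OF c, of "x + t *\<^sub>R (y - x)" "y - x" x] t by simp
    also have "M * (t * norm (y - x)) * norm (y - x) \<le> M * (1 * norm (y - x)) * norm (y - x)"
      using t M_nonneg by (intro mult_right_mono mult_left_mono) auto
    finally show "cost c (x + t *\<^sub>R (y - x)) (y - x) \<le> cost c x (y - x) + M * (norm (y - x))\<^sup>2"
      by (simp add: power2_eq_square mult.assoc)
  qed auto
  then show "f y - f x \<le> cost c x (y - x) + M * (norm (y - x))\<^sup>2" by simp
qed

lemma dominated_lip_le:
  assumes "0 \<le> c" "dominated c f"
  shows "f y - f x \<le> cost_max c * norm (y - x)"
proof -
  have "f (x + (y - x)) - f x \<le> cost_max c * norm (y - x)"
    by (rule chain_bound[of c 1 M]) (use assms M_nonneg cost_le_max in \<open>auto simp: dominated_def\<close>)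
  then show ?thesis by simp
qed

lemma dominated_lip:
  assumes "0 \<le> c" "dominated c f"
  shows "\<bar>f y - f x\<bar> \<le> cost_max c * norm (y - x)"
  using dominated_lip_le[OF assms, of y x] dominated_lip_le[OF assms, of x y]
  by (simp add: abs_le_iff norm_minus_commute)

lemma dominated_lipschitz:
  assumes "0 \<le> c" "dominated c f"
  shows "(cost_max c)-lipschitz_on UNIV f"
  using dominated_lip[OF assms] cost_max_nonneg[OF assms(1)]
  by (intro lipschitz_onI) (auto simp: dist_norm)

lemma dominated_continuous: "0 \<le> c \<Longrightarrow> dominated c f \<Longrightarrow> continuous_on S f"
  using lipschitz_on_continuous_on[OF dominated_lipschitz] continuous_on_subset by blast

lemma dominated_along:
  assumes c: "0 \<le> c" and f: "dominated c f"
    and G: "\<And>t. 0 \<le> t \<Longrightarrow> t \<le> 1 \<Longrightarrow> cost c (x + t *\<^sub>R v) v \<le> G"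
  shows "f (x + v) - f x \<le> G"
  by (rule chain_bound[of c 1 M]) (use assms M_nonneg in \<open>auto simp: dominated_def\<close>)

lemma dominated_mono: "dominated c f \<Longrightarrow> c \<le> c' \<Longrightarrow> dominated c' f"
  unfolding dominated_def using cost_mono by (meson add_right_mono order_trans)

lemma dominated_add_const: "dominated c f \<Longrightarrow> dominated c (\<lambda>x. f x + k)"
  unfolding dominated_def by simp

lemma dominated_convex:
  assumes "0 \<le> a" "0 \<le> b" "0 \<le> t" "t \<le> 1" "dominated a f" "dominated b g"
  shows "dominated (t * a + (1 - t) * b) (\<lambda>x. t * f x + (1 - t) * g x)"
  unfolding dominated_def
proof (intro allI)
  fix x y
  have "t * (f y - f x) \<le> t * (cost a x (y - x) + M * (norm (y - x))\<^sup>2)"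
    using assms by (intro mult_left_mono dominatedD) auto
  moreover have "(1 - t) * (g y - g x) \<le> (1 - t) * (cost b x (y - x) + M * (norm (y - x))\<^sup>2)"
    using assms by (intro mult_left_mono dominatedD) auto
  moreover note cost_concave[OF assms(1-4), of x "y - x"]
  ultimately show "t * f y + (1 - t) * g y - (t * f x + (1 - t) * g x)
    \<le> cost (t * a + (1 - t) * b) x (y - x) + M * (norm (y - x))\<^sup>2"
    by (simp add: algebra_simps)
qed

lemma dominated_SUP:
  assumes "I \<noteq> {}" "\<And>i. i \<in> I \<Longrightarrow> dominated c (f i)" "\<And>x. bdd_above ((\<lambda>i. f i x) ` I)"
  shows "dominated c (\<lambda>x. SUP i\<in>I. f i x)"
  unfolding dominated_def
proof (intro allI)
  fix x y
  have "(SUP i\<in>I. f i y) \<le> (SUP i\<in>I. f i x) + (cost c x (y - x) + M * (norm (y - x))\<^sup>2)"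
  proof (rule cSUP_least[OF assms(1)])
    fix i assume i: "i \<in> I"
    show "f i y \<le> (SUP i\<in>I. f i x) + (cost c x (y - x) + M * (norm (y - x))\<^sup>2)"
      using dominatedD[OF assms(2)[OF i], of y x] cSUP_upper[OF i assms(3)[of x]] by linarith
  qed
  then show "(SUP i\<in>I. f i y) - (SUP i\<in>I. f i x) \<le> cost c x (y - x) + M * (norm (y - x))\<^sup>2" by linarith
qed

lemma dominated_linear:
  assumes "0 \<le> c" "\<And>x. (norm p)\<^sup>2 + W x \<bullet> p \<le> c"
  shows "dominated c (\<lambda>x. p \<bullet> x)"
  unfolding dominated_def
proof (intro allI)
  fix x y
  show "p \<bullet> y - p \<bullet> x \<le> cost c x (y - x) + M * (norm (y - x))\<^sup>2"
    using inner_le_cost[OF assms(2), of "y - x" x] M_nonneg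
    by (simp add: inner_diff_right add_increasing2)
qed

end

section \<open>Admissible functions and the critical value\<close>

definition lattice :: "(real^2) set" where
  "lattice = {k. \<forall>i. k $ i \<in> \<int>}"

lemma vec2_decompose: "(k::real^2) = (k $ 1) *\<^sub>R axis 1 1 + (k $ 2) *\<^sub>R axis 2 1"
  by (simp add: vec_eq_iff forall_2 axis_def)

lemma lattice_closed [simp, intro]:
  "0 \<in> lattice" "k \<in> lattice \<Longrightarrow> - k \<in> lattice"
  "k \<in> lattice \<Longrightarrow> l \<in> lattice \<Longrightarrow> k + l \<in> lattice"
  "k \<in> lattice \<Longrightarrow> l \<in> lattice \<Longrightarrow> k - l \<in> lattice"
  "axis i 1 \<in> lattice"
  unfolding lattice_def by (auto simp: axis_def)

lemma torus_periodic_lattice: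
  assumes f: "torus_periodic f" and k: "k \<in> lattice"
  shows "f (x + k) = f x"
proof -
  have nat: "f (x + real n *\<^sub>R axis i 1) = f x" for n x i
  proof (induction n)
    case (Suc n)
    have "f (x + real (Suc n) *\<^sub>R axis i 1) = f ((x + real n *\<^sub>R axis i 1) + axis i 1)"
      by (simp add: algebra_simps)
    then show ?case using f Suc unfolding torus_periodic_def by metis
  qed simp
  have int: "f (x + real_of_int n *\<^sub>R axis i 1) = f x" for n x i
  proof (cases "0 \<le> n")
    case True
    then show ?thesis using nat[of x "nat n" i] by simp
  next
    case False
    then show ?thesis using nat[of "x + real_of_int n *\<^sub>R axis i 1" "nat (- n)" i] by simp
  qed
  obtain a b where ab: "k $ 1 = real_of_int a" "k $ 2 = real_of_int b"
    using k unfolding lattice_def by (auto elim!: Ints_cases) (metis Ints_cases)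
  have "f (x + k) = f ((x + real_of_int a *\<^sub>R axis 1 1) + real_of_int b *\<^sub>R axis 2 1)"
    using vec2_decompose[of k] ab by (simp add: add.assoc)
  then show ?thesis using int by metis
qed

lemma lattice_reduce: obtains k where "k \<in> lattice" "x + k \<in> cbox 0 (1::real^2)"
proof
  show "(\<chi> i. - real_of_int \<lfloor>x $ i\<rfloor>) \<in> lattice" unfolding lattice_def by simp
  show "x + (\<chi> i. - real_of_int \<lfloor>x $ i\<rfloor>) \<in> cbox 0 1"
    unfolding mem_box_cart by simp linarith
qed

lemma lattice_norm_ge_1:
  assumes "k \<in> lattice" "k \<noteq> 0" shows "1 \<le> norm k"
proof -
  obtain i where i: "k $ i \<noteq> 0" using assms(2) by (auto simp: vec_eq_iff)
  then have "1 \<le> \<bar>k $ i\<bar>" using assms(1) unfolding lattice_def by (simp add: Ints_nonzero_abs_ge1)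
  then show ?thesis using component_le_norm_cart order_trans by blast
qed

text \<open>Such an \<open>f\<close> is p . x plus a periodic corrector; keeping the linear part
  inside \<open>f\<close> removes \<open>p\<close> from the Hamiltonian.\<close>

definition equivariant :: "real^2 \<Rightarrow> (real^2 \<Rightarrow> real) \<Rightarrow> bool" where
  "equivariant p f \<longleftrightarrow> (\<forall>x i. f (x + axis i 1) = f x + p $ i)"

lemma equivariant_iff_periodic: "equivariant p f \<longleftrightarrow> torus_periodic (\<lambda>x. f x - p \<bullet> x)"
  unfolding equivariant_def torus_periodic_def
  by (simp add: inner_add_right inner_axis algebra_simps)

lemma equivariant_lattice: "equivariant p f \<Longrightarrow> k \<in> lattice \<Longrightarrow> f (x + k) = f x + p \<bullet> k"
  using torus_periodic_lattice[of "\<lambda>x. f x - p \<bullet> x" k x]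
  unfolding equivariant_iff_periodic by (simp add: inner_add_right)

context drift
begin

lemma W_lattice: "k \<in> lattice \<Longrightarrow> W (x + k) = W x"
  using torus_periodic_lattice[OF W_periodic] .

lemma cost_lattice: "k \<in> lattice \<Longrightarrow> cost c (x + k) v = cost c x v"
  unfolding cost_def by (simp add: W_lattice)

definition admissible :: "real \<Rightarrow> real^2 \<Rightarrow> (real^2 \<Rightarrow> real) \<Rightarrow> bool" where
  "admissible c p f \<longleftrightarrow> dominated c f \<and> equivariant p f"

definition levels :: "real^2 \<Rightarrow> real set" where
  "levels p = {c. 0 \<le> c \<and> (\<exists>f. admissible c p f)}"

definition crit :: "real^2 \<Rightarrow> real" where "crit p = Inf (levels p)"

lemma admissible_linear: "admissible ((norm p)\<^sup>2 + B * norm p) p (\<lambda>x. p \<bullet> x)"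
proof -
  have "W x \<bullet> p \<le> B * norm p" for x
    using norm_cauchy_schwarz[of "W x" p] mult_right_mono[OF W_bound[of x] norm_ge_zero[of p]] by linarith
  then have "dominated ((norm p)\<^sup>2 + B * norm p) (\<lambda>x. p \<bullet> x)"
    using B_nonneg by (intro dominated_linear) auto
  then show ?thesis unfolding admissible_def equivariant_def by (simp add: inner_add_right inner_axis)
qed

lemma levels_nonempty: "levels p \<noteq> {}"
proof -
  have "(norm p)\<^sup>2 + B * norm p \<in> levels p"
    using admissible_linear[of p] B_nonneg unfolding levels_def by auto
  then show ?thesis by auto
qed

lemma levels_bdd: "bdd_below (levels p)"
  unfolding levels_def by (auto intro: bdd_belowI)

lemma crit_le: "admissible c p f \<Longrightarrow> 0 \<le> c \<Longrightarrow> crit p \<le> c"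
  unfolding crit_def by (rule cInf_lower[OF _ levels_bdd]) (auto simp: levels_def)

lemma crit_greatest: "(\<And>c f. 0 \<le> c \<Longrightarrow> admissible c p f \<Longrightarrow> b \<le> c) \<Longrightarrow> b \<le> crit p"
  unfolding crit_def by (rule cInf_greatest[OF levels_nonempty]) (auto simp: levels_def)

lemma crit_nonneg: "0 \<le> crit p"
  by (rule crit_greatest)

text \<open>The Mane potential based at \<open>z\<close>: the largest admissible function vanishing
  there. If no function is admissible the supremum runs over the empty set, so the facts about it
  presuppose one.\<close>

definition potential :: "real \<Rightarrow> real^2 \<Rightarrow> real^2 \<Rightarrow> real^2 \<Rightarrow> real" where
  "potential c p z x = (SUP f\<in>{f. admissible c p f}. f x - f z)"

lemma potential_bdd: "0 \<le> c \<Longrightarrow> bdd_above ((\<lambda>f. f x - f z) ` {f. admissible c p f})"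
  using dominated_lip_le unfolding admissible_def bdd_above_def by blast

lemma potential_ge: "0 \<le> c \<Longrightarrow> admissible c p f \<Longrightarrow> f x - f z \<le> potential c p z x"
  unfolding potential_def by (rule cSUP_upper[OF _ potential_bdd]) auto

lemma potential_self [simp]:
  assumes "admissible c p f" shows "potential c p z z = 0"
  unfolding potential_def using assms by (auto intro!: cSUP_const)

lemma potential_admissible:
  assumes "0 \<le> c" "admissible c p f"
  shows "admissible c p (potential c p z)"
proof -
  have ne: "{f. admissible c p f} \<noteq> {}" using assms by blast
  have "dominated c (potential c p z)"
    unfolding potential_def
  proof (rule dominated_SUP[OF ne _ potential_bdd[OF assms(1)]])
    fix f assume "f \<in> {f. admissible c p f}"
    then have "dominated c (\<lambda>x. f x + - f z)" unfolding admissible_def using dominated_add_const by blast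
    then show "dominated c (\<lambda>x. f x - f z)" by simp
  qed
  moreover have "equivariant p (potential c p z)"
    unfolding equivariant_def
  proof (intro allI)
    fix x i
    have "potential c p z (x + axis i 1) = (SUP f\<in>{f. admissible c p f}. (f x - f z) + p $ i)"
      unfolding potential_def
      by (rule SUP_cong) (auto simp: admissible_def equivariant_def)
    also have "\<dots> = potential c p z x + p $ i"
      unfolding potential_def
    proof (rule antisym)
      show "(SUP f\<in>{f. admissible c p f}. (f x - f z) + p $ i)
          \<le> (SUP f\<in>{f. admissible c p f}. f x - f z) + p $ i"
        by (rule cSUP_least[OF ne])
          (rule add_right_mono, rule cSUP_upper[OF _ potential_bdd[OF assms(1)]])
      have bdd: "bdd_above ((\<lambda>f. (f x - f z) + p $ i) ` {f. admissible c p f})"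
      proof -
        obtain b where "\<And>f. admissible c p f \<Longrightarrow> f x - f z \<le> b"
          using potential_bdd[OF assms(1), of x z p] unfolding bdd_above_def by auto
        then show ?thesis by (intro bdd_aboveI[where M = "b + p $ i"]) auto
      qed
      have "(SUP f\<in>{f. admissible c p f}. f x - f z)
          \<le> (SUP f\<in>{f. admissible c p f}. (f x - f z) + p $ i) - p $ i"
        by (rule cSUP_least[OF ne]) (simp only: le_diff_eq, rule cSUP_upper[OF _ bdd])
      then show "(SUP f\<in>{f. admissible c p f}. f x - f z) + p $ i
          \<le> (SUP f\<in>{f. admissible c p f}. (f x - f z) + p $ i)" by simp
    qed
    finally show "potential c p z (x + axis i 1) = potential c p z x + p $ i" .
  qed
  ultimately show ?thesis unfolding admissible_def by blast
qed

lemma admissible_mono: "admissible c p f \<Longrightarrow> c \<le> c' \<Longrightarrow> admissible c' p f"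
  unfolding admissible_def using dominated_mono by blast

lemma admissible_convex:
  assumes "0 \<le> a" "0 \<le> b" "0 \<le> t" "t \<le> 1" "admissible a p f" "admissible b q g"
  shows "admissible (t * a + (1 - t) * b) (t *\<^sub>R p + (1 - t) *\<^sub>R q) (\<lambda>x. t * f x + (1 - t) * g x)"
  using dominated_convex[OF assms(1-4), of f g] assms(5,6)
  unfolding admissible_def equivariant_def by (simp add: algebra_simps)

text \<open>Potentials at levels decreasing to \<open>crit p\<close> decrease, since fewer functions
  compete at a lower level, and a common Lipschitz bound holds them from below. Their limit is
  dominated because the error constant is the same at all levels.\<close>

lemma crit_attained: obtains f where "admissible (crit p) p f"
proof -
  define c where "c n = crit p + 1 / real (Suc n)" for n
  have c0: "0 \<le> c n" for n using crit_nonneg[of p] unfolding c_def by simp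
  have ex: "\<exists>f. admissible (c n) p f" for n
  proof -
    have "Inf (levels p) < c n" unfolding c_def crit_def by simp
    then obtain a where "a \<in> levels p" "a < c n" using cInf_lessD[OF levels_nonempty] by blast
    then show ?thesis using admissible_mono[of a p _ "c n"] unfolding levels_def by auto
  qed
  define S where "S n = potential (c n) p 0" for n
  have S: "admissible (c n) p (S n)" for n
    using ex[of n] potential_admissible[OF c0] unfolding S_def by blast
  have S0: "S n 0 = 0" for n using ex[of n] unfolding S_def by auto
  have cdec: "c n \<le> c m" if "m \<le> n" for m n using that unfolding c_def by (simp add: frac_le)
  have dec: "S n x \<le> S m x" if "m \<le> n" for m n x
    using potential_ge[OF c0 admissible_mono[OF S cdec[OF that]], of x 0] S0 unfolding S_def by simp
  have low: "- (cost_max (c 0) * norm x) \<le> S n x" for n x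
    using dominated_lip[OF c0[of 0], of "S n" x 0] S0[of n] admissible_mono[OF S cdec[of 0 n]]
    unfolding admissible_def by simp
  have "convergent (\<lambda>n. S n x)" for x
  proof -
    have "Bseq (\<lambda>n. S n x)"
    proof (rule BseqI')
      fix n show "norm (S n x) \<le> \<bar>S 0 x\<bar> + \<bar>cost_max (c 0) * norm x\<bar>"
        using low[of x n] dec[of 0 n x] by simp
    qed
    moreover have "monoseq (\<lambda>n. S n x)" unfolding monoseq_def using dec by blast
    ultimately show ?thesis by (rule Bseq_monoseq_convergent)
  qed
  then have lim: "(\<lambda>n. S n x) \<longlonglongrightarrow> lim (\<lambda>n. S n x)" for x
    by (simp add: convergent_LIMSEQ_iff)
  let ?f = "\<lambda>x. lim (\<lambda>n. S n x)"
  have "c \<longlonglongrightarrow> crit p + 0"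
    unfolding c_def by (intro tendsto_add tendsto_const LIMSEQ_Suc[OF lim_const_over_n[of 1]])
  then have clim: "c \<longlonglongrightarrow> crit p" by simp
  have "dominated (crit p) ?f"
    unfolding dominated_def
  proof (intro allI)
    fix x y
    have "(\<lambda>n. cost (c n) x (y - x) + M * (norm (y - x))\<^sup>2)
        \<longlonglongrightarrow> cost (crit p) x (y - x) + M * (norm (y - x))\<^sup>2"
      unfolding cost_def by (intro tendsto_intros clim) auto
    moreover have "(\<lambda>n. S n y - S n x) \<longlonglongrightarrow> ?f y - ?f x" by (intro tendsto_diff lim)
    moreover have "S n y - S n x \<le> cost (c n) x (y - x) + M * (norm (y - x))\<^sup>2" for n
      using S unfolding admissible_def dominated_def by blast
    ultimately show "?f y - ?f x \<le> cost (crit p) x (y - x) + M * (norm (y - x))\<^sup>2"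
      by (meson LIMSEQ_le)
  qed
  moreover have "equivariant p ?f"
    unfolding equivariant_def
  proof (intro allI)
    fix x i
    have "(\<lambda>n. S n (x + axis i 1)) = (\<lambda>n. S n x + p $ i)"
      using S unfolding admissible_def equivariant_def by simp
    then have "(\<lambda>n. S n (x + axis i 1)) \<longlonglongrightarrow> ?f x + p $ i" by (simp add: tendsto_add lim)
    then show "?f (x + axis i 1) = ?f x + p $ i" by (rule limI)
  qed
  ultimately show ?thesis using that unfolding admissible_def by blast
qed

section \<open>Local domination and strict subsolutions\<close>

definition dominated_on :: "real \<Rightarrow> (real^2) set \<Rightarrow> (real^2 \<Rightarrow> real) \<Rightarrow> bool" where
  "dominated_on c V g \<longleftrightarrow>
     (\<exists>K. \<forall>x\<in>V. \<forall>y\<in>V. g y - g x \<le> cost c x (y - x) + K * (norm (y - x))\<^sup>2)"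

lemma dominated_onI:
  "(\<And>x y. x \<in> V \<Longrightarrow> y \<in> V \<Longrightarrow> g y - g x \<le> cost c x (y - x) + K * (norm (y - x))\<^sup>2)
    \<Longrightarrow> dominated_on c V g"
  unfolding dominated_on_def by blast

lemma dominated_onE:
  assumes "dominated_on c V g"
  obtains K where "0 \<le> K"
    "\<And>x y. x \<in> V \<Longrightarrow> y \<in> V \<Longrightarrow> g y - g x \<le> cost c x (y - x) + K * (norm (y - x))\<^sup>2"
proof -
  obtain K where K: "\<And>x y. x \<in> V \<Longrightarrow> y \<in> V \<Longrightarrow> g y - g x \<le> cost c x (y - x) + K * (norm (y - x))\<^sup>2"
    using assms unfolding dominated_on_def by blast
  show ?thesis
  proof
    show "0 \<le> \<bar>K\<bar>" by simp
    fix x y assume "x \<in> V" "y \<in> V"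
    then show "g y - g x \<le> cost c x (y - x) + \<bar>K\<bar> * (norm (y - x))\<^sup>2"
      using K[of x y] mult_right_mono[OF abs_ge_self, of "(norm (y - x))\<^sup>2" K] by simp
  qed
qed

lemma dominated_imp_on: "dominated c f \<Longrightarrow> dominated_on c V f"
  unfolding dominated_def dominated_on_def by blast

lemma dominated_on_add_const: "dominated_on c V g \<Longrightarrow> dominated_on c V (\<lambda>x. g x + k)"
  unfolding dominated_on_def by simp

lemma dominated_on_mono: "dominated_on c V g \<Longrightarrow> c \<le> c' \<Longrightarrow> dominated_on c' V g"
  unfolding dominated_on_def using cost_mono by (meson add_right_mono order_trans)

lemma dominated_on_shrink:
  assumes "0 \<le> c" "0 \<le> t" "t \<le> 1" "dominated_on c V g"
  shows "dominated_on (t * c) V (\<lambda>x. t * g x + k)"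
proof -
  obtain K where K: "0 \<le> K"
    "\<And>x y. x \<in> V \<Longrightarrow> y \<in> V \<Longrightarrow> g y - g x \<le> cost c x (y - x) + K * (norm (y - x))\<^sup>2"
    using dominated_onE[OF assms(4)] by blast
  show ?thesis
  proof (rule dominated_onI)
    fix x y assume "x \<in> V" "y \<in> V"
    then have "t * (g y - g x) \<le> t * (cost c x (y - x) + K * (norm (y - x))\<^sup>2)"
      using K assms by (intro mult_left_mono) auto
    then show "t * g y + k - (t * g x + k) \<le> cost (t * c) x (y - x) + (t * K) * (norm (y - x))\<^sup>2"
      using cost_shrink[OF assms(1-3), of x "y - x"] by (simp add: algebra_simps)
  qed
qed

lemma dominated_on_max:
  assumes "dominated_on c V f" "dominated_on c V g"
  shows "dominated_on c V (\<lambda>x. max (f x) (g x))"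
proof -
  obtain K where K: "\<And>x y. x \<in> V \<Longrightarrow> y \<in> V \<Longrightarrow> f y - f x \<le> cost c x (y - x) + K * (norm (y - x))\<^sup>2"
    using assms unfolding dominated_on_def by blast
  obtain L where L: "\<And>x y. x \<in> V \<Longrightarrow> y \<in> V \<Longrightarrow> g y - g x \<le> cost c x (y - x) + L * (norm (y - x))\<^sup>2"
    using assms unfolding dominated_on_def by blast
  have *: "K * (norm v)\<^sup>2 \<le> max K L * (norm v)\<^sup>2" "L * (norm v)\<^sup>2 \<le> max K L * (norm v)\<^sup>2" for v :: "real^2"
    by (intro mult_right_mono; simp)+
  show ?thesis
  proof (rule dominated_onI)
    fix x y assume xy: "x \<in> V" "y \<in> V"
    show "max (f y) (g y) - max (f x) (g x) \<le> cost c x (y - x) + max K L * (norm (y - x))\<^sup>2"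
      using K[OF xy] L[OF xy] *[of "y - x"] by linarith
  qed
qed

lemma dominated_on_continuous:
  assumes c: "0 \<le> c" and V: "V \<subseteq> ball z (1/2)" and g: "dominated_on c V g"
  shows "continuous_on V g"
proof -
  obtain K where K: "0 \<le> K"
    "\<And>x y. x \<in> V \<Longrightarrow> y \<in> V \<Longrightarrow> g y - g x \<le> cost c x (y - x) + K * (norm (y - x))\<^sup>2"
    using dominated_onE[OF g] by blast
  have le: "g y - g x \<le> (cost_max c + K) * norm (y - x)" if xy: "x \<in> V" "y \<in> V" for x y
  proof -
    have "dist y x < 1" using V xy dist_triangle_half_r[of z y 1 x] by (auto simp: subset_iff)
    then have "norm (y - x) \<le> 1" by (simp add: dist_norm)
    then have "K * (norm (y - x))\<^sup>2 \<le> K * norm (y - x)"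
      using K(1) by (intro mult_left_mono) (auto simp: power2_eq_square mult_left_le)
    then show ?thesis using K(2)[OF xy] cost_le_max[OF c, of x "y - x"] by (simp add: algebra_simps)
  qed
  have "(cost_max c + K)-lipschitz_on V g"
  proof (rule lipschitz_onI)
    fix x y assume xy: "x \<in> V" "y \<in> V"
    show "dist (g x) (g y) \<le> (cost_max c + K) * dist x y"
      using le[OF xy] le[OF xy(2,1)] by (simp add: dist_norm norm_minus_commute abs_le_iff)
  qed (use K(1) cost_max_nonneg[OF c] in auto)
  then show ?thesis by (rule lipschitz_on_continuous_on)
qed

text \<open>One function, one gap \<open>d\<close> and one radius \<open>r\<close> serve all points
  of \<open>T\<close>. This uniformity later yields a lower global level, or room for a tilt of
  fixed size.\<close>

definition strict_on :: "real \<Rightarrow> real^2 \<Rightarrow> (real^2) set \<Rightarrow> bool" where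
  "strict_on c p T \<longleftrightarrow> (\<exists>f d r K. admissible c p f \<and> 0 < d \<and> d \<le> c \<and> 0 < r \<and>
     (\<forall>z\<in>T. \<forall>x\<in>ball z r. \<forall>y\<in>ball z r. f y - f x \<le> cost (c - d) x (y - x) + K * (norm (y - x))\<^sup>2))"

lemma strict_onI:
  assumes "admissible c p f" "0 < d" "d \<le> c" "0 < r"
    "\<And>z x y. z \<in> T \<Longrightarrow> x \<in> ball z r \<Longrightarrow> y \<in> ball z r \<Longrightarrow>
      f y - f x \<le> cost (c - d) x (y - x) + K * (norm (y - x))\<^sup>2"
  shows "strict_on c p T"
  unfolding strict_on_def using assms by metis

lemma strict_onE:
  assumes "strict_on c p T"
  obtains f d r K where "admissible c p f" "0 < d" "d \<le> c" "0 < r"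
    "\<And>z x y. z \<in> T \<Longrightarrow> x \<in> ball z r \<Longrightarrow> y \<in> ball z r \<Longrightarrow>
      f y - f x \<le> cost (c - d) x (y - x) + K * (norm (y - x))\<^sup>2"
  using assms unfolding strict_on_def by blast

text \<open>The average of the two witnesses is strict on both sets with half of the smaller gap, by
  concavity of the cost in the level.\<close>

lemma strict_on_Un:
  assumes "strict_on c p S" "strict_on c p T"
  shows "strict_on c p (S \<union> T)"
proof -
  obtain f d r K where f: "admissible c p f" "0 < d" "d \<le> c" "0 < r"
    and fS: "\<And>z x y. z \<in> S \<Longrightarrow> x \<in> ball z r \<Longrightarrow> y \<in> ball z r \<Longrightarrow>
      f y - f x \<le> cost (c - d) x (y - x) + K * (norm (y - x))\<^sup>2"
    using assms(1) unfolding strict_on_def by blast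
  obtain g e s L where g: "admissible c p g" "0 < e" "e \<le> c" "0 < s"
    and gT: "\<And>z x y. z \<in> T \<Longrightarrow> x \<in> ball z s \<Longrightarrow> y \<in> ball z s \<Longrightarrow>
      g y - g x \<le> cost (c - e) x (y - x) + L * (norm (y - x))\<^sup>2"
    using assms(2) unfolding strict_on_def by blast
  define K' where "K' = max M (max K L)"
  have K': "a * (norm v)\<^sup>2 \<le> K' * (norm v)\<^sup>2" if "a = M \<or> a = K \<or> a = L" for a and v :: "real^2"
    using that unfolding K'_def by (intro mult_right_mono) auto
  have fM: "f y - f x \<le> cost c x (y - x) + K' * (norm (y - x))\<^sup>2"
    and gM: "g y - g x \<le> cost c x (y - x) + K' * (norm (y - x))\<^sup>2" for x y
    using f(1) g(1) K'[of M "y - x"] dominatedD[of c f y x] dominatedD[of c g y x]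
    unfolding admissible_def by auto
  let ?d = "min d e / 2" and ?h = "\<lambda>x. f x / 2 + g x / 2"
  have c: "0 \<le> c" using f by simp
  have avg: "cost a x v / 2 + cost b x v / 2 \<le> cost (c - ?d) x v"
    if "0 \<le> a" "0 \<le> b" "a + b \<le> 2 * c - min d e" for a b x v
    using cost_concave[OF that(1,2), of "1/2" x v] cost_mono[of "1/2 * a + (1 - 1/2) * b" "c - ?d" x v] that(3)
    by (simp add: field_simps)
  have "admissible c p ?h"
    using admissible_convex[OF c c, of "1/2" p f p g] f(1) g(1)
    by (simp add: field_simps flip: scaleR_left_distrib)
  moreover have "?h y - ?h x \<le> cost (c - ?d) x (y - x) + K' * (norm (y - x))\<^sup>2"
    if "z \<in> S \<union> T" "x \<in> ball z (min r s)" "y \<in> ball z (min r s)" for x y z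
  proof (cases "z \<in> S")
    case True
    then have "f y - f x \<le> cost (c - d) x (y - x) + K' * (norm (y - x))\<^sup>2"
      using fS[of z x y] that K'[of K "y - x"] by auto
    moreover have "cost (c - d) x (y - x) / 2 + cost c x (y - x) / 2 \<le> cost (c - ?d) x (y - x)"
      by (rule avg) (use f in auto)
    ultimately show ?thesis using gM[of y x] by (simp add: field_simps)
  next
    case False
    then have "g y - g x \<le> cost (c - e) x (y - x) + K' * (norm (y - x))\<^sup>2"
      using gT[of z x y] that K'[of L "y - x"] by auto
    moreover have "cost (c - e) x (y - x) / 2 + cost c x (y - x) / 2 \<le> cost (c - ?d) x (y - x)"
      by (rule avg) (use g in auto)
    ultimately show ?thesis using fM[of y x] by (simp add: field_simps)
  qed
  moreover have "0 < ?d" "?d \<le> c" "0 < min r s" using f g by auto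
  ultimately show ?thesis unfolding strict_on_def by blast
qed

lemma strict_on_subset: "strict_on c p T \<Longrightarrow> S \<subseteq> T \<Longrightarrow> strict_on c p S"
  unfolding strict_on_def by (meson subsetD)

lemma strict_on_ball:
  assumes "strict_on c p {z}"
  obtains r where "0 < r" "strict_on c p (ball z r)"
proof -
  obtain f d r K where f: "admissible c p f" "0 < d" "d \<le> c" "0 < r"
    and fS: "\<And>x y. x \<in> ball z r \<Longrightarrow> y \<in> ball z r \<Longrightarrow>
      f y - f x \<le> cost (c - d) x (y - x) + K * (norm (y - x))\<^sup>2"
    using assms unfolding strict_on_def by blast
  have "ball z' (r / 2) \<subseteq> ball z r" if "z' \<in> ball z (r / 2)" for z'
    using that by (intro ball_subset_ball_iff[THEN iffD2]) (auto simp: dist_commute)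
  then have "f y - f x \<le> cost (c - d) x (y - x) + K * (norm (y - x))\<^sup>2"
    if "z' \<in> ball z (r / 2)" "x \<in> ball z' (r / 2)" "y \<in> ball z' (r / 2)" for z' x y
    using that fS by blast
  then have "strict_on c p (ball z (r / 2))"
    using f(4) by (intro strict_onI[OF f(1-3), of "r/2" _ K]) (simp, blast)
  then show ?thesis using that[of "r/2"] f by simp
qed

lemma strict_on_compact:
  assumes T: "compact T" and ex: "admissible c p f" "0 < c" and all: "\<And>z. z \<in> T \<Longrightarrow> strict_on c p {z}"
  shows "strict_on c p T"
proof -
  let ?C = "{U. open U \<and> strict_on c p U}"
  have "T \<subseteq> \<Union>?C"
  proof
    fix z assume "z \<in> T"
    then obtain r where "0 < r" "strict_on c p (ball z r)" using strict_on_ball all by blast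
    then show "z \<in> \<Union>?C" by (auto intro!: bexI[of _ "ball z r"])
  qed
  then obtain D where D: "D \<subseteq> ?C" "finite D" "T \<subseteq> \<Union>D"
    using compactE[OF T, of ?C] by (metis (no_types, lifting) mem_Collect_eq)
  have "strict_on c p (\<Union>D)" using D(2,1)
  proof (induction D)
    case empty
    show ?case by (rule strict_onI[of c p f c 1]) (use ex in auto)
  next
    case (insert U D)
    then show ?case using strict_on_Un[of c p U "\<Union>D"] by simp
  qed
  then show ?thesis using strict_on_subset D(3) by blast
qed

lemma strict_on_translates:
  assumes "strict_on c p T"
  shows "strict_on c p {x + k |x k. x \<in> T \<and> k \<in> lattice}"
proof -
  obtain f d r K where f: "admissible c p f" "0 < d" "d \<le> c" "0 < r"
    and fS: "\<And>z x y. z \<in> T \<Longrightarrow> x \<in> ball z r \<Longrightarrow> y \<in> ball z r \<Longrightarrow>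
      f y - f x \<le> cost (c - d) x (y - x) + K * (norm (y - x))\<^sup>2"
    using assms unfolding strict_on_def by blast
  have "f y - f x \<le> cost (c - d) x (y - x) + K * (norm (y - x))\<^sup>2"
    if "z \<in> T" "k \<in> lattice" "x \<in> ball (z + k) r" "y \<in> ball (z + k) r" for z k x y
  proof -
    have eq: "f y - f x = f (y - k) - f (x - k)"
      using equivariant_lattice[of p f "-k" y] equivariant_lattice[of p f "-k" x] f(1) that(2)
      unfolding admissible_def by auto
    have "x - k \<in> ball z r" "y - k \<in> ball z r"
      using that(3,4) by (auto simp: dist_norm algebra_simps)
    then show ?thesis
      using fS[OF that(1), of "x - k" "y - k"] cost_lattice[of "-k" "c - d" x "y - x"] that(2)
      unfolding eq by auto
  qed
  then show ?thesis by (intro strict_onI[OF f, of _ K]) blast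
qed

text \<open>If every point were strict, compactness of the unit cell and lattice translation would
  give one function strict everywhere, hence admissible below the critical level.\<close>

lemma ex_not_strict:
  assumes "0 < crit p"
  obtains z where "\<not> strict_on (crit p) p {z}"
proof -
  obtain f0 where f0: "admissible (crit p) p f0" by (rule crit_attained)
  have False if "\<And>z. strict_on (crit p) p {z}"
  proof -
    have "strict_on (crit p) p (cbox 0 1)"
      by (rule strict_on_compact[OF compact_cbox f0 assms that])
    then have "strict_on (crit p) p {x + k |x k. x \<in> cbox 0 1 \<and> k \<in> lattice}"
      by (rule strict_on_translates)
    moreover have "{x + k |x k. x \<in> cbox 0 1 \<and> k \<in> lattice} = UNIV"
    proof -
      have "\<exists>y k. x = y + k \<and> y \<in> cbox 0 1 \<and> k \<in> lattice" for x
        using lattice_reduce[of x] by (metis add_diff_cancel_right' diff_conv_add_uminus lattice_closed(2))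
      then show ?thesis by blast
    qed
    ultimately have "strict_on (crit p) p UNIV" by simp
    then obtain f d r K where f: "admissible (crit p) p f" "0 < d" "d \<le> crit p" "0 < r"
      and fS: "\<And>z x y. z \<in> UNIV \<Longrightarrow> x \<in> ball z r \<Longrightarrow> y \<in> ball z r \<Longrightarrow>
        f y - f x \<le> cost (crit p - d) x (y - x) + K * (norm (y - x))\<^sup>2"
      by (rule strict_onE) metis
    have "dominated (crit p - d) f"
    proof (rule dominatedI[OF _ f(4), of _ _ K])
      fix x y :: "real^2" assume "norm (y - x) < r"
      then show "f y - f x \<le> cost (crit p - d) x (y - x) + K * (norm (y - x))\<^sup>2"
        using fS[of x x y] f(4) by (simp add: dist_norm norm_minus_commute)
    qed (use f in simp)
    then have "admissible (crit p - d) p f" using f unfolding admissible_def by blast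
    then have "crit p \<le> crit p - d" using crit_le f by simp
    then show False using f by simp
  qed
  then show ?thesis using that by blast
qed

end

section \<open>Maximality and viscosity solutions\<close>

context drift
begin

text \<open>Pastes a local subsolution onto \<open>f\<close> at all lattice translates of
  \<open>V\<close> at once. As \<open>V\<close> fits into a ball of radius 1/2, its translates are
  disjoint; as \<open>g\<close> is strictly below \<open>f\<close> on the frontier, the maximum
  equals \<open>f\<close> near it and no domination is lost at the seam.\<close>

lemma periodic_max:
  assumes c: "0 \<le> c" and f: "admissible c p f"
    and V: "compact V" "V \<subseteq> ball z (1/2)" and g: "dominated_on c V g"
    and fr: "\<And>x. x \<in> frontier V \<Longrightarrow> g x < f x"
  obtains w where "admissible c p w" "\<And>x. x \<in> V \<Longrightarrow> w x = max (f x) (g x)"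
    "\<And>x. (\<And>k. k \<in> lattice \<Longrightarrow> x + k \<notin> V) \<Longrightarrow> w x = f x"
proof -
  have fdom: "dominated c f" and feq: "equivariant p f" using f unfolding admissible_def by auto
  obtain K where K: "0 \<le> K"
    "\<And>x y. x \<in> V \<Longrightarrow> y \<in> V \<Longrightarrow> g y - g x \<le> cost c x (y - x) + K * (norm (y - x))\<^sup>2"
    using dominated_onE[OF g] by blast
  have cont: "continuous_on V f" "continuous_on V g"
    using dominated_continuous[OF c fdom] dominated_on_continuous[OF c V(2) g] by auto
  let ?V = "{x \<in> V. f x \<le> g x}"
  have cl: "closed V" using V(1) by (rule compact_imp_closed)
  have "closed ?V" by (rule continuous_on_closed_Collect_le[OF cont cl])
  moreover have "?V = V \<inter> ?V" by auto
  ultimately have cV: "compact ?V" using compact_Int_closed[OF V(1), of ?V] by argo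
  have "?V \<subseteq> interior V"
  proof
    fix x assume x: "x \<in> ?V"
    then have "x \<notin> frontier V" using fr[of x] by auto
    then show "x \<in> interior V" using x cl by (simp add: frontier_def closure_closed)
  qed
  with cV obtain \<rho> where \<rho>: "0 < \<rho>" "(\<Union>x\<in>?V. ball x \<rho>) \<subseteq> interior V"
    using compact_subset_open_imp_ball_epsilon_subset[OF _ open_interior] by blast
  define w0 where "w0 x = (if x \<in> V then max (f x) (g x) else f x)" for x
  have w0_ge: "f x \<le> w0 x" for x unfolding w0_def by simp
  have w0_dom: "dominated c w0"
  proof (rule dominatedI[OF c \<rho>(1), of _ "M + K"])
    fix x y :: "real^2" assume xy: "norm (y - x) < \<rho>"
    show "w0 y - w0 x \<le> cost c x (y - x) + (M + K) * (norm (y - x))\<^sup>2"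
    \<comment> \<open>An exact value is needed only at \<open>y\<close>; at \<open>x\<close> a lower
      bound for \<open>w0\<close> suffices. If \<open>g\<close> wins at \<open>y\<close>, the margin
      \<open>\<rho>\<close> puts \<open>x\<close> inside \<open>V\<close>.\<close>
    proof (cases "y \<in> ?V")
      case True
      have "x \<in> ball y \<rho>" using xy by (simp add: dist_norm)
      then have "x \<in> V" using \<rho>(2) True interior_subset[of V] by blast
      then have "w0 y = g y" "g x \<le> w0 x" using True unfolding w0_def by auto
      moreover have "0 \<le> M * (norm (y - x))\<^sup>2" using M_nonneg by simp
      ultimately show ?thesis using K(2)[OF \<open>x \<in> V\<close>, of y] True by (simp add: algebra_simps)
    next
      case False
      then have "w0 y = f y" unfolding w0_def by auto
      moreover have "0 \<le> K * (norm (y - x))\<^sup>2" using K by simp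
      ultimately show ?thesis using dominatedD[OF fdom, of y x] w0_ge[of x] by (simp add: algebra_simps)
    qed
  qed
  obtain D where D: "\<And>x. x \<in> V \<Longrightarrow> \<bar>g x - f x\<bar> \<le> D"
    using compact_imp_bounded[OF compact_continuous_image[OF continuous_on_diff[OF cont(2,1)] V(1)]]
    unfolding bounded_iff by auto
  let ?t = "\<lambda>k x. w0 (x + k) - p \<bullet> k"
  have t_le: "?t k x \<le> f x + \<bar>D\<bar>" if "k \<in> lattice" for k x
  proof -
    have "w0 (x + k) \<le> f (x + k) + \<bar>D\<bar>" unfolding w0_def using D[of "x + k"] by auto
    then show ?thesis using equivariant_lattice[OF feq that, of x] by simp
  qed
  have bdd: "bdd_above ((\<lambda>k. ?t k x) ` lattice)" for x
    using t_le by (intro bdd_aboveI[where M = "f x + \<bar>D\<bar>"]) auto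
  have ne: "lattice \<noteq> {}" by blast
  \<comment> \<open>Taking the supremum over all lattice translates restores equivariance without
    choosing a fundamental cell.\<close>
  define w where "w x = (SUP k\<in>lattice. ?t k x)" for x
  have "dominated c w"
    unfolding w_def
  proof (rule dominated_SUP[OF ne _ bdd])
    fix k :: "real^2" assume k: "k \<in> lattice"
    show "dominated c (\<lambda>x. w0 (x + k) - p \<bullet> k)"
      unfolding dominated_def
    proof (intro allI)
      fix x y :: "real^2"
      show "w0 (y + k) - p \<bullet> k - (w0 (x + k) - p \<bullet> k) \<le> cost c x (y - x) + M * (norm (y - x))\<^sup>2"
        using dominatedD[OF w0_dom, of "y + k" "x + k"] cost_lattice[OF k] by simp
    qed
  qed
  moreover have shift: "w (x + l) \<le> w x + p \<bullet> l" if l: "l \<in> lattice" for x l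
    unfolding w_def[of "x + l"]
  proof (rule cSUP_least[OF ne])
    fix k assume k: "k \<in> lattice"
    have "?t (l + k) x \<le> w x" unfolding w_def by (rule cSUP_upper[OF _ bdd]) (use k l in simp)
    then show "w0 (x + l + k) - p \<bullet> k \<le> w x + p \<bullet> l" by (simp add: inner_add_right add.assoc)
  qed
  have "equivariant p w"
    unfolding equivariant_def
  proof (intro allI antisym)
    fix x and i :: 2
    show "w (x + axis i 1) \<le> w x + p $ i" using shift[of "axis i 1" x] by (simp add: inner_axis)
    show "w x + p $ i \<le> w (x + axis i 1)"
      using shift[of "- axis i 1" "x + axis i 1"] by (simp add: inner_axis)
  qed
  ultimately have "admissible c p w" unfolding admissible_def by blast
  moreover have "w x = max (f x) (g x)" if x: "x \<in> V" for x
  proof (rule antisym)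
    have "?t 0 x \<le> w x" unfolding w_def by (rule cSUP_upper[OF _ bdd]) simp
    then show "max (f x) (g x) \<le> w x" using x unfolding w0_def by simp
    show "w x \<le> max (f x) (g x)"
      unfolding w_def
    proof (rule cSUP_least[OF ne])
      fix k assume k: "k \<in> lattice"
      show "?t k x \<le> max (f x) (g x)"
      proof (cases "k = 0")
        case True then show ?thesis using x unfolding w0_def by simp
      next
        case False
        have "x + k \<notin> V"
        proof
          assume "x + k \<in> V"
          then have "dist (x + k) x < 1"
            using V(2) x dist_triangle_half_r[of z "x + k" 1 x] by (auto simp: subset_iff)
          then show False using lattice_norm_ge_1[OF k False] by (simp add: dist_norm)
        qed
        then show ?thesis unfolding w0_def using equivariant_lattice[OF feq k, of x] by simp
      qed
    qed
  qed
  moreover have "w x = f x" if x: "\<And>k. k \<in> lattice \<Longrightarrow> x + k \<notin> V" for x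
  proof -
    have "?t k x = f x" if "k \<in> lattice" for k
      unfolding w0_def using x[OF that] equivariant_lattice[OF feq that, of x] by simp
    then have "w x = (SUP k\<in>lattice. f x)" unfolding w_def by (intro SUP_cong) auto
    then show ?thesis using ne by simp
  qed
  ultimately show ?thesis using that by blast
qed

text \<open>Raising an admissible function at a point makes it strict there: near that point the raised
  function may be multiplied by \<open>1 - \<kappa>\<close>, which lowers its level since the Hamiltonian vanishes
  at zero momentum.\<close>

lemma strict_on_if_raised:
  assumes c: "0 < c" and f: "admissible c p f"
    and V: "compact V" "V \<subseteq> ball z (1/2)" and g: "dominated_on c V g"
    and fr: "\<And>x. x \<in> frontier V \<Longrightarrow> g x < f x"
    and y: "y \<in> V" "f y < g y"
  shows "strict_on c p {y}"
proof -
  have c0: "0 \<le> c" using c by simp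
  have fdom: "dominated c f" using f unfolding admissible_def by auto
  have contf: "continuous_on V f" by (rule dominated_continuous[OF c0 fdom])
  have "V \<noteq> {}" using y by auto
  then obtain x0 where "x0 \<in> V" "\<And>x. x \<in> V \<Longrightarrow> f x0 \<le> f x"
    using continuous_attains_inf[OF V(1) _ contf] by blast
  then obtain m where m: "\<And>x. x \<in> V \<Longrightarrow> m \<le> f x" "m \<le> f y" using y(1) by metis
  \<comment> \<open>Passing from \<open>g\<close> to \<open>h\<close> costs
    \<open>k * (g y - m)\<close> at \<open>y\<close>; this \<open>k\<close> makes it half of the
    excess \<open>g y - f y\<close>. Since \<open>m\<close> bounds \<open>f\<close> from below on
    \<open>V\<close>, \<open>h\<close> stays under \<open>f\<close> on the frontier.\<close>
  define k where "k = (g y - f y) / (2 * (g y - m))"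
  have gm: "0 < g y - m" using m(2) y(2) by simp
  have k: "0 < k" "k \<le> 1/2" "k * (g y - m) = (g y - f y) / 2"
    unfolding k_def using gm y(2) m(2) by (auto simp: divide_simps)
  define h where "h x = (1 - k) * g x + k * m" for x
  have h: "dominated_on ((1 - k) * c) V h"
    unfolding h_def by (rule dominated_on_shrink[OF c0 _ _ g]) (use k in auto)
  have hc: "dominated_on c V h"
    by (rule dominated_on_mono[OF h]) (use k c in \<open>simp add: algebra_simps\<close>)
  have "g y - h y = k * (g y - m)" unfolding h_def by (simp add: algebra_simps)
  then have hy: "f y < h y" using k(3) y(2) by simp
  have hfr: "h x < f x" if x: "x \<in> frontier V" for x
  proof -
    have "x \<in> V" using x V(1) compact_imp_closed frontier_subset_closed by blast
    then have "k * m \<le> k * f x" "(1 - k) * g x < (1 - k) * f x"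
      using m(1) k fr[OF x] by (auto intro!: mult_left_mono mult_strict_left_mono)
    then show ?thesis unfolding h_def by (simp add: algebra_simps)
  qed
  obtain w where w: "admissible c p w" "\<And>x. x \<in> V \<Longrightarrow> w x = max (f x) (h x)"
    using periodic_max[OF c0 f V hc hfr] by metis
  have "y \<in> interior V"
    using hfr[of y] hy y(1) V(1) by (auto simp: frontier_def closure_closed compact_imp_closed)
  moreover have "open {x \<in> interior V. f x < h x}"
  proof -
    have "continuous_on (interior V) (\<lambda>x. h x - f x)"
      using continuous_on_diff[OF dominated_on_continuous[OF c0 V(2) hc] contf] interior_subset
      by (rule continuous_on_subset)
    then have "open ((\<lambda>x. h x - f x) -` {0<..} \<inter> interior V)"
      using open_interior open_greaterThan by (simp add: continuous_on_open_vimage)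
    moreover have "(\<lambda>x. h x - f x) -` {0<..} \<inter> interior V = {x \<in> interior V. f x < h x}" by auto
    ultimately show ?thesis by simp
  qed
  ultimately obtain r where r: "0 < r" "ball y r \<subseteq> {x \<in> interior V. f x < h x}"
    using hy unfolding open_contains_ball by blast
  have wh: "w x = h x" "x \<in> V" if "x \<in> ball y r" for x
  proof -
    have "x \<in> interior V" "f x < h x" using r(2) that by auto
    then show "x \<in> V" "w x = h x" using w(2)[of x] interior_subset[of V] by (auto simp: max_def)
  qed
  obtain K where "0 \<le> K" and K: "\<And>x y. x \<in> V \<Longrightarrow> y \<in> V \<Longrightarrow>
      h y - h x \<le> cost ((1 - k) * c) x (y - x) + K * (norm (y - x))\<^sup>2"
    using dominated_onE[OF h] by blast
  show ?thesis
  proof (rule strict_onI[OF w(1), of "k * c" r _ K])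
    fix z' x x' assume "z' \<in> {y}" "x \<in> ball z' r" "x' \<in> ball z' r"
    then show "w x' - w x \<le> cost (c - k * c) x (x' - x) + K * (norm (x' - x))\<^sup>2"
      using K[of x x'] wh by (simp add: algebra_simps)
  qed (use k c r in auto)
qed

text \<open>The supersolution property in comparison form, free of test functions; the competitors
  may be any local subsolutions, such as maxima of cones and barriers.\<close>

definition locally_maximal :: "real \<Rightarrow> (real^2 \<Rightarrow> real) \<Rightarrow> bool" where
  "locally_maximal c f \<longleftrightarrow> (\<forall>z V g. compact V \<longrightarrow> V \<subseteq> ball z (1/2) \<longrightarrow> dominated_on c V g \<longrightarrow>
     (\<forall>x\<in>frontier V. g x \<le> f x) \<longrightarrow> (\<forall>x\<in>V. g x \<le> f x))"

lemma locally_maximalD: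
  assumes "locally_maximal c f" "compact V" "V \<subseteq> ball z (1/2)" "dominated_on c V g"
    "\<And>x. x \<in> frontier V \<Longrightarrow> g x \<le> f x" "x \<in> V"
  shows "g x \<le> f x"
  using assms unfolding locally_maximal_def by blast

text \<open>A competitor exceeding the potential could be pasted onto it. The result is still at
  most 0 at \<open>z\<close>, as raising a translate of \<open>z\<close> would make \<open>z\<close>
  strict; so an admissible function would beat the largest one.\<close>

lemma potential_locally_maximal:
  assumes c: "0 < c" and ex: "admissible c p f0" and ns: "\<not> strict_on c p {z}"
  shows "locally_maximal c (potential c p z)"
  unfolding locally_maximal_def
proof (intro allI impI ballI)
  fix a V g x
  assume V: "compact V" "V \<subseteq> ball a (1/2)" and g: "dominated_on c V g"
    and fr: "\<forall>x\<in>frontier V. g x \<le> potential c p z x" and x: "x \<in> V"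
  let ?f = "potential c p z"
  have f: "admissible c p ?f" using potential_admissible ex c by simp
  have feq: "equivariant p ?f" using f unfolding admissible_def by auto
  have f0: "?f z = 0" using ex by simp
  show "g x \<le> ?f x"
  proof (rule ccontr)
    assume "\<not> g x \<le> ?f x"
    then have gx: "?f x < g x" by simp
    \<comment> \<open>Lowering by half of the excess makes the frontier inequality strict and still
      leaves \<open>h\<close> above the potential at \<open>x\<close>.\<close>
    define h where "h y = g y + - ((g x - ?f x) / 2)" for y
    have h: "dominated_on c V h" unfolding h_def by (rule dominated_on_add_const[OF g])
    have hfr: "h y < ?f y" if "y \<in> frontier V" for y
    proof -
      have "g y \<le> potential c p z y" using fr that by blast
      then show ?thesis using gx unfolding h_def by argo
    qed
    have hx: "?f x < h x" using gx unfolding h_def by (simp add: field_simps)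
    obtain w where w: "admissible c p w" "\<And>y. y \<in> V \<Longrightarrow> w y = max (?f y) (h y)"
      "\<And>y. (\<And>k. k \<in> lattice \<Longrightarrow> y + k \<notin> V) \<Longrightarrow> w y = ?f y"
      using periodic_max[OF less_imp_le[OF c] f V h hfr] by metis
    have "w z \<le> 0"
    proof (cases "\<exists>k\<in>lattice. z + k \<in> V")
      case True
      then obtain k where k: "k \<in> lattice" "z + k \<in> V" by blast
      have "h (z + k) \<le> ?f (z + k)"
      proof (rule ccontr)
        assume "\<not> h (z + k) \<le> ?f (z + k)"
        then have "strict_on c p {z + k}"
          using strict_on_if_raised[OF c f V h hfr k(2)] by simp
        then have "strict_on c p {x + l |x l. x \<in> {z + k} \<and> l \<in> lattice}" by (rule strict_on_translates)
        moreover have "{z} \<subseteq> {x + l |x l. x \<in> {z + k} \<and> l \<in> lattice}"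
          using k(1) by (auto intro!: exI[of _ "- k"])
        ultimately show False using ns strict_on_subset by blast
      qed
      then have "w (z + k) = ?f (z + k)" using w(2)[OF k(2)] by simp
      then have "w z = ?f z"
        using w(1) equivariant_lattice[OF _ k(1)] feq unfolding admissible_def by (metis add_right_cancel)
      then show ?thesis using f0 by simp
    qed (use w(3) f0 in auto)
    moreover have "w x - w z \<le> ?f x" using potential_ge[of c p w x z] w(1) c by simp
    ultimately show False using w(2)[OF x] hx by simp
  qed
qed

text \<open>Domination is applied from x - s v to x, where touching bounds the increment from below
  by about s (q . v). Dividing by a small \<open>s\<close> bounds \<open>q\<close> by the support
  function.\<close>

lemma dominated_touch_above:
  assumes c: "0 \<le> c" and f: "dominated c f"
    and t: "\<And>e. 0 < e \<Longrightarrow> \<forall>\<^sub>F y in nhds x. f y \<le> f x + q \<bullet> (y - x) + e * norm (y - x)"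
  shows "(norm q)\<^sup>2 + W x \<bullet> q \<le> c"
proof (rule hamiltonian_le[OF c], rule field_le_epsilon)
  fix v :: "real^2" and e :: real assume e: "0 < e"
  define e' where "e' = e / (2 * (norm v + 1))"
  have n: "0 < norm v + 1" by (simp add: add_nonneg_pos)
  have e': "0 < e'" "e' * norm v \<le> e / 2"
    unfolding e'_def using e n by (auto simp: field_simps)
  obtain d where d: "0 < d" "\<And>y. dist y x < d \<Longrightarrow> f y \<le> f x + q \<bullet> (y - x) + e' * norm (y - x)"
    using t[OF e'(1)] unfolding eventually_nhds_metric by blast
  \<comment> \<open>Keeps x - s v within the touching radius \<open>d\<close>, and lets the two
    quadratic errors, that of domination and that of moving the base point, cost at most e / 2
    together.\<close>
  define s where "s = min (d / (2 * (norm v + 1))) (e / (4 * (M + 1) * (norm v + 1)\<^sup>2))"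
  have "0 < 4 * (M + 1) * (norm v + 1)\<^sup>2" using n M_nonneg by (intro mult_pos_pos zero_less_power) auto
  then have s: "0 < s" unfolding s_def using d(1) e n by simp
  have "s * norm v \<le> d / (2 * (norm v + 1)) * norm v" unfolding s_def by (intro mult_right_mono) auto
  also have "\<dots> < d" using d(1) n by (simp add: field_simps add_strict_increasing)
  finally have sd: "s * norm v < d" .
  have "s \<le> e / (4 * (M + 1) * (norm v + 1)\<^sup>2)" unfolding s_def by simp
  then have "s * (4 * (M + 1) * (norm v + 1)\<^sup>2) \<le> e"
    using n M_nonneg by (simp add: pos_le_divide_eq)
  moreover have "s * (4 * M * (norm v)\<^sup>2) \<le> s * (4 * (M + 1) * (norm v + 1)\<^sup>2)"
    using s M_nonneg by (intro mult_left_mono mult_mono power_mono) auto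
  ultimately have sM: "2 * M * s * (norm v)\<^sup>2 \<le> e / 2" by (simp add: algebra_simps)
  let ?y = "x - s *\<^sub>R v"
  have "f ?y \<le> f x - s * (q \<bullet> v) + e' * (s * norm v)"
    using d(2)[of ?y] sd s by (simp add: dist_norm)
  moreover have "f x - f ?y \<le> cost c ?y (s *\<^sub>R v) + M * (s * norm v)\<^sup>2"
    using dominatedD[OF f, of x ?y] s by simp
  moreover have "cost c ?y (s *\<^sub>R v) \<le> s * (cost c x v + M * (s * norm v) * norm v)"
    using cost_lip[OF c, of ?y v x] s by (simp add: cost_scale)
  ultimately have "s * (q \<bullet> v) \<le> s * (cost c x v + M * (s * norm v) * norm v) + M * (s * norm v)\<^sup>2 + e' * (s * norm v)"
    by linarith
  also have "\<dots> = s * (cost c x v + 2 * M * s * (norm v)\<^sup>2 + e' * norm v)"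
    by (simp add: algebra_simps power2_eq_square)
  also have "\<dots> \<le> s * (cost c x v + e)" using s sM e'(2) by (intro mult_left_mono) auto
  finally show "q \<bullet> v \<le> cost c x v + e" using s by simp
qed

text \<open>If the energy of \<open>q\<close> were below \<open>c\<close>, a downward cone tilted by
  \<open>q\<close> and lifted a little would be a local subsolution lying under \<open>f\<close> on
  a small sphere and over it at the vertex.\<close>

lemma locally_maximal_touch_below:
  assumes c: "0 < c" and f: "locally_maximal c f"
    and t: "\<And>e. 0 < e \<Longrightarrow> \<forall>\<^sub>F y in nhds x. f x + q \<bullet> (y - x) - e * norm (y - x) \<le> f y"
  shows "c \<le> (norm q)\<^sup>2 + W x \<bullet> q"
proof (rule ccontr)
  assume "\<not> c \<le> (norm q)\<^sup>2 + W x \<bullet> q"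
  \<comment> \<open>The gap estimate starts from a nonnegative level, hence the maximum with
    0.\<close>
  define c' where "c' = max 0 ((norm q)\<^sup>2 + W x \<bullet> q)"
  have c': "0 \<le> c'" "c' < c" unfolding c'_def using c \<open>\<not> c \<le> _\<close> by auto
  obtain k where k: "0 < k" "\<And>y v. cost c' y v + k * norm v \<le> cost c y v"
    using cost_gap[OF c'] by blast
  have q: "q \<bullet> v \<le> cost c' x v" for v by (rule inner_le_cost) (simp add: c'_def)
  obtain d where d: "0 < d" "\<And>y. dist y x < d \<Longrightarrow> f x + q \<bullet> (y - x) - k / 8 * norm (y - x) \<le> f y"
    using t[of "k / 8"] k(1) unfolding eventually_nhds_metric by auto
  define r where "r = min (1/4) (min (d / 2) (k / (4 * (M + 1))))"
  have r: "0 < r" "r < 1/2" "r < d" unfolding r_def using d k M_nonneg by auto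
  have "r \<le> k / (4 * (M + 1))" unfolding r_def by simp
  then have rM: "M * r \<le> k / 4" using M_nonneg r(1) by (simp add: pos_le_divide_eq) (simp add: algebra_simps)
  \<comment> \<open>The free slope \<open>k\<close> pays \<open>k / 4\<close> for the cone and
    \<open>k / 4\<close> for moving the base point. On the sphere the cone loses
    \<open>k * r / 4\<close>, the lift returns half of it, and the remaining
    \<open>k * r / 8\<close> matches the touching error.\<close>
  define g where "g y = f x + q \<bullet> (y - x) - k / 4 * norm (y - x) + k / 8 * r" for y
  have "g x \<le> f x"
  proof (rule locally_maximalD[OF f compact_cball[of x r]])
    show "cball x r \<subseteq> ball x (1/2)" using r by auto
    show "dominated_on c (cball x r) g"
    proof (rule dominated_onI[of _ _ _ 0])
      fix y z assume "y \<in> cball x r" "z \<in> cball x r"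
      then have y: "norm (x - y) \<le> r" by (simp add: dist_norm)
      have "g z - g y = q \<bullet> (z - y) - k / 4 * (norm (z - x) - norm (y - x))"
        unfolding g_def by (simp add: inner_diff_right algebra_simps)
      moreover have "norm (y - x) - norm (z - x) \<le> norm (z - y)"
        using norm_triangle_ineq2[of "y - x" "z - x"] by (simp add: norm_minus_commute)
      then have "k / 4 * (norm (y - x) - norm (z - x)) \<le> k / 4 * norm (z - y)"
        using k(1) by (intro mult_left_mono) auto
      then have "- (k / 4 * (norm (z - x) - norm (y - x))) \<le> k / 4 * norm (z - y)"
        by (simp add: algebra_simps)
      moreover have "cost c x (z - y) \<le> cost c y (z - y) + k / 4 * norm (z - y)"
      proof -
        have "M * norm (x - y) * norm (z - y) \<le> M * r * norm (z - y)"
          using y M_nonneg by (intro mult_right_mono mult_left_mono) auto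
        also have "\<dots> \<le> k / 4 * norm (z - y)" using rM by (intro mult_right_mono) auto
        finally show ?thesis using cost_lip[of c x "z - y" y] c by simp
      qed
      moreover note q[of "z - y"] k(2)[of x "z - y"]
      moreover have "0 \<le> k * norm (z - y)" using k by simp
      ultimately show "g z - g y \<le> cost c y (z - y) + 0 * (norm (z - y))\<^sup>2" by (simp add: field_simps)
    qed
    show "g y \<le> f y" if "y \<in> frontier (cball x r)" for y
    proof -
      have "norm (y - x) = r" using that by (simp add: dist_norm norm_minus_commute)
      then show ?thesis using d(2)[of y] r unfolding g_def by (simp add: dist_norm)
    qed
    show "x \<in> cball x r" using r by simp
  qed
  then show False using mult_pos_pos[OF k(1) r(1)] unfolding g_def by simp
qed

end

lemma GDERIV_expansion:
  assumes "GDERIV \<phi> x :> D" "0 < e"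
  shows "\<forall>\<^sub>F y in nhds x. \<bar>\<phi> y - \<phi> x - D \<bullet> (y - x)\<bar> \<le> e * norm (y - x)"
  using assms unfolding gderiv_def has_derivative_at_alt eventually_nhds_metric dist_norm real_norm_def
  by (metis inner_commute)

context drift
begin

lemma cell_problem_solvableI:
  assumes c: "0 < c" and f: "admissible c p f" and lm: "locally_maximal c f"
  shows "cell_problem_solvable W p c"
  unfolding cell_problem_solvable_def
proof (intro exI conjI)
  let ?u = "\<lambda>x. f x - p \<bullet> x"
  have fdom: "dominated c f" and feq: "equivariant p f" using f unfolding admissible_def by auto
  show "torus_periodic ?u" using feq unfolding equivariant_iff_periodic .
  have c0: "0 \<le> c" using c by simp
  have lip: "(cost_max c + norm p)-lipschitz_on UNIV ?u"
  proof (intro lipschitz_onI)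
    fix x y
    have "\<bar>p \<bullet> (y - x)\<bar> \<le> norm p * norm (y - x)" by (rule Cauchy_Schwarz_ineq2)
    then show "dist (?u x) (?u y) \<le> (cost_max c + norm p) * dist x y"
      using dominated_lip[OF c0 fdom, of y x]
      by (simp add: dist_norm norm_minus_commute algebra_simps)
  qed (use cost_max_nonneg[OF c0] in simp)
  then show "(cost_max c + norm p)-lipschitz_on UNIV ?u" .
  have cont: "continuous_on UNIV ?u" using lip by (rule lipschitz_on_continuous_on)
  show "viscosity_solution (\<lambda>x q. (norm (p + q))\<^sup>2 + W x \<bullet> (p + q) - c) ?u"
    unfolding viscosity_solution_def viscosity_subsolution_def viscosity_supersolution_def
  proof (intro conjI cont allI impI)
    fix \<phi> D x assume "C1_with_gradient \<phi> D"
    then have D: "GDERIV \<phi> x :> D x" unfolding C1_with_gradient_def by blast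
    have ev: "\<forall>\<^sub>F y in nhds x. \<bar>\<phi> y - \<phi> x - D x \<bullet> (y - x)\<bar> \<le> e * norm (y - x)" if "0 < e" for e
      by (rule GDERIV_expansion[OF D that])
    {
      assume m: "\<forall>\<^sub>F y in nhds x. ?u y - \<phi> y \<le> ?u x - \<phi> x"
      have "(norm (p + D x))\<^sup>2 + W x \<bullet> (p + D x) \<le> c"
      proof (rule dominated_touch_above[OF c0 fdom])
        fix e :: real assume "0 < e"
        show "\<forall>\<^sub>F y in nhds x. f y \<le> f x + (p + D x) \<bullet> (y - x) + e * norm (y - x)"
          using ev[OF \<open>0 < e\<close>] m
          by eventually_elim (simp add: abs_le_iff inner_add_left inner_diff_right)
      qed
      then show "(norm (p + D x))\<^sup>2 + W x \<bullet> (p + D x) - c \<le> 0" by simp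
    next
      assume m: "\<forall>\<^sub>F y in nhds x. ?u y - \<phi> y \<ge> ?u x - \<phi> x"
      have "c \<le> (norm (p + D x))\<^sup>2 + W x \<bullet> (p + D x)"
      proof (rule locally_maximal_touch_below[OF c lm])
        fix e :: real assume "0 < e"
        show "\<forall>\<^sub>F y in nhds x. f x + (p + D x) \<bullet> (y - x) - e * norm (y - x) \<le> f y"
          using ev[OF \<open>0 < e\<close>] m
          by eventually_elim (simp add: abs_le_iff inner_add_left inner_diff_right)
      qed
      then show "(norm (p + D x))\<^sup>2 + W x \<bullet> (p + D x) - c \<ge> 0" by simp
    }
  qed
qed

lemma cell_problem_solvable_crit:
  assumes "0 < crit p" shows "cell_problem_solvable W p (crit p)"
proof -
  obtain f where f: "admissible (crit p) p f" by (rule crit_attained)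
  obtain z where "\<not> strict_on (crit p) p {z}" using ex_not_strict[OF assms] by blast
  then show ?thesis
    using cell_problem_solvableI[OF assms potential_admissible] potential_locally_maximal[OF assms f] f
      crit_nonneg by blast
qed

section \<open>Uniqueness of the constant by doubling of variables\<close>

lemma norm_le_2_of_unit_cell: "x \<in> cbox 0 (1::real^2) \<Longrightarrow> norm x \<le> 2"
  using norm_le_l1_cart[of x] unfolding mem_box_cart sum_2 by (simp add: forall_2)

text \<open>With the penalty |x - y|^2 / e both tests at a maximum have the same momentum
  \<open>q\<close>, so the constants differ by at most (W y0 - W x0) . (p + q). The Lipschitz bounds
  give |x0 - y0| <= K e and |q| <= 2 K, which makes this O(e).\<close>

lemma cell_problem_comparison:
  assumes 1: "cell_problem_solvable W p c\<^sub>1" and 2: "cell_problem_solvable W p c\<^sub>2"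
  shows "c\<^sub>2 \<le> c\<^sub>1"
proof -
  obtain u L where u: "torus_periodic u" "L-lipschitz_on UNIV u"
    "viscosity_subsolution (\<lambda>x q. (norm (p + q))\<^sup>2 + W x \<bullet> (p + q) - c\<^sub>1) u"
    using 1 unfolding cell_problem_solvable_def viscosity_solution_def by blast
  obtain v L' where v: "torus_periodic v" "L'-lipschitz_on UNIV v"
    "viscosity_supersolution (\<lambda>x q. (norm (p + q))\<^sup>2 + W x \<bullet> (p + q) - c\<^sub>2) v"
    using 2 unfolding cell_problem_solvable_def viscosity_solution_def by blast
  define K where "K = max L L'"
  have K: "0 \<le> K" using lipschitz_on_nonneg[OF u(2)] unfolding K_def by simp
  have uK: "\<bar>u x - u y\<bar> \<le> K * norm (x - y)" for x y
    using lipschitz_onD[OF u(2), of x y] mult_right_mono[of L K "norm (x - y)"]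
    unfolding K_def by (simp add: dist_norm)
  have vK: "\<bar>v x - v y\<bar> \<le> K * norm (x - y)" for x y
    using lipschitz_onD[OF v(2), of x y] mult_right_mono[of L' K "norm (x - y)"]
    unfolding K_def by (simp add: dist_norm)
  have main: "c\<^sub>2 - c\<^sub>1 \<le> e * (M * K * (norm p + 2 * K))" if e: "0 < e" "e \<le> 1" for e
  proof -
    let ?\<Phi> = "\<lambda>z. u (fst z) - v (snd z) - (norm (fst z - snd z))\<^sup>2 / e"
    \<comment> \<open>Shifting both variables by the same lattice vector puts \<open>x\<close> into
      the unit cell, of norm at most 2, and pairs with |x - y| > K are no better than the diagonal;
      hence the radius \<open>K + 2\<close>.\<close>
    let ?C = "cbox 0 (1::real^2) \<times> cball (0::real^2) (K + 2)"
    have "continuous_on ?C (\<lambda>z. u (fst z))"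
      by (rule continuous_on_compose2[OF lipschitz_on_continuous_on[OF u(2)]])
        (auto intro: continuous_intros)
    moreover have "continuous_on ?C (\<lambda>z. v (snd z))"
      by (rule continuous_on_compose2[OF lipschitz_on_continuous_on[OF v(2)]])
        (auto intro: continuous_intros)
    ultimately have "continuous_on ?C ?\<Phi>"
      by (rule continuous_on_diff[OF continuous_on_diff])
        (intro continuous_intros, use e in simp)
    moreover have "compact ?C" by (intro compact_Times compact_cbox compact_cball)
    moreover have "(0, 0) \<in> ?C" using K by (simp add: mem_box_cart)
    then have "?C \<noteq> {}" by blast
    ultimately obtain m where m: "m \<in> ?C" "\<And>z. z \<in> ?C \<Longrightarrow> ?\<Phi> z \<le> ?\<Phi> m"
      using continuous_attains_sup[of ?C ?\<Phi>] by blast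
    obtain x0 y0 where xy0: "m = (x0, y0)" by (cases m)
    have glob: "u x - v y - (norm (x - y))\<^sup>2 / e \<le> u x0 - v y0 - (norm (x0 - y0))\<^sup>2 / e" for x y
    proof -
      have near: "u x - v y - (norm (x - y))\<^sup>2 / e \<le> u x0 - v y0 - (norm (x0 - y0))\<^sup>2 / e"
        if xy: "norm (x - y) \<le> K" for x y
      proof -
        obtain k where k: "k \<in> lattice" "x + k \<in> cbox 0 1" using lattice_reduce by blast
        have "norm (y + k) \<le> norm (x + k) + norm (y - x)"
          using norm_triangle_ineq[of "x + k" "y - x"] by (simp add: algebra_simps)
        then have "(x + k, y + k) \<in> ?C"
          using k xy norm_le_2_of_unit_cell[OF k(2)] by (simp add: norm_minus_commute)
        from m(2)[OF this] show ?thesis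
          using torus_periodic_lattice[OF u(1) k(1)] torus_periodic_lattice[OF v(1) k(1)]
          unfolding xy0 by simp
      qed
      show ?thesis
      proof (cases "norm (x - y) \<le> K")
        case False
        then have "K * e * norm (x - y) \<le> norm (x - y) * norm (x - y)"
          using e K mult_left_le[of e K] by (intro mult_right_mono) auto
        then have "K * norm (x - y) \<le> (norm (x - y))\<^sup>2 / e"
          using e by (simp add: field_simps power2_eq_square)
        then have "u x - v y - (norm (x - y))\<^sup>2 / e \<le> u x - v x - (norm (x - x))\<^sup>2 / e"
          using vK[of x y] by (simp add: abs_le_iff)
        then show ?thesis using near[of x x] K by simp
      qed (rule near)
    qed
    define q where "q = (2 / e) *\<^sub>R (x0 - y0)"
    have xy: "norm (x0 - y0) \<le> K * e"
    proof -
      have "(norm (x0 - y0))\<^sup>2 / e \<le> K * norm (x0 - y0)"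
        using glob[of y0 y0] uK[of x0 y0] by (simp add: abs_le_iff)
      then have "norm (x0 - y0) * norm (x0 - y0) \<le> (K * e) * norm (x0 - y0)"
        using e by (simp add: field_simps power2_eq_square)
      then show ?thesis
        using K e by (cases "norm (x0 - y0) = 0") (auto simp: mult_le_cancel_right)
    qed
    have gd: "GDERIV (\<lambda>x. s * (norm (x - a))\<^sup>2) x :> (2 * s) *\<^sub>R (x - a)" for s a and x :: "real^2"
      unfolding gderiv_def power2_norm_eq_inner
      by (auto intro!: derivative_eq_intros simp: inner_commute algebra_simps)
    have C1: "C1_with_gradient (\<lambda>x. s * (norm (x - a))\<^sup>2) (\<lambda>x. (2 * s) *\<^sub>R (x - a))" for s a
      unfolding C1_with_gradient_def using gd by (auto intro!: continuous_intros)
    have testu: "(norm (p + D x))\<^sup>2 + W x \<bullet> (p + D x) - c\<^sub>1 \<le> 0"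
      if "C1_with_gradient \<phi> D" "\<forall>\<^sub>F y in nhds x. u y - \<phi> y \<le> u x - \<phi> x" for \<phi> D x
      using u(3) that unfolding viscosity_subsolution_def by blast
    have testv: "(norm (p + D x))\<^sup>2 + W x \<bullet> (p + D x) - c\<^sub>2 \<ge> 0"
      if "C1_with_gradient \<phi> D" "\<forall>\<^sub>F y in nhds x. v y - \<phi> y \<ge> v x - \<phi> x" for \<phi> D x
      using v(3) that unfolding viscosity_supersolution_def by blast
    have "u y - (1/e) * (norm (y - y0))\<^sup>2 \<le> u x0 - (1/e) * (norm (x0 - y0))\<^sup>2" for y
      using glob[of y y0] by simp
    then have "(norm (p + (2 * (1/e)) *\<^sub>R (x0 - y0)))\<^sup>2 + W x0 \<bullet> (p + (2 * (1/e)) *\<^sub>R (x0 - y0)) - c\<^sub>1 \<le> 0"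
      by (intro testu[OF C1[of "1/e" y0]] always_eventually) simp
    then have sub: "(norm (p + q))\<^sup>2 + W x0 \<bullet> (p + q) - c\<^sub>1 \<le> 0" unfolding q_def by simp
    have "v y - (-1/e) * (norm (y - x0))\<^sup>2 \<ge> v y0 - (-1/e) * (norm (y0 - x0))\<^sup>2" for y
      using glob[of x0 y] by (simp add: norm_minus_commute)
    then have "(norm (p + (2 * (-1/e)) *\<^sub>R (y0 - x0)))\<^sup>2 + W y0 \<bullet> (p + (2 * (-1/e)) *\<^sub>R (y0 - x0)) - c\<^sub>2 \<ge> 0"
      by (intro testv[OF C1[of "-1/e" x0]] always_eventually) simp
    moreover have "(2 * (-1/e)) *\<^sub>R (y0 - x0) = q" unfolding q_def by (simp add: algebra_simps)
    ultimately have super: "(norm (p + q))\<^sup>2 + W y0 \<bullet> (p + q) - c\<^sub>2 \<ge> 0" by metis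
    have "c\<^sub>2 - c\<^sub>1 \<le> (W y0 - W x0) \<bullet> (p + q)" using sub super by (simp add: inner_diff_left)
    also have "\<dots> \<le> norm (W y0 - W x0) * norm (p + q)" by (rule norm_cauchy_schwarz)
    also have "\<dots> \<le> (M * (K * e)) * (norm p + 2 * K)"
    proof (rule mult_mono)
      show "norm (W y0 - W x0) \<le> M * (K * e)"
        using W_lip[of y0 x0] mult_left_mono[OF xy M_nonneg] by (simp add: norm_minus_commute)
      have "norm q = 2 / e * norm (x0 - y0)" unfolding q_def norm_scaleR using e by simp
      also have "\<dots> \<le> 2 / e * (K * e)" using xy e by (intro mult_left_mono) auto
      finally have "norm q \<le> 2 * K" using e by simp
      then show "norm (p + q) \<le> norm p + 2 * K" using norm_triangle_ineq[of p q] by simp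
    qed (use M_nonneg K e in auto)
    finally show ?thesis by (simp add: algebra_simps)
  qed
  have "c\<^sub>2 - c\<^sub>1 \<le> 0 + d" if d: "0 < d" for d
  proof -
    let ?N = "M * K * (norm p + 2 * K)"
    have N: "0 \<le> ?N" using M_nonneg K by simp
    define e where "e = min 1 (d / (?N + 1))"
    have e: "0 < e" "e \<le> 1" unfolding e_def using d N by (auto simp: add_nonneg_pos)
    have "e * ?N \<le> d / (?N + 1) * ?N" unfolding e_def using N by (intro mult_right_mono) auto
    also have "\<dots> \<le> d" using d N by (simp add: field_simps)
    finally show ?thesis using main[OF e] by simp
  qed
  then have "c\<^sub>2 - c\<^sub>1 \<le> 0" by (rule field_le_epsilon)
  then show ?thesis by simp
qed

theorem effective_Hamiltonian_eq_crit:
  assumes "0 < crit p" shows "effective_Hamiltonian W p = crit p"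
  unfolding effective_Hamiltonian_def
  using cell_problem_solvable_crit[OF assms] cell_problem_comparison
  by (intro the_equality antisym) auto

end

section \<open>Conjugate pairs and semiconcavity\<close>

context drift
begin

text \<open>The negative of a subsolution for \<open>W\<close> and \<open>p\<close> is one for
  \<open>- W\<close> and \<open>- p\<close>. Statements about smallest functions and local
  minimality thus follow from those about largest functions and local maximality.\<close>

lemma reversed: "drift (\<lambda>x. - W x) M B"
  using W_lip W_bound W_periodic
  by unfold_locales (auto simp: torus_periodic_def norm_minus_commute)

lemma reversed_cost: "drift.cost (\<lambda>x. - W x) c x v = cost c x (- v)"
  unfolding cost_def drift.cost_def[OF reversed] by simp

lemma cost_reverse_le:
  assumes "0 \<le> c" shows "cost c y (x - y) \<le> cost c x (x - y) + M * (norm (y - x))\<^sup>2"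
  using cost_lip[OF assms, of y "x - y" x] by (simp add: norm_minus_commute power2_eq_square mult.assoc)

lemma reversed_dominated_on:
  assumes "0 \<le> c"
  shows "drift.dominated_on (\<lambda>x. - W x) c V (\<lambda>x. - f x) \<longleftrightarrow> dominated_on c V f"
proof
  assume "dominated_on c V f"
  then obtain K where "0 \<le> K" and K: "\<And>x y. x \<in> V \<Longrightarrow> y \<in> V \<Longrightarrow> f y - f x \<le> cost c x (y - x) + K * (norm (y - x))\<^sup>2"
    using dominated_onE by blast
  show "drift.dominated_on (\<lambda>x. - W x) c V (\<lambda>x. - f x)"
  \<comment> \<open>Exchanging \<open>x\<close> and \<open>y\<close> moves the base point of the
    cost, which adds \<open>M\<close> to the error constant.\<close>
  proof (rule drift.dominated_onI[OF reversed, of _ _ _ "K + M"])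
    fix x y assume "x \<in> V" "y \<in> V"
    then show "- f y - - f x \<le> drift.cost (\<lambda>x. - W x) c x (y - x) + (K + M) * (norm (y - x))\<^sup>2"
      using K[of y x] cost_reverse_le[OF assms, of y x]
      by (simp add: reversed_cost norm_minus_commute algebra_simps)
  qed
next
  assume "drift.dominated_on (\<lambda>x. - W x) c V (\<lambda>x. - f x)"
  then obtain K where "0 \<le> K" and K: "\<And>x y. x \<in> V \<Longrightarrow> y \<in> V \<Longrightarrow>
      - f y - - f x \<le> drift.cost (\<lambda>x. - W x) c x (y - x) + K * (norm (y - x))\<^sup>2"
    using drift.dominated_onE[OF reversed] by blast
  show "dominated_on c V f"
  proof (rule dominated_onI[of _ _ _ "K + M"])
    fix x y assume "x \<in> V" "y \<in> V"
    then show "f y - f x \<le> cost c x (y - x) + (K + M) * (norm (y - x))\<^sup>2"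
      using K[of y x] cost_lip[OF assms, of y "y - x" x]
      by (simp add: reversed_cost norm_minus_commute algebra_simps power2_eq_square)
  qed
qed

lemma dominated_iff_on: "0 \<le> c \<Longrightarrow> dominated c f \<longleftrightarrow> dominated_on c UNIV f"
  using dominated_imp_on dominatedI[of c 1] unfolding dominated_on_def by (metis UNIV_I zero_less_one)

lemma reversed_dominated:
  assumes "0 \<le> c"
  shows "drift.dominated (\<lambda>x. - W x) M c (\<lambda>x. - f x) \<longleftrightarrow> dominated c f"
  unfolding dominated_iff_on[OF assms] drift.dominated_iff_on[OF reversed assms]
    reversed_dominated_on[OF assms] ..

lemma reversed_admissible:
  assumes "0 \<le> c"
  shows "drift.admissible (\<lambda>x. - W x) M c (- p) (\<lambda>x. - f x) \<longleftrightarrow> admissible c p f"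
  unfolding admissible_def drift.admissible_def[OF reversed] reversed_dominated[OF assms]
  by (auto simp: equivariant_def algebra_simps)

lemma reversed_strict_on:
  assumes "0 \<le> c" "drift.strict_on (\<lambda>x. - W x) M c (- p) T"
  shows "strict_on c p T"
proof -
  obtain f d r K where f: "drift.admissible (\<lambda>x. - W x) M c (- p) f" "0 < d" "d \<le> c" "0 < r"
    and fT: "\<And>z x y. z \<in> T \<Longrightarrow> x \<in> ball z r \<Longrightarrow> y \<in> ball z r \<Longrightarrow>
      f y - f x \<le> drift.cost (\<lambda>x. - W x) (c - d) x (y - x) + K * (norm (y - x))\<^sup>2"
    using drift.strict_onE[OF reversed assms(2)] by metis
  show ?thesis
  proof (rule strict_onI[of c p "\<lambda>x. - f x" d r T "K + M"])
    show "admissible c p (\<lambda>x. - f x)" using f(1) reversed_admissible[OF assms(1), of p "\<lambda>x. - f x"] by simp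
    fix z x y assume "z \<in> T" "x \<in> ball z r" "y \<in> ball z r"
    then show "- f y - - f x \<le> cost (c - d) x (y - x) + (K + M) * (norm (y - x))\<^sup>2"
      using fT[of z y x] cost_lip[of "c - d" y "y - x" x] f(3)
      by (simp add: reversed_cost norm_minus_commute algebra_simps power2_eq_square)
  qed (use f in auto)
qed

definition locally_minimal :: "real \<Rightarrow> (real^2 \<Rightarrow> real) \<Rightarrow> bool" where
  "locally_minimal c f \<longleftrightarrow> drift.locally_maximal (\<lambda>x. - W x) c (\<lambda>x. - f x)"

lemma locally_minimalD:
  assumes "0 \<le> c" "locally_minimal c f" "compact V" "V \<subseteq> ball z (1/2)" "dominated_on c V g"
    "\<And>x. x \<in> frontier V \<Longrightarrow> f x \<le> g x" "x \<in> V"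
  shows "f x \<le> g x"
proof -
  have "- g x \<le> - f x"
    by (rule drift.locally_maximalD[OF reversed, of c "\<lambda>x. - f x" V z "\<lambda>x. - g x"])
      (use assms reversed_dominated_on[OF assms(1), of V g] in \<open>auto simp: locally_minimal_def\<close>)
  then show ?thesis by simp
qed

text \<open>If \<open>z\<close> carries no strict admissible function, the largest and the smallest admissible functions
  vanishing at \<open>z\<close> are viscosity solutions of the forward and the reversed problem, respectively.\<close>

lemma conjugate_pair:
  assumes c: "0 < c" and ex: "admissible c p f0" and ns: "\<not> strict_on c p {z}"
    and sym: "\<And>h. admissible c p h \<Longrightarrow> admissible c p (h \<circ> \<sigma>)" "\<sigma> z = z" "\<And>x. \<sigma> (\<sigma> x) = x"
  obtains f g where "admissible c p f" "admissible c p g" "locally_maximal c f" "locally_minimal c g"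
    "\<And>x. g x \<le> f x" "f z = g z" "\<And>x. f (\<sigma> x) = f x" "\<And>x. g (\<sigma> x) = g x"
proof -
  have c0: "0 \<le> c" using c by simp
  let ?f = "potential c p z"
  let ?h = "drift.potential (\<lambda>x. - W x) M c (- p) z"
  let ?g = "\<lambda>x. - ?h x"
  have ex': "drift.admissible (\<lambda>x. - W x) M c (- p) (\<lambda>x. - f0 x)"
    using reversed_admissible[OF c0] ex by blast
  have h: "drift.admissible (\<lambda>x. - W x) M c (- p) ?h"
    by (rule drift.potential_admissible[OF reversed c0 ex'])
  have adm: "admissible c p ?f" "admissible c p ?g"
    using potential_admissible[OF c0 ex] h reversed_admissible[OF c0, of p ?g] by auto
  have z0: "?f z = 0" "?h z = 0" using ex drift.potential_self[OF reversed ex'] by auto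
  have lm: "locally_maximal c ?f" by (rule potential_locally_maximal[OF c ex ns])
  have "\<not> drift.strict_on (\<lambda>x. - W x) M c (- p) {z}" using reversed_strict_on[OF c0] ns by blast
  then have "drift.locally_maximal (\<lambda>x. - W x) c ?h"
    by (rule drift.potential_locally_maximal[OF reversed c ex'])
  then have ln: "locally_minimal c ?g" unfolding locally_minimal_def by simp
  have le: "?g x \<le> ?f x" for x using potential_ge[OF c0 adm(2), of x z] z0 by simp
  have fs: "?f x \<le> ?f (\<sigma> x)" for x
    using potential_ge[OF c0 sym(1)[OF adm(1)], of "\<sigma> x" z] sym(2,3) z0 by simp
  have gs: "?g (\<sigma> x) \<le> ?g x" for x
  proof -
    have "admissible c p (?g \<circ> \<sigma>)" by (rule sym(1)[OF adm(2)])
    then have "drift.admissible (\<lambda>x. - W x) M c (- p) (\<lambda>x. - (?g \<circ> \<sigma>) x)"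
      using reversed_admissible[OF c0] by blast
    from drift.potential_ge[OF reversed c0 this, of "\<sigma> x" z]
    show ?thesis using sym(2,3) z0 by simp
  qed
  have "?f (\<sigma> x) = ?f x" "?g (\<sigma> x) = ?g x" for x
    using fs[of x] fs[of "\<sigma> x"] gs[of x] gs[of "\<sigma> x"] sym(3) by (simp_all add: antisym)
  then show ?thesis using that[OF adm lm ln le] z0 by simp
qed

end

section \<open>Semiconcavity of locally maximal functions\<close>

locale smooth_drift = drift +
  fixes C\<^sub>2 :: real
  assumes W_second_difference: "0 \<le> t \<Longrightarrow> t \<le> 1 \<Longrightarrow>
    norm (t *\<^sub>R W (x + (1 - t) *\<^sub>R d) + (1 - t) *\<^sub>R W (x - t *\<^sub>R d) - W x) \<le> C\<^sub>2 * (t * (1 - t) * (norm d)\<^sup>2)"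
begin

lemma reversed_smooth: "smooth_drift (\<lambda>x. - W x) M B C\<^sub>2"
proof -
  interpret rev: drift "\<lambda>x. - W x" M B by (rule reversed)
  show ?thesis
  proof
    fix t :: real and x d assume t: "0 \<le> t" "t \<le> 1"
    have "t *\<^sub>R - W (x + (1 - t) *\<^sub>R d) + (1 - t) *\<^sub>R - W (x - t *\<^sub>R d) - - W x
       = - (t *\<^sub>R W (x + (1 - t) *\<^sub>R d) + (1 - t) *\<^sub>R W (x - t *\<^sub>R d) - W x)" by simp
    then show "norm (t *\<^sub>R - W (x + (1 - t) *\<^sub>R d) + (1 - t) *\<^sub>R - W (x - t *\<^sub>R d) - - W x)
        \<le> C\<^sub>2 * (t * (1 - t) * (norm d)\<^sup>2)"
      using W_second_difference[OF t] by (simp only: norm_minus_cancel)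
  qed
qed

lemma C2_nonneg: "0 \<le> C\<^sub>2"
proof -
  have "0 \<le> C\<^sub>2 * (1/2 * (1 - 1/2) * (norm (axis 1 1 :: real^2))\<^sup>2)"
    by (rule order_trans[OF norm_ge_zero W_second_difference]) auto
  then show ?thesis by simp
qed

text \<open>The variance identity: squares have an exact weighted second difference.\<close>

lemma weighted_norm_sq:
  fixes a b :: "'a::real_inner"
  shows "t * (norm a)\<^sup>2 + (1 - t) * (norm b)\<^sup>2
    = (norm (t *\<^sub>R a + (1 - t) *\<^sub>R b))\<^sup>2 + t * (1 - t) * (norm (a - b))\<^sup>2"
  unfolding power2_norm_eq_inner
  by (simp add: inner_add_left inner_add_right inner_diff_left inner_diff_right inner_commute algebra_simps)

lemma mult_le_weighted_squares:
  fixes a b s :: real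
  assumes "0 < s" shows "a * b \<le> (s * a\<^sup>2 + b\<^sup>2 / s) / 2"
proof -
  have "0 \<le> (s * a - b)\<^sup>2 / s" using assms by simp
  also have "\<dots> = s * a\<^sup>2 + b\<^sup>2 / s - 2 * (a * b)"
    using assms by (simp add: power2_eq_square field_simps)
  finally show ?thesis by simp
qed

text \<open>The cost contains the product of sqrt (c + |W|^2 / 4) and |v|. Bounding it by weighted
  squares, with the weight |v| / N that gives equality at the centre, reduces the claim to second
  differences of squares. The factor 4 bounding \<open>\<Delta>\<close> is the slope of the cutoff
  in the semiconcavity proof.\<close>

lemma cost_second_difference:
  assumes c: "0 < c" and t: "0 \<le> t" "t \<le> 1" and \<psi>: "0 \<le> \<psi>" "\<psi> \<le> 1" and d: "norm d \<le> 1"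
    and \<Delta>: "\<bar>\<Delta>\<bar> \<le> 4 * norm v"
  shows "t * cost c (x + (1 - t) *\<^sub>R (\<psi> *\<^sub>R d)) (v + ((1 - t) * \<Delta>) *\<^sub>R d)
     + (1 - t) * cost c (x - t *\<^sub>R (\<psi> *\<^sub>R d)) (v - (t * \<Delta>) *\<^sub>R d)
    \<le> cost c x v + ((2 * B * C\<^sub>2 + C\<^sub>2\<^sup>2 + M\<^sup>2) / (8 * sqrt c) + 8 * cost_max c + 2 * M + C\<^sub>2 / 2)
        * (t * (1 - t) * (norm d)\<^sup>2 * norm v)"
proof (cases "v = 0")
  case True
  then have "\<Delta> = 0" using \<Delta> by simp
  then show ?thesis using True by simp
next
  case False
  define C4 where "C4 = 2 * B * C\<^sub>2 + C\<^sub>2\<^sup>2 + M\<^sup>2"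
  have C4: "0 \<le> C4" unfolding C4_def using B_nonneg C2_nonneg by simp
  define \<tau> where "\<tau> = t * (1 - t) * (norm d)\<^sup>2"
  have \<tau>: "0 \<le> \<tau>" "\<tau> \<le> 1"
  proof -
    show "0 \<le> \<tau>" unfolding \<tau>_def using t by simp
    have "t * (1 - t) * (norm d)\<^sup>2 \<le> 1 * 1 * 1"
      using t d by (intro mult_mono) (auto simp: power_le_one)
    then show "\<tau> \<le> 1" unfolding \<tau>_def by simp
  qed
  define W1 where "W1 = W (x + (1 - t) *\<^sub>R (\<psi> *\<^sub>R d))"
  define W2 where "W2 = W (x - t *\<^sub>R (\<psi> *\<^sub>R d))"
  define Wm where "Wm = t *\<^sub>R W1 + (1 - t) *\<^sub>R W2"
  define v1 where "v1 = v + ((1 - t) * \<Delta>) *\<^sub>R d"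
  define v2 where "v2 = v - (t * \<Delta>) *\<^sub>R d"
  define N where "N = sqrt (c + (norm (W x))\<^sup>2 / 4)"
  have Nc: "sqrt c \<le> N" "0 < sqrt c" unfolding N_def using c by auto
  then have N: "0 < N" by linarith
  have Nmax: "N \<le> cost_max c"
  proof -
    have "N \<le> sqrt (c + B\<^sup>2 / 4)" unfolding N_def using power_mono[OF W_bound[of x], of 2] by simp
    then show ?thesis unfolding cost_max_def using B_nonneg by simp
  qed
  have Nsq: "N\<^sup>2 = c + (norm (W x))\<^sup>2 / 4" unfolding N_def using c by simp
  define s where "s = norm v / N"
  have s: "0 < s" unfolding s_def using False N by simp
  have \<psi>d: "norm (\<psi> *\<^sub>R d) \<le> norm d" using \<psi> by (simp add: mult_left_le_one_le)
  have \<psi>\<tau>: "t * (1 - t) * (norm (\<psi> *\<^sub>R d))\<^sup>2 \<le> \<tau>"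
    unfolding \<tau>_def using power_mono[OF \<psi>d, of 2] t by (intro mult_left_mono) auto
  have Wm: "norm (Wm - W x) \<le> C\<^sub>2 * \<tau>"
    using W_second_difference[OF t, of x "\<psi> *\<^sub>R d"] mult_left_mono[OF \<psi>\<tau> C2_nonneg]
    unfolding Wm_def W1_def W2_def by linarith
  have W12: "norm (W1 - W2) \<le> M * norm d"
  proof -
    have "x + (1 - t) *\<^sub>R (\<psi> *\<^sub>R d) - (x - t *\<^sub>R (\<psi> *\<^sub>R d)) = \<psi> *\<^sub>R d"
      by (simp add: algebra_simps)
    then have "norm (W1 - W2) \<le> M * norm (\<psi> *\<^sub>R d)"
      using W_lip[of "x + (1 - t) *\<^sub>R (\<psi> *\<^sub>R d)" "x - t *\<^sub>R (\<psi> *\<^sub>R d)"]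
      unfolding W1_def W2_def by (simp only:)
    then show ?thesis using mult_left_mono[OF \<psi>d M_nonneg] by linarith
  qed
  have sumW: "t * (norm W1)\<^sup>2 + (1 - t) * (norm W2)\<^sup>2 \<le> (norm (W x))\<^sup>2 + C4 * \<tau>"
  proof -
    have "norm Wm \<le> norm (W x) + C\<^sub>2 * \<tau>" using norm_triangle_sub[of Wm "W x"] Wm by simp
    then have "(norm Wm)\<^sup>2 \<le> (norm (W x) + C\<^sub>2 * \<tau>)\<^sup>2" by (intro power_mono) auto
    also have "\<dots> = (norm (W x))\<^sup>2 + 2 * norm (W x) * (C\<^sub>2 * \<tau>) + C\<^sub>2\<^sup>2 * (\<tau> * \<tau>)"
      by (simp add: power2_sum power2_eq_square algebra_simps)
    also have "\<dots> \<le> (norm (W x))\<^sup>2 + 2 * B * (C\<^sub>2 * \<tau>) + C\<^sub>2\<^sup>2 * \<tau>"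
      using W_bound[of x] C2_nonneg \<tau>
        B_nonneg by (intro add_mono mult_mono mult_left_mono) (auto simp: mult_left_le)
    finally have "(norm Wm)\<^sup>2 \<le> (norm (W x))\<^sup>2 + 2 * B * (C\<^sub>2 * \<tau>) + C\<^sub>2\<^sup>2 * \<tau>" .
    moreover have "t * (1 - t) * (norm (W1 - W2))\<^sup>2 \<le> M\<^sup>2 * \<tau>"
    proof -
      have "t * (1 - t) * (norm (W1 - W2))\<^sup>2 \<le> t * (1 - t) * (M * norm d)\<^sup>2"
        using W12 t by (intro mult_left_mono power_mono) auto
      then show ?thesis unfolding \<tau>_def by (simp add: power_mult_distrib algebra_simps)
    qed
    ultimately show ?thesis
      unfolding weighted_norm_sq C4_def Wm_def[symmetric] by (simp add: algebra_simps)
  qed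
  have sumv: "t * (norm v1)\<^sup>2 + (1 - t) * (norm v2)\<^sup>2 \<le> (norm v)\<^sup>2 + 16 * \<tau> * (norm v)\<^sup>2"
  proof -
    have "t *\<^sub>R v1 + (1 - t) *\<^sub>R v2 = v" unfolding v1_def v2_def by (simp add: algebra_simps)
    moreover have "v1 - v2 = \<Delta> *\<^sub>R d" unfolding v1_def v2_def by (simp add: algebra_simps)
    moreover have "t * (1 - t) * (norm (\<Delta> *\<^sub>R d))\<^sup>2 \<le> 16 * \<tau> * (norm v)\<^sup>2"
    proof -
      have "\<Delta>\<^sup>2 \<le> (4 * norm v)\<^sup>2" using power_mono[OF \<Delta>, of 2] by simp
      then have "\<tau> * \<Delta>\<^sup>2 \<le> \<tau> * (16 * (norm v)\<^sup>2)" using \<tau> by (intro mult_left_mono) (auto simp: power_mult_distrib)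
      then show ?thesis unfolding \<tau>_def by (simp add: power_mult_distrib algebra_simps)
    qed
    ultimately show ?thesis unfolding weighted_norm_sq by simp
  qed
  have q: "sqrt (c + (norm U)\<^sup>2 / 4) * norm u \<le> (s * (c + (norm U)\<^sup>2 / 4) + (norm u)\<^sup>2 / s) / 2"
    for U u :: "real^2"
    using mult_le_weighted_squares[OF s, of "sqrt (c + (norm U)\<^sup>2 / 4)" "norm u"] c by simp
  have sqrts: "t * (sqrt (c + (norm W1)\<^sup>2 / 4) * norm v1) + (1 - t) * (sqrt (c + (norm W2)\<^sup>2 / 4) * norm v2)
      \<le> N * norm v + (C4 / (8 * sqrt c) + 8 * cost_max c) * (\<tau> * norm v)"
  proof -
    have "t * (sqrt (c + (norm W1)\<^sup>2 / 4) * norm v1) + (1 - t) * (sqrt (c + (norm W2)\<^sup>2 / 4) * norm v2)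
      \<le> t * ((s * (c + (norm W1)\<^sup>2 / 4) + (norm v1)\<^sup>2 / s) / 2)
         + (1 - t) * ((s * (c + (norm W2)\<^sup>2 / 4) + (norm v2)\<^sup>2 / s) / 2)"
      using t by (intro add_mono mult_left_mono q) auto
    also have "\<dots> = (s * (c + (t * (norm W1)\<^sup>2 + (1 - t) * (norm W2)\<^sup>2) / 4)
        + (t * (norm v1)\<^sup>2 + (1 - t) * (norm v2)\<^sup>2) / s) / 2"
      using s by (simp add: field_simps)
    also have "\<dots> \<le> (s * (c + ((norm (W x))\<^sup>2 + C4 * \<tau>) / 4) + ((norm v)\<^sup>2 + 16 * \<tau> * (norm v)\<^sup>2) / s) / 2"
    proof -
      have "s * (c + (t * (norm W1)\<^sup>2 + (1 - t) * (norm W2)\<^sup>2) / 4) \<le> s * (c + ((norm (W x))\<^sup>2 + C4 * \<tau>) / 4)"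
        by (intro mult_left_mono add_left_mono divide_right_mono sumW) (use s in auto)
      moreover have "(t * (norm v1)\<^sup>2 + (1 - t) * (norm v2)\<^sup>2) / s \<le> ((norm v)\<^sup>2 + 16 * \<tau> * (norm v)\<^sup>2) / s"
        by (intro divide_right_mono sumv) (use s in auto)
      ultimately show ?thesis by (rule divide_right_mono[OF add_mono]) simp
    qed
    also have "\<dots> = (s * (N\<^sup>2 + C4 * \<tau> / 4) + (norm v)\<^sup>2 * (1 + 16 * \<tau>) / s) / 2"
      unfolding Nsq by (simp add: algebra_simps add_divide_distrib)
    also have "\<dots> = N * norm v + C4 / (8 * N) * (\<tau> * norm v) + 8 * N * (\<tau> * norm v)"
      unfolding s_def using N False by (simp add: field_simps power2_eq_square)
    also have "\<dots> \<le> N * norm v + C4 / (8 * sqrt c) * (\<tau> * norm v) + 8 * cost_max c * (\<tau> * norm v)"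
      using Nc N Nmax C4 \<tau> by (intro add_mono mult_right_mono divide_left_mono mult_pos_pos) auto
    finally show ?thesis by (simp add: algebra_simps)
  qed
  have inners: "W x \<bullet> v \<le> t * (W1 \<bullet> v1) + (1 - t) * (W2 \<bullet> v2) + (4 * M + C\<^sub>2) * (\<tau> * norm v)"
  proof -
    have "t * (W1 \<bullet> v1) + (1 - t) * (W2 \<bullet> v2) = Wm \<bullet> v + t * (1 - t) * \<Delta> * ((W1 - W2) \<bullet> d)"
      unfolding Wm_def v1_def v2_def
      by (simp add: inner_add_left inner_add_right inner_diff_left inner_diff_right algebra_simps)
    moreover have "\<bar>(Wm - W x) \<bullet> v\<bar> \<le> C\<^sub>2 * \<tau> * norm v"
      using Cauchy_Schwarz_ineq2[of "Wm - W x" v] mult_right_mono[OF Wm norm_ge_zero[of v]] by linarith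
    moreover have "\<bar>t * (1 - t) * \<Delta> * ((W1 - W2) \<bullet> d)\<bar> \<le> 4 * M * (\<tau> * norm v)"
    proof -
      have "\<bar>(W1 - W2) \<bullet> d\<bar> \<le> M * norm d * norm d"
        using Cauchy_Schwarz_ineq2[of "W1 - W2" d] mult_right_mono[OF W12 norm_ge_zero[of d]] by linarith
      then have "t * (1 - t) * (\<bar>\<Delta>\<bar> * \<bar>(W1 - W2) \<bullet> d\<bar>) \<le> t * (1 - t) * ((4 * norm v) * (M * norm d * norm d))"
        using \<Delta> t by (intro mult_left_mono mult_mono) auto
      moreover have "\<bar>t * (1 - t) * \<Delta> * ((W1 - W2) \<bullet> d)\<bar> = t * (1 - t) * (\<bar>\<Delta>\<bar> * \<bar>(W1 - W2) \<bullet> d\<bar>)"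
        using t by (simp add: abs_mult)
      ultimately show ?thesis unfolding \<tau>_def by (simp add: power2_eq_square algebra_simps)
    qed
    ultimately show ?thesis by (simp add: inner_diff_left algebra_simps abs_le_iff)
  qed
  have "t * cost c (x + (1 - t) *\<^sub>R (\<psi> *\<^sub>R d)) v1 + (1 - t) * cost c (x - t *\<^sub>R (\<psi> *\<^sub>R d)) v2
      = t * (sqrt (c + (norm W1)\<^sup>2 / 4) * norm v1) + (1 - t) * (sqrt (c + (norm W2)\<^sup>2 / 4) * norm v2)
        - (t * (W1 \<bullet> v1) + (1 - t) * (W2 \<bullet> v2)) / 2"
    unfolding cost_def W1_def W2_def by (simp add: algebra_simps add_divide_distrib diff_divide_distrib)
  also have "\<dots> \<le> N * norm v + (C4 / (8 * sqrt c) + 8 * cost_max c) * (\<tau> * norm v)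
        - (W x \<bullet> v - (4 * M + C\<^sub>2) * (\<tau> * norm v)) / 2"
  proof (rule diff_mono[OF sqrts divide_right_mono])
    show "W x \<bullet> v - (4 * M + C\<^sub>2) * (\<tau> * norm v) \<le> t * (W1 \<bullet> v1) + (1 - t) * (W2 \<bullet> v2)"
      using inners unfolding diff_le_eq .
  qed simp
  also have "\<dots> = cost c x v + (C4 / (8 * sqrt c) + 8 * cost_max c + 2 * M + C\<^sub>2 / 2) * (\<tau> * norm v)"
    unfolding cost_def N_def by (simp add: algebra_simps add_divide_distrib diff_divide_distrib)
  finally show ?thesis unfolding C4_def \<tau>_def v1_def v2_def by (simp add: mult.assoc)
qed

definition semiconcavity :: "real \<Rightarrow> real" where
  "semiconcavity c = (2 * B * C\<^sub>2 + C\<^sub>2\<^sup>2 + M\<^sup>2) / (8 * sqrt c) + 8 * cost_max c + 2 * M + C\<^sub>2 / 2"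

lemma semiconcavity_pos: "0 < c \<Longrightarrow> 0 < semiconcavity c"
  unfolding semiconcavity_def using B_nonneg C2_nonneg M_nonneg cost_max_pos[of c]
  by (simp add: add_nonneg_pos add_pos_nonneg)

text \<open>The competitor is a weighted average of two translates of \<open>f\<close> itself. A
  cutoff makes it equal to \<open>f\<close> on the sphere of radius 1/4, and the factor
  \<open>1 - k\<close> absorbs the second difference of the cost; local maximality then compares it
  with \<open>f\<close> at the centre.\<close>

lemma locally_maximal_semiconcave:
  assumes c: "0 < c" and f: "dominated c f" and lm: "locally_maximal c f"
    and t: "0 \<le> t" "t \<le> 1" and d: "norm d \<le> 1/8" "semiconcavity c * (norm d)\<^sup>2 \<le> cost_min c"
  shows "t * f (x + (1 - t) *\<^sub>R d) + (1 - t) * f (x - t *\<^sub>R d)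
    \<le> f x + 2 * cost_max c * semiconcavity c / cost_min c * (t * (1 - t) * (norm d)\<^sup>2)"
proof -
  have c0: "0 \<le> c" using c by simp
  define \<tau> where "\<tau> = t * (1 - t) * (norm d)\<^sup>2"
  \<comment> \<open>The excess slope \<open>semiconcavity c * \<tau>\<close> is the fraction
    \<open>k\<close> of the least slope \<open>cost_min c\<close>.\<close>
  define k where "k = semiconcavity c * \<tau> / cost_min c"
  have cm: "0 < cost_min c" by (rule cost_min_pos[OF c])
  have "t * (1 - t) \<le> 1 * 1" using t by (intro mult_mono) auto
  then have "\<tau> \<le> 1 * (norm d)\<^sup>2" unfolding \<tau>_def by (intro mult_right_mono) auto
  then have "semiconcavity c * \<tau> \<le> semiconcavity c * (norm d)\<^sup>2"
    using semiconcavity_pos[OF c] by (intro mult_left_mono) auto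
  moreover have \<tau>0: "0 \<le> \<tau>" unfolding \<tau>_def using t by simp
  ultimately have "semiconcavity c * \<tau> \<le> cost_min c" using d by linarith
  then have k: "0 \<le> k" "k \<le> 1" "k * cost_min c = semiconcavity c * \<tau>"
    unfolding k_def using cm \<tau>0 semiconcavity_pos[OF c] by auto
  define \<psi> where "\<psi> y = max 0 (1 - 4 * norm (y - x))" for y
  have \<psi>: "0 \<le> \<psi> y" "\<psi> y \<le> 1" for y unfolding \<psi>_def by auto
  define g0 where "g0 y = t * f (y + (1 - t) *\<^sub>R (\<psi> y *\<^sub>R d)) + (1 - t) * f (y - t *\<^sub>R (\<psi> y *\<^sub>R d))" for y
  \<comment> \<open>A lower bound for \<open>f\<close> on the ball of radius 1/4, so mixing it in
    with weight \<open>k\<close> keeps the competitor below \<open>f\<close> on the sphere.\<close>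
  define m where "m = f x - cost_max c * (1/4)"
  define g where "g y = (1 - k) * g0 y + k * m" for y
  have fm: "m \<le> f y" if "norm (y - x) \<le> 1/4" for y
    using dominated_lip[OF c0 f, of y x] mult_left_mono[OF that cost_max_nonneg[OF c0]]
    unfolding m_def by (simp add: abs_le_iff)
  have gx: "g x \<le> f x"
  proof (rule locally_maximalD[OF lm compact_cball[of x "1/4"]])
    show "cball x (1/4) \<subseteq> ball x (1/2)" by auto
    show "x \<in> cball x (1/4)" by simp
    show "g y \<le> f y" if "y \<in> frontier (cball x (1/4))" for y
    proof -
      have n: "norm (y - x) = 1/4" using that by (simp add: dist_norm norm_minus_commute)
      then have "\<psi> y = 0" unfolding \<psi>_def by simp
      then have "g0 y = f y" unfolding g0_def by (simp add: algebra_simps)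
      then show ?thesis unfolding g_def using mult_left_mono[OF fm[of y] k(1)] n by (simp add: algebra_simps)
    qed
    show "dominated_on c (cball x (1/4)) g"
    proof (rule dominated_onI[of _ _ _ "4 * M"])
      fix y z :: "real^2"
      let ?v = "z - y"
      let ?\<Delta> = "\<psi> z - \<psi> y"
      have \<Delta>: "\<bar>?\<Delta>\<bar> \<le> 4 * norm ?v"
        using norm_triangle_ineq3[of "z - x" "y - x"] unfolding \<psi>_def max_def by auto
      let ?y1 = "y + (1 - t) *\<^sub>R (\<psi> y *\<^sub>R d)" and ?y2 = "y - t *\<^sub>R (\<psi> y *\<^sub>R d)"
      let ?v1 = "?v + ((1 - t) * ?\<Delta>) *\<^sub>R d" and ?v2 = "?v - (t * ?\<Delta>) *\<^sub>R d"
      have z1: "z + (1 - t) *\<^sub>R (\<psi> z *\<^sub>R d) = ?y1 + ?v1" and z2: "z - t *\<^sub>R (\<psi> z *\<^sub>R d) = ?y2 + ?v2"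
        by (simp_all add: algebra_simps)
      have small: "norm (a *\<^sub>R d) \<le> norm ?v" if "\<bar>a\<bar> \<le> \<bar>?\<Delta>\<bar>" for a
      proof -
        have "\<bar>a\<bar> * norm d \<le> (4 * norm ?v) * (1/8)" using that \<Delta> d by (intro mult_mono) auto
        then show ?thesis using norm_ge_zero[of ?v] unfolding norm_scaleR by linarith
      qed
      have "\<bar>(1 - t) * ?\<Delta>\<bar> \<le> \<bar>?\<Delta>\<bar>" "\<bar>t * ?\<Delta>\<bar> \<le> \<bar>?\<Delta>\<bar>"
        using t by (auto simp: abs_mult mult_left_le_one_le)
      then have "norm ?v1 \<le> 2 * norm ?v" "norm ?v2 \<le> 2 * norm ?v"
        using norm_triangle_ineq[of ?v "((1 - t) * ?\<Delta>) *\<^sub>R d"] norm_triangle_ineq4[of ?v "(t * ?\<Delta>) *\<^sub>R d"]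
          small[of "(1 - t) * ?\<Delta>"] small[of "t * ?\<Delta>"] by linarith+
      then have sq: "M * (norm ?v1)\<^sup>2 \<le> 4 * M * (norm ?v)\<^sup>2" "M * (norm ?v2)\<^sup>2 \<le> 4 * M * (norm ?v)\<^sup>2"
        using power_mono[of "norm ?v1" "2 * norm ?v" 2] power_mono[of "norm ?v2" "2 * norm ?v" 2]
          M_nonneg mult_left_mono[of "(norm ?v1)\<^sup>2" "4 * (norm ?v)\<^sup>2" M]
          mult_left_mono[of "(norm ?v2)\<^sup>2" "4 * (norm ?v)\<^sup>2" M] by (auto simp: power_mult_distrib)
      have "g0 z - g0 y = t * (f (?y1 + ?v1) - f ?y1) + (1 - t) * (f (?y2 + ?v2) - f ?y2)"
        unfolding g0_def z1 z2 by (simp add: algebra_simps)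
      also have "\<dots> \<le> t * (cost c ?y1 ?v1 + 4 * M * (norm ?v)\<^sup>2) + (1 - t) * (cost c ?y2 ?v2 + 4 * M * (norm ?v)\<^sup>2)"
      proof (intro add_mono mult_left_mono)
        show "f (?y1 + ?v1) - f ?y1 \<le> cost c ?y1 ?v1 + 4 * M * (norm ?v)\<^sup>2"
          using dominatedD[OF f, of "?y1 + ?v1" ?y1] sq(1) unfolding add_diff_cancel_left' by linarith
        show "f (?y2 + ?v2) - f ?y2 \<le> cost c ?y2 ?v2 + 4 * M * (norm ?v)\<^sup>2"
          using dominatedD[OF f, of "?y2 + ?v2" ?y2] sq(2) unfolding add_diff_cancel_left' by linarith
      qed (use t in auto)
      also have "\<dots> = (t * cost c ?y1 ?v1 + (1 - t) * cost c ?y2 ?v2) + 4 * M * (norm ?v)\<^sup>2"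
        by (simp add: algebra_simps)
      also have "t * cost c ?y1 ?v1 + (1 - t) * cost c ?y2 ?v2 \<le> cost c y ?v + semiconcavity c * (\<tau> * norm ?v)"
        using cost_second_difference[OF c t \<psi>[of y] _ \<Delta>, of d y] d(1)
        unfolding semiconcavity_def \<tau>_def by (simp add: mult.assoc)
      also have "semiconcavity c * (\<tau> * norm ?v) = k * (cost_min c * norm ?v)"
        unfolding mult.assoc[symmetric] k(3) ..
      finally have "g0 z - g0 y \<le> cost c y ?v + k * (cost_min c * norm ?v) + 4 * M * (norm ?v)\<^sup>2" by simp
      then have "(1 - k) * (g0 z - g0 y) \<le> (1 - k) * (cost c y ?v + k * (cost_min c * norm ?v) + 4 * M * (norm ?v)\<^sup>2)"
        using k by (intro mult_left_mono) auto
      also have "\<dots> = (1 - k) * cost c y ?v + (1 - k) * (k * (cost_min c * norm ?v)) + (1 - k) * (4 * M * (norm ?v)\<^sup>2)"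
        by (simp add: algebra_simps)
      also have "\<dots> \<le> (1 - k) * cost c y ?v + 1 * (k * cost c y ?v) + 1 * (4 * M * (norm ?v)\<^sup>2)"
        using k M_nonneg cost_min_le[OF c0, of ?v y] cm
        by (intro add_mono mult_mono mult_left_mono mult_right_mono mult_nonneg_nonneg) auto
      finally show "g z - g y \<le> cost c y (z - y) + 4 * M * (norm (z - y))\<^sup>2"
        unfolding g_def by (simp add: algebra_simps)
    qed
  qed
  have g0x: "g0 x = t * f (x + (1 - t) *\<^sub>R d) + (1 - t) * f (x - t *\<^sub>R d)"
    unfolding g0_def \<psi>_def by simp
  have "g0 x \<le> f x + cost_max c"
  proof -
    have *: "f (x + e) \<le> f x + cost_max c" if "norm e \<le> norm d" for e
    proof -
      have "cost_max c * norm e \<le> cost_max c * 1"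
        using that d cost_max_nonneg[OF c0] by (intro mult_left_mono) auto
      then show ?thesis using dominated_lip[OF c0 f, of "x + e" x] by (simp add: abs_le_iff)
    qed
    have "f (x + (1 - t) *\<^sub>R d) \<le> f x + cost_max c" "f (x - t *\<^sub>R d) \<le> f x + cost_max c"
      using *[of "(1 - t) *\<^sub>R d"] *[of "- (t *\<^sub>R d)"] t by (auto simp: mult_left_le_one_le)
    then have "g0 x \<le> t * (f x + cost_max c) + (1 - t) * (f x + cost_max c)"
      unfolding g0x using t by (intro add_mono mult_left_mono) auto
    then show ?thesis by (simp add: algebra_simps)
  qed
  then have "k * (g0 x - m) \<le> k * (2 * cost_max c)"
    using k(1) cost_max_nonneg[OF c0] unfolding m_def by (intro mult_left_mono) auto
  with gx have "g0 x \<le> f x + k * (2 * cost_max c)" unfolding g_def by (simp add: algebra_simps)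
  also have "k * (2 * cost_max c) = 2 * cost_max c * semiconcavity c / cost_min c * \<tau>"
    unfolding k_def by simp
  finally show ?thesis unfolding g0x \<tau>_def .
qed

end

section \<open>Symmetries of the cellular flow\<close>

lemma norm_vec2_le: "norm (x::real^2) \<le> \<bar>x $ 1\<bar> + \<bar>x $ 2\<bar>"
  using norm_le_l1_cart[of x] unfolding sum_2 .

lemma sin_lipschitz: "\<bar>sin a - sin b\<bar> \<le> \<bar>a - b\<bar>" for a b :: real
proof -
  have "\<bar>sin a - sin b\<bar> = 2 * \<bar>sin ((a - b) / 2)\<bar> * \<bar>cos ((a + b) / 2)\<bar>"
    by (simp add: sin_diff_sin abs_mult)
  also have "\<dots> \<le> 2 * \<bar>(a - b) / 2\<bar> * 1"
    by (intro mult_mono mult_left_mono abs_sin_x_le_abs_x abs_cos_le_one) auto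
  finally show ?thesis by simp
qed

text \<open>Adding x^2 / 2 to plus or minus the sine makes it convex, and the second difference of
  the square is exact.\<close>

lemma sin_second_difference:
  fixes a d t :: real
  assumes t: "0 \<le> t" "t \<le> 1"
  shows "\<bar>t * sin (a + (1 - t) * d) + (1 - t) * sin (a - t * d) - sin a\<bar> \<le> t * (1 - t) * d\<^sup>2 / 2"
proof -
  have conv: "convex_on UNIV (\<lambda>x. s * sin x + x\<^sup>2 / 2)" if s: "s = 1 \<or> s = -1" for s :: real
  proof (rule f''_ge0_imp_convex[of _ _ "\<lambda>x. s * cos x + x" "\<lambda>x. 1 - s * sin x"])
    show "convex (UNIV :: real set)" by simp
    show "((\<lambda>x. s * sin x + x\<^sup>2 / 2) has_real_derivative s * cos x + x) (at x)" for x
      by (auto intro!: derivative_eq_intros)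
    show "((\<lambda>x. s * cos x + x) has_real_derivative 1 - s * sin x) (at x)" for x
      by (auto intro!: derivative_eq_intros)
    show "0 \<le> 1 - s * sin x" for x using s abs_sin_le_one[of x] by auto
  qed
  define S where "S = t * sin (a + (1 - t) * d) + (1 - t) * sin (a - t * d)"
  define Q where "Q = t * (a + (1 - t) * d)\<^sup>2 + (1 - t) * (a - t * d)\<^sup>2"
  have *: "s * sin a + a\<^sup>2 / 2 \<le> s * S + Q / 2" if "s = 1 \<or> s = -1" for s
  proof -
    have "t *\<^sub>R (a + (1 - t) * d) + (1 - t) *\<^sub>R (a - t * d) = a" by (simp add: algebra_simps)
    then have "s * sin a + a\<^sup>2 / 2 \<le> t * (s * sin (a + (1 - t) * d) + (a + (1 - t) * d)\<^sup>2 / 2)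
      + (1 - t) * (s * sin (a - t * d) + (a - t * d)\<^sup>2 / 2)"
      using convex_onD[OF conv[OF that], of t "a - t * d" "a + (1 - t) * d"] t by (simp add: add.commute)
    also have "\<dots> = s * S + Q / 2" unfolding S_def Q_def by (simp add: field_simps)
    finally show ?thesis .
  qed
  have "Q = a\<^sup>2 + t * (1 - t) * d\<^sup>2"
    unfolding Q_def by (simp add: power2_eq_square algebra_simps)
  then show ?thesis using *[of 1] *[of "-1"] unfolding S_def[symmetric]
    by (intro abs_leI) (simp_all add: add_divide_distrib)
qed

section \<open>The cellular field and its regularity\<close>

locale cellular =
  fixes A :: real
  assumes A_nonzero: "A \<noteq> 0"
begin

definition profile :: "real \<Rightarrow> real" where "profile t = pi * A * sin (2 * pi * t)"

text \<open>The product-to-sum form of \<open>A\<close> times the cellular field: two diagonal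
  shears, one depending on x1 + x2 and one on x1 - x2. Regularity becomes one-dimensional, and each
  shear preserves area.\<close>

definition W :: "real^2 \<Rightarrow> real^2" where
  "W x = vector [- (profile (x $ 1 + x $ 2) + profile (x $ 1 - x $ 2)),
                 profile (x $ 1 + x $ 2) - profile (x $ 1 - x $ 2)]"

lemma W_components:
  "W x $ 1 = - (profile (x $ 1 + x $ 2) + profile (x $ 1 - x $ 2))"
  "W x $ 2 = profile (x $ 1 + x $ 2) - profile (x $ 1 - x $ 2)"
  unfolding W_def by simp_all

lemma W_trig:
  "W x $ 1 = - 2 * pi * A * sin (2 * pi * x $ 1) * cos (2 * pi * x $ 2)"
  "W x $ 2 = 2 * pi * A * cos (2 * pi * x $ 1) * sin (2 * pi * x $ 2)"
  unfolding W_components profile_def distrib_left right_diff_distrib sin_add sin_diff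
  by (simp_all add: algebra_simps)

lemma profile_lipschitz: "\<bar>profile a - profile b\<bar> \<le> 2 * pi\<^sup>2 * \<bar>A\<bar> * \<bar>a - b\<bar>"
proof -
  have "\<bar>profile a - profile b\<bar> = pi * \<bar>A\<bar> * \<bar>sin (2 * pi * a) - sin (2 * pi * b)\<bar>"
    unfolding profile_def by (simp add: abs_mult flip: right_diff_distrib)
  also have "\<dots> \<le> pi * \<bar>A\<bar> * \<bar>2 * pi * a - 2 * pi * b\<bar>"
    by (intro mult_left_mono sin_lipschitz) auto
  also have "\<dots> = 2 * pi\<^sup>2 * \<bar>A\<bar> * \<bar>a - b\<bar>"
    by (simp add: abs_mult power2_eq_square flip: right_diff_distrib)
  finally show ?thesis .
qed

lemma profile_bound: "\<bar>profile a\<bar> \<le> pi * \<bar>A\<bar>"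
  unfolding profile_def by (simp add: abs_mult mult_left_le)

lemma profile_periodic: "profile (t + of_int n) = profile t"
proof -
  have "sin (2 * pi * (t + of_int n)) = sin (2 * pi * t)"
    unfolding distrib_left using sin_cos_eq_iff[of "2 * pi * t + 2 * pi * of_int n" "2 * pi * t"]
    by (auto simp: algebra_simps)
  then show ?thesis unfolding profile_def by simp
qed

lemma profile_second_difference:
  assumes "0 \<le> t" "t \<le> 1"
  shows "\<bar>t * profile (a + (1 - t) * d) + (1 - t) * profile (a - t * d) - profile a\<bar>
    \<le> 2 * pi ^ 3 * \<bar>A\<bar> * (t * (1 - t) * d\<^sup>2)"
proof -
  let ?S = "t * sin (2 * pi * a + (1 - t) * (2 * pi * d)) + (1 - t) * sin (2 * pi * a - t * (2 * pi * d)) - sin (2 * pi * a)"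
  have "t * profile (a + (1 - t) * d) + (1 - t) * profile (a - t * d) - profile a = pi * A * ?S"
    unfolding profile_def by (simp add: algebra_simps)
  then have "\<bar>t * profile (a + (1 - t) * d) + (1 - t) * profile (a - t * d) - profile a\<bar> = pi * \<bar>A\<bar> * \<bar>?S\<bar>"
    by (simp add: abs_mult)
  also have "\<dots> \<le> pi * \<bar>A\<bar> * (t * (1 - t) * (2 * pi * d)\<^sup>2 / 2)"
    by (intro mult_left_mono sin_second_difference assms) auto
  also have "\<dots> = 2 * pi ^ 3 * \<bar>A\<bar> * (t * (1 - t) * d\<^sup>2)"
    by (simp add: power2_eq_square power3_eq_cube)
  finally show ?thesis .
qed

sublocale smooth_drift W "16 * pi\<^sup>2 * \<bar>A\<bar>" "4 * pi * \<bar>A\<bar>" "32 * pi ^ 3 * \<bar>A\<bar>"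
proof
  fix x y :: "real^2"
  have c: "\<bar>(x - y) $ 1\<bar> \<le> norm (x - y)" "\<bar>(x - y) $ 2\<bar> \<le> norm (x - y)"
    using component_le_norm_cart by blast+
  have P: "\<bar>profile (x $ 1 + x $ 2) - profile (y $ 1 + y $ 2)\<bar> \<le> 2 * pi\<^sup>2 * \<bar>A\<bar> * (2 * norm (x - y))"
    by (rule order_trans[OF profile_lipschitz mult_left_mono]) (use c in auto)
  have N: "\<bar>profile (x $ 1 - x $ 2) - profile (y $ 1 - y $ 2)\<bar> \<le> 2 * pi\<^sup>2 * \<bar>A\<bar> * (2 * norm (x - y))"
    by (rule order_trans[OF profile_lipschitz mult_left_mono]) (use c in auto)
  show "norm (W x - W y) \<le> 16 * pi\<^sup>2 * \<bar>A\<bar> * norm (x - y)"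
    using norm_vec2_le[of "W x - W y"] P N by (simp add: W_components)
  show "norm (W x) \<le> 4 * pi * \<bar>A\<bar>"
    using norm_vec2_le[of "W x"] profile_bound[of "x $ 1 + x $ 2"] profile_bound[of "x $ 1 - x $ 2"]
    by (simp add: W_components)
next
  show "torus_periodic W"
    unfolding torus_periodic_def
  proof (intro allI)
    fix x :: "real^2" and i :: 2
    show "W (x + axis i 1) = W x"
      using exhaust_2[of i] profile_periodic[of "x $ 1 + x $ 2" 1] profile_periodic[of "x $ 1 - x $ 2" 1]
        profile_periodic[of "x $ 1 - x $ 2" "-1"]
      by (auto simp: vec_eq_iff forall_2 W_components axis_def algebra_simps)
  qed
next
  fix t :: real and x d :: "real^2"
  assume t: "0 \<le> t" "t \<le> 1"
  let ?D = "\<lambda>a e. t * profile (a + (1 - t) * e) + (1 - t) * profile (a - t * e) - profile a"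
  let ?V = "t *\<^sub>R W (x + (1 - t) *\<^sub>R d) + (1 - t) *\<^sub>R W (x - t *\<^sub>R d) - W x"
  have c: "\<bar>d $ 1\<bar> \<le> norm d" "\<bar>d $ 2\<bar> \<le> norm d" using component_le_norm_cart by blast+
  have b: "\<bar>?D a e\<bar> \<le> 2 * pi ^ 3 * \<bar>A\<bar> * (t * (1 - t) * (4 * (norm d)\<^sup>2))" if "\<bar>e\<bar> \<le> 2 * norm d" for a e
  proof (rule order_trans[OF profile_second_difference[OF t] mult_left_mono[OF mult_left_mono]])
    show "e\<^sup>2 \<le> 4 * (norm d)\<^sup>2" using power_mono[OF that, of 2] by (simp add: power_mult_distrib)
  qed (use t in auto)
  have "?V $ 1 = - (?D (x $ 1 + x $ 2) (d $ 1 + d $ 2) + ?D (x $ 1 - x $ 2) (d $ 1 - d $ 2))"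
    and "?V $ 2 = ?D (x $ 1 + x $ 2) (d $ 1 + d $ 2) - ?D (x $ 1 - x $ 2) (d $ 1 - d $ 2)"
    by (simp_all add: W_components algebra_simps)
  moreover have "\<bar>- (p + q)\<bar> + \<bar>p - q\<bar> \<le> 2 * \<bar>p\<bar> + 2 * \<bar>q\<bar>" for p q :: real by linarith
  ultimately have "\<bar>?V $ 1\<bar> + \<bar>?V $ 2\<bar> \<le> 2 * \<bar>?D (x $ 1 + x $ 2) (d $ 1 + d $ 2)\<bar> + 2 * \<bar>?D (x $ 1 - x $ 2) (d $ 1 - d $ 2)\<bar>"
    by (simp only:)
  moreover have "\<bar>?D (x $ 1 + x $ 2) (d $ 1 + d $ 2)\<bar> \<le> 2 * pi ^ 3 * \<bar>A\<bar> * (t * (1 - t) * (4 * (norm d)\<^sup>2))"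
    by (rule b) (use c in linarith)
  moreover have "\<bar>?D (x $ 1 - x $ 2) (d $ 1 - d $ 2)\<bar> \<le> 2 * pi ^ 3 * \<bar>A\<bar> * (t * (1 - t) * (4 * (norm d)\<^sup>2))"
    by (rule b) (use c in linarith)
  ultimately show "norm ?V \<le> 32 * pi ^ 3 * \<bar>A\<bar> * (t * (1 - t) * (norm d)\<^sup>2)"
    using norm_vec2_le[of ?V] by simp
qed

section \<open>Reflections in the coordinate axes\<close>

definition reflect1 :: "real^2 \<Rightarrow> real^2" where "reflect1 x = vector [- (x $ 1), x $ 2]"
definition reflect2 :: "real^2 \<Rightarrow> real^2" where "reflect2 x = vector [x $ 1, - (x $ 2)]"

lemma reflect_components [simp]:
  "reflect1 x $ 1 = - (x $ 1)" "reflect1 x $ 2 = x $ 2"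
  "reflect2 x $ 1 = x $ 1" "reflect2 x $ 2 = - (x $ 2)"
  unfolding reflect1_def reflect2_def by simp_all

lemma reflect_linear:
  "reflect1 y - reflect1 x = reflect1 (y - x)" "reflect2 y - reflect2 x = reflect2 (y - x)"
  by (simp_all add: vec_eq_iff forall_2)

lemma reflect_norm [simp]: "norm (reflect1 x) = norm x" "norm (reflect2 x) = norm x"
  using norm_vec2_sq[of "reflect1 x"] norm_vec2_sq[of "reflect2 x"] norm_vec2_sq[of x]
  by (metis power2_minus reflect_components norm_ge_zero power2_eq_imp_eq)+

lemma reflect_involution [simp]: "reflect1 (reflect1 x) = x" "reflect2 (reflect2 x) = x"
  by (simp_all add: vec_eq_iff forall_2)

lemma reflect_W: "W (reflect1 x) = reflect1 (W x)" "W (reflect2 x) = reflect2 (W x)"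
  by (simp_all add: vec_eq_iff forall_2 W_trig)

lemma cost_reflect: "cost c (reflect1 x) (reflect1 v) = cost c x v" "cost c (reflect2 x) (reflect2 v) = cost c x v"
  unfolding cost_def reflect_W reflect_norm by (simp_all add: inner_vec2)

lemma dominated_on_reflect:
  assumes "dominated_on c V g"
  shows "dominated_on c (reflect1 ` V) (\<lambda>x. g (reflect1 x))"
proof -
  obtain K where "0 \<le> K" and K: "\<And>x y. x \<in> V \<Longrightarrow> y \<in> V \<Longrightarrow> g y - g x \<le> cost c x (y - x) + K * (norm (y - x))\<^sup>2"
    using dominated_onE[OF assms] by blast
  show ?thesis
  proof (rule dominated_onI[of _ _ _ K])
    fix x y assume "x \<in> reflect1 ` V" "y \<in> reflect1 ` V"
    then have "reflect1 x \<in> V" "reflect1 y \<in> V" by auto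
    from K[OF this] show "g (reflect1 y) - g (reflect1 x) \<le> cost c x (y - x) + K * (norm (y - x))\<^sup>2"
      unfolding reflect_linear cost_reflect reflect_norm .
  qed
qed

lemma dominated_reflect:
  assumes "dominated c f"
  shows "dominated c (\<lambda>x. f (reflect1 x))" "dominated c (\<lambda>x. f (reflect2 x))"
  unfolding dominated_def
  using dominatedD[OF assms] by (metis reflect_linear cost_reflect reflect_norm)+

lemma equivariant_reflect2:
  assumes "equivariant p f" shows "equivariant (reflect2 p) (\<lambda>x. f (reflect2 x))"
  unfolding equivariant_def
proof (intro allI)
  fix x :: "real^2" and i :: 2
  consider "i = 1" | "i = 2" using exhaust_2 by blast
  then show "f (reflect2 (x + axis i 1)) = f (reflect2 x) + reflect2 p $ i"
  proof cases
    case 1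
    have "reflect2 (x + axis 1 1) = reflect2 x + axis 1 1" by (simp add: vec_eq_iff forall_2 axis_def)
    then show ?thesis using assms 1 unfolding equivariant_def by simp
  next
    case 2
    have "reflect2 (x + axis 2 1) + axis 2 1 = reflect2 x" by (simp add: vec_eq_iff forall_2 axis_def)
    then show ?thesis using assms 2 unfolding equivariant_def by (metis add_diff_cancel_right' diff_conv_add_uminus reflect_components(4))
  qed
qed

lemma equivariant_reflect1:
  assumes "equivariant p f" shows "equivariant (reflect1 p) (\<lambda>x. f (reflect1 x))"
  unfolding equivariant_def
proof (intro allI)
  fix x :: "real^2" and i :: 2
  consider "i = 1" | "i = 2" using exhaust_2 by blast
  then show "f (reflect1 (x + axis i 1)) = f (reflect1 x) + reflect1 p $ i"
  proof cases
    case 2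
    have "reflect1 (x + axis 2 1) = reflect1 x + axis 2 1" by (simp add: vec_eq_iff forall_2 axis_def)
    then show ?thesis using assms 2 unfolding equivariant_def by simp
  next
    case 1
    have "reflect1 (x + axis 1 1) + axis 1 1 = reflect1 x" by (simp add: vec_eq_iff forall_2 axis_def)
    then show ?thesis using assms 1 unfolding equivariant_def by (metis add_diff_cancel_right' diff_conv_add_uminus reflect_components(1))
  qed
qed

lemma admissible_reflect:
  assumes "admissible c p f"
  shows "admissible c (reflect1 p) (\<lambda>x. f (reflect1 x))" "admissible c (reflect2 p) (\<lambda>x. f (reflect2 x))"
  using assms dominated_reflect equivariant_reflect1 equivariant_reflect2 unfolding admissible_def by blast+

lemma reflect1_image:
  "compact V \<Longrightarrow> compact (reflect1 ` V)" "frontier (reflect1 ` V) = reflect1 ` frontier V"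
  "V \<subseteq> ball z r \<Longrightarrow> reflect1 ` V \<subseteq> ball (reflect1 z) r"
proof -
  have lin: "linear reflect1" by (rule linearI) (simp_all add: vec_eq_iff forall_2)
  show "compact V \<Longrightarrow> compact (reflect1 ` V)"
    by (rule compact_continuous_image[OF linear_continuous_on[OF linear_linear[THEN iffD2, OF lin]]])
  have inv: "bij reflect1" by (rule involuntory_imp_bij) simp
  show "frontier (reflect1 ` V) = reflect1 ` frontier V"
    using interior_bijective_linear_image[OF lin inv, of V] closure_injective_linear_image[OF lin, of V] inv
    unfolding frontier_def by (simp add: bij_def image_set_diff)
  show "V \<subseteq> ball z r \<Longrightarrow> reflect1 ` V \<subseteq> ball (reflect1 z) r"
    by (auto simp: dist_norm reflect_linear)
qed

lemma locally_maximal_reflect: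
  assumes "locally_maximal c f" shows "locally_maximal c (\<lambda>x. f (reflect1 x))"
  unfolding locally_maximal_def
proof (intro allI impI ballI)
  fix z V g x
  assume V: "compact V" "V \<subseteq> ball z (1/2)" "dominated_on c V g" "\<forall>x\<in>frontier V. g x \<le> f (reflect1 x)" "x \<in> V"
  have "g (reflect1 (reflect1 x)) \<le> f (reflect1 x)"
    by (rule locally_maximalD[OF assms reflect1_image(1)[OF V(1)] reflect1_image(3)[OF V(2)] dominated_on_reflect[OF V(3)]])
      (use V(4,5) reflect1_image(2)[of V] in auto)
  then show "g x \<le> f (reflect1 x)" by simp
qed

lemma locally_minimalI:
  assumes c: "0 \<le> c" and "\<And>z V g x. compact V \<Longrightarrow> V \<subseteq> ball z (1/2) \<Longrightarrow> dominated_on c V g \<Longrightarrow>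
      (\<And>x. x \<in> frontier V \<Longrightarrow> f x \<le> g x) \<Longrightarrow> x \<in> V \<Longrightarrow> f x \<le> g x"
  shows "locally_minimal c f"
  unfolding locally_minimal_def drift.locally_maximal_def[OF reversed]
proof (intro allI impI ballI)
  fix z V g x
  assume V: "compact V" "V \<subseteq> ball z (1/2)" "drift.dominated_on (\<lambda>x. - W x) c V g"
    "\<forall>x\<in>frontier V. g x \<le> - f x" "x \<in> V"
  have "f x \<le> - g x"
    by (rule assms(2)[OF V(1,2) _ _ V(5)]) (use V reversed_dominated_on[OF c, of V "\<lambda>x. - g x"] in force)+
  then show "g x \<le> - f x" by simp
qed

lemma locally_minimal_reflect:
  assumes c: "0 \<le> c" and "locally_minimal c f" shows "locally_minimal c (\<lambda>x. f (reflect1 x))"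
proof (rule locally_minimalI[OF c])
  fix z V g x
  assume V: "compact V" "V \<subseteq> ball z (1/2)" "dominated_on c V g" "\<And>x. x \<in> frontier V \<Longrightarrow> f (reflect1 x) \<le> g x" "x \<in> V"
  have "f (reflect1 x) \<le> g (reflect1 (reflect1 x))"
    by (rule locally_minimalD[OF c assms(2) reflect1_image(1)[OF V(1)] reflect1_image(3)[OF V(2)] dominated_on_reflect[OF V(3)]])
      (use V(4,5) reflect1_image(2)[of V] in auto)
  then show "f (reflect1 x) \<le> g x" by simp
qed

end

section \<open>Barriers near the axis\<close>

text \<open>Subdivision again: \<open>n\<close> equal steps leave only K (t - s)^2 / n.\<close>

lemma nonincreasing_if_quadratic:
  fixes h :: "real \<Rightarrow> real"
  assumes K: "0 \<le> K" and h: "\<And>s t. s \<le> t \<Longrightarrow> h t - h s \<le> K * (t - s)\<^sup>2" and st: "s \<le> t"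
  shows "h t \<le> h s"
proof -
  have ev: "h t - h s \<le> K * (t - s)\<^sup>2 / real n" if n: "0 < n" for n
  proof -
    let ?y = "\<lambda>i. s + (real i / real n) * (t - s)"
    have step: "h (?y (Suc i)) - h (?y i) \<le> K * (t - s)\<^sup>2 / (real n)\<^sup>2" for i
    proof -
      have d: "?y (Suc i) - ?y i = (t - s) / n" using n by (simp add: field_simps)
      then have "?y i \<le> ?y (Suc i)" using st n by (simp add: mult_right_mono divide_right_mono)
      from h[OF this] show ?thesis unfolding d by (simp add: power_divide)
    qed
    have "h t - h s = (\<Sum>i<n. h (?y (Suc i)) - h (?y i))"
      using sum_lessThan_telescope[of "\<lambda>i. h (?y i)" n] n by simp
    also have "\<dots> \<le> (\<Sum>i<n. K * (t - s)\<^sup>2 / (real n)\<^sup>2)" by (intro sum_mono step)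
    also have "\<dots> = K * (t - s)\<^sup>2 / n" using n by (simp add: power2_eq_square)
    finally show ?thesis .
  qed
  have "(\<lambda>n. K * (t - s)\<^sup>2 / real n) \<longlonglongrightarrow> 0" by (rule lim_const_over_n)
  moreover have "\<forall>\<^sub>F n in sequentially. h t - h s \<le> K * (t - s)\<^sup>2 / real n"
    using ev by (intro eventually_sequentiallyI[of 1]) auto
  ultimately have "h t - h s \<le> 0" by (metis tendsto_lowerbound trivial_limit_sequentially)
  then show ?thesis by simp
qed

abbreviation pt :: "real \<Rightarrow> real \<Rightarrow> real^2" where "pt a b \<equiv> vector [a, b]"

lemma pt_arith:
  "pt a b + pt c d = pt (a + c) (b + d)" "pt a b - pt c d = pt (a - c) (b - d)"
  "r *\<^sub>R pt a b = pt (r * a) (r * b)" "- pt a b = pt (- a) (- b)"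
  by (simp_all add: vec_eq_iff forall_2)

lemma norm_pt: "norm (pt a b) = sqrt (a\<^sup>2 + b\<^sup>2)"
  using norm_vec2_sq[of "pt a b"] by (metis norm_ge_zero real_sqrt_unique vector_2)

lemma norm_pt_axis [simp]: "norm (pt a 0) = \<bar>a\<bar>" "norm (pt 0 a) = \<bar>a\<bar>"
  unfolding norm_pt by simp_all

context cellular
begin

definition drift_axis :: "real \<Rightarrow> real" where "drift_axis t = - 2 * pi * A * sin (2 * pi * t)"

lemma W_axis: "W (pt t 0) = pt (drift_axis t) 0"
  by (simp add: vec_eq_iff forall_2 W_trig drift_axis_def)

text \<open>The two horizontal momenta of energy \<open>c\<close> at \<open>(t, 0)\<close> are \<open>slope c t\<close> and \<open>- slope c (- t)\<close>.\<close>

definition slope :: "real \<Rightarrow> real \<Rightarrow> real" where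
  "slope c t = sqrt (c + (drift_axis t)\<^sup>2 / 4) - drift_axis t / 2"

lemma slope_eq_cost: "slope c t = cost c (pt t 0) (pt 1 0)"
  unfolding slope_def cost_def W_axis by (simp add: inner_vec2)

lemma cost_axis: "0 \<le> s \<Longrightarrow> cost c (pt t 0) (pt s 0) = s * slope c t"
  unfolding slope_eq_cost using cost_scale[of s c "pt t 0" "pt 1 0"] by (simp add: pt_arith)

lemma slope_energy: "0 \<le> c \<Longrightarrow> (slope c t)\<^sup>2 + drift_axis t * slope c t = c"
  unfolding slope_def by (simp add: power2_diff power2_eq_square algebra_simps)

lemma slope_roots:
  assumes "0 \<le> c" "q\<^sup>2 + drift_axis t * q = c"
  shows "q = slope c t \<or> q = - slope c (- t)"
proof -
  have "(q + drift_axis t / 2)\<^sup>2 = c + (drift_axis t)\<^sup>2 / 4"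
    using assms(2) by (simp add: power2_sum power_divide algebra_simps)
  also have "\<dots> = (sqrt (c + (drift_axis t)\<^sup>2 / 4))\<^sup>2" using assms(1) by simp
  finally have "q + drift_axis t / 2 = sqrt (c + (drift_axis t)\<^sup>2 / 4)
      \<or> q + drift_axis t / 2 = - sqrt (c + (drift_axis t)\<^sup>2 / 4)"
    by (simp add: power2_eq_iff)
  moreover have "drift_axis (- t) = - drift_axis t" unfolding drift_axis_def by simp
  ultimately show ?thesis unfolding slope_def by auto
qed

lemma slope_pos: "0 < c \<Longrightarrow> cost_min c \<le> slope c t"
  unfolding slope_eq_cost using cost_min_le[of c "pt 1 0" "pt t 0"] by simp

lemma slope_lipschitz: "0 \<le> c \<Longrightarrow> slope c s \<le> slope c t + 16 * pi\<^sup>2 * \<bar>A\<bar> * \<bar>s - t\<bar>"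
  unfolding slope_eq_cost using cost_lip[of c "pt s 0" "pt 1 0" "pt t 0"] by (simp add: pt_arith)

lemma slope_continuous: "continuous_on S (slope c)"
  unfolding slope_def drift_axis_def by (intro continuous_intros) auto

text \<open>A primitive of the larger horizontal momentum; the choice fixes it up to a constant, and
  only its increments occur.\<close>

definition slope_integral :: "real \<Rightarrow> real \<Rightarrow> real" where
  "slope_integral c = (SOME F. \<forall>t. (F has_real_derivative slope c t) (at t))"

lemma slope_integral_deriv: "(slope_integral c has_real_derivative slope c t) (at t)"
proof -
  have "\<exists>F. \<forall>t. - \<infinity> < ereal t \<longrightarrow> ereal t < \<infinity> \<longrightarrow> (F has_vector_derivative slope c t) (at t)"
    by (rule einterval_antiderivative)
      (use slope_continuous[of UNIV c] in \<open>auto simp: continuous_on_eq_continuous_at\<close>)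
  then have "\<exists>F. \<forall>t. (F has_real_derivative slope c t) (at t)"
    by (simp add: has_real_derivative_iff_has_vector_derivative)
  then have "\<forall>t. (slope_integral c has_real_derivative slope c t) (at t)"
    unfolding slope_integral_def by (rule someI_ex)
  then show ?thesis by blast
qed

lemma slope_integral_mvt:
  assumes "s \<le> t"
  obtains \<xi> where "s \<le> \<xi>" "\<xi> \<le> t" "slope_integral c t - slope_integral c s = (t - s) * slope c \<xi>"
proof (cases "s = t")
  case False
  then have "s < t" using assms by simp
  then obtain \<xi> where "s < \<xi>" "\<xi> < t" "slope_integral c t - slope_integral c s = (t - s) * slope c \<xi>"
    using MVT2[of s t "slope_integral c" "slope c"] slope_integral_deriv by blast
  then show ?thesis using that[of \<xi>] by simp
qed (use that in auto)

text \<open>A short step to the right costs its length times \<open>slope c\<close>, so no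
  subsolution climbs along the axis faster than the primitive.\<close>

lemma axis_increment_le:
  assumes c: "0 \<le> c" and f: "dominated c f" and "s \<le> t"
  shows "f (pt t 0) - f (pt s 0) \<le> slope_integral c t - slope_integral c s"
proof -
  let ?L = "16 * pi\<^sup>2 * \<bar>A\<bar>"
  have "f (pt t 0) - slope_integral c t \<le> f (pt s 0) - slope_integral c s"
  \<comment> \<open>One \<open>?L\<close> is the error in domination, the other comes from freezing
    \<open>slope\<close> at \<open>s\<close>.\<close>
  proof (rule nonincreasing_if_quadratic[of "2 * ?L" "\<lambda>t. f (pt t 0) - slope_integral c t", OF _ _ \<open>s \<le> t\<close>])
    fix s t :: real assume st: "s \<le> t"
    obtain \<xi> where \<xi>: "s \<le> \<xi>" "\<xi> \<le> t" "slope_integral c t - slope_integral c s = (t - s) * slope c \<xi>"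
      using slope_integral_mvt[OF st] by blast
    have "?L * \<bar>s - \<xi>\<bar> \<le> ?L * (t - s)" using \<xi>(1,2) by (intro mult_left_mono) auto
    then have "slope c s \<le> slope c \<xi> + ?L * (t - s)"
      using slope_lipschitz[OF c, of s \<xi>] by linarith
    then have "(t - s) * slope c s \<le> (t - s) * (slope c \<xi> + ?L * (t - s))"
      using st by (intro mult_left_mono) auto
    moreover have "f (pt t 0) - f (pt s 0) \<le> (t - s) * slope c s + ?L * (t - s)\<^sup>2"
      using dominatedD[OF f, of "pt t 0" "pt s 0"] cost_axis[of "t - s" c s] st by (simp add: pt_arith)
    ultimately show "f (pt t 0) - slope_integral c t - (f (pt s 0) - slope_integral c s) \<le> 2 * ?L * (t - s)\<^sup>2"
      using \<xi>(3) by (simp add: algebra_simps power2_eq_square)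
  qed simp
  then show ?thesis by simp
qed

end

section \<open>Local subsolutions from gradients, cones and a Riccati barrier\<close>

context drift
begin

text \<open>The mean value theorem on the segment, after which the base point is moved back to
  \<open>x\<close> at the price of \<open>M\<close>.\<close>

lemma gradient_dominated_on:
  assumes c: "0 \<le> c" and V: "convex V" and g: "\<And>x. x \<in> V \<Longrightarrow> GDERIV g x :> D x"
    and H: "\<And>x. x \<in> V \<Longrightarrow> (norm (D x))\<^sup>2 + W x \<bullet> D x \<le> c"
  shows "dominated_on c V g"
proof (rule dominated_onI[of _ _ _ M])
  fix x y assume xy: "x \<in> V" "y \<in> V"
  let ?z = "\<lambda>t. x + t *\<^sub>R (y - x)"
  have zV: "?z t \<in> V" if "0 \<le> t" "t \<le> 1" for t
    using convexD_alt[OF V xy that] by (simp add: algebra_simps)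
  have der: "((\<lambda>t. g (?z t)) has_real_derivative (y - x) \<bullet> D (?z t)) (at t)" if "0 \<le> t" "t \<le> 1" for t
  proof -
    have "(?z has_derivative (\<lambda>h. h *\<^sub>R (y - x))) (at t)" by (auto intro!: derivative_eq_intros)
    from has_derivative_compose[OF this g[OF zV[OF that], unfolded gderiv_def]]
    have "((\<lambda>t. g (?z t)) has_derivative (\<lambda>h. (h *\<^sub>R (y - x)) \<bullet> D (?z t))) (at t)" .
    then show ?thesis unfolding has_field_derivative_def
      by (rule has_derivative_eq_rhs) (auto simp: mult.commute)
  qed
  obtain t where t: "0 < t" "t < 1" "g (?z 1) - g (?z 0) = (1 - 0) * ((y - x) \<bullet> D (?z t))"
    using MVT2[of 0 1 "\<lambda>t. g (?z t)" "\<lambda>t. (y - x) \<bullet> D (?z t)"] der by auto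
  have "g y - g x = D (?z t) \<bullet> (y - x)" using t(3) by (simp add: inner_commute)
  also have "\<dots> \<le> cost c (?z t) (y - x)" using H[OF zV, of t] t by (intro inner_le_cost) auto
  also have "\<dots> \<le> cost c x (y - x) + M * norm (?z t - x) * norm (y - x)" by (rule cost_lip[OF c])
  also have "M * norm (?z t - x) * norm (y - x) \<le> M * (1 * norm (y - x)) * norm (y - x)"
    using t M_nonneg by (intro mult_right_mono mult_left_mono) (auto simp: mult_left_le_one_le)
  finally show "g y - g x \<le> cost c x (y - x) + M * (norm (y - x))\<^sup>2"
    by (simp add: power2_eq_square mult.assoc)
qed

text \<open>With the base point frozen at \<open>z\<close> the cost is subadditive; the factor
  \<open>1 - k\<close> pays for the freezing.\<close>

lemma cone_dominated_on:
  assumes c: "0 \<le> c" and k: "0 \<le> k" "k \<le> 1" and V: "\<And>x. x \<in> V \<Longrightarrow> M * norm (x - z) \<le> k * cost_min c"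
  shows "dominated_on c V (\<lambda>x. (1 - k) * cost c z (x - z))"
proof (rule dominated_onI[of _ _ _ 0])
  fix x y assume "x \<in> V" "y \<in> V"
  have "cost c z (y - z) \<le> cost c z (x - z) + cost c z (y - x)"
    using cost_add_le[OF c, of z "x - z" "y - x"] by simp
  then have "(1 - k) * cost c z (y - z) \<le> (1 - k) * (cost c z (x - z) + cost c z (y - x))"
    using k by (intro mult_left_mono) auto
  moreover have "cost c z (y - x) \<le> cost c x (y - x) + k * cost_min c * norm (y - x)"
    using cost_lip[OF c, of z "y - x" x] mult_right_mono[OF V[OF \<open>x \<in> V\<close>] norm_ge_zero[of "y - x"]]
    by (simp add: norm_minus_commute)
  moreover have "k * cost_min c * norm (y - x) \<le> k * cost c z (y - x)"
    using mult_left_mono[OF cost_min_le[OF c, of "y - x" z] k(1)] by (simp add: mult.assoc)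
  ultimately show "(1 - k) * cost c z (y - z) - (1 - k) * cost c z (x - z)
      \<le> cost c x (y - x) + 0 * (norm (y - x))\<^sup>2"
    by (simp add: algebra_simps)
qed

end

text \<open>Put Y = y^2 / dd^2 and \<beta> = b Y / 2. Lowering the horizontal momentum by \<beta>
  gains at least 2 sqrt c \<beta> = c Y / 2, while \<beta>^2 and the vertical momentum cost at most
  c Y / 16 and c Y / 4. The choice b = sqrt c / 2 thus leaves 3 c Y / 16 for the deviation of the
  field from its axis values, which is of order dd Y.\<close>

lemma riccati_barrier_energy:
  fixes c q w y dd r b \<kappa> W2 Kw Kq KV :: real
  assumes c: "0 < c" and q: "q\<^sup>2 + w * q = c" "2 * sqrt c \<le> 2 * q + w" "0 \<le> q" "q \<le> Kq"
    and w: "\<bar>w\<bar> \<le> Kw" and y: "\<bar>y\<bar> \<le> dd" "0 < dd" "dd \<le> 1"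
    and \<kappa>: "0 \<le> \<kappa>" "\<kappa> \<le> 2 * pi\<^sup>2 * y\<^sup>2" and W2: "\<bar>W2\<bar> \<le> KV * \<bar>y\<bar>" and b: "b = sqrt c / 2"
    and small: "dd * (2 * pi\<^sup>2 * Kw * (Kq + b) + KV * b) \<le> 3 * c / 16"
  shows "(q - b / dd\<^sup>2 * y\<^sup>2 / 2)\<^sup>2 + (b / dd * y)\<^sup>2 + w * (1 - \<kappa>) * (q - b / dd\<^sup>2 * y\<^sup>2 / 2) + W2 * (b / dd * y) \<le> c"
proof -
  define Y where "Y = y\<^sup>2 / dd\<^sup>2"
  have yY: "y\<^sup>2 = Y * dd\<^sup>2" unfolding Y_def using y by simp
  have "y\<^sup>2 \<le> dd\<^sup>2" using power_mono[OF y(1), of 2] by simp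
  then have Y: "0 \<le> Y" "Y \<le> 1" unfolding Y_def using y by auto
  have b0: "0 < b" "b\<^sup>2 = c / 4" "sqrt c * b = c / 2" unfolding b using c by (auto simp: power_divide)
  define \<beta> where "\<beta> = b * Y / 2"
  have \<beta>: "b / dd\<^sup>2 * y\<^sup>2 / 2 = \<beta>" unfolding \<beta>_def Y_def by simp
  have \<beta>0: "0 \<le> \<beta>" "\<beta> \<le> b" unfolding \<beta>_def using b0 Y mult_left_le[of Y b] by auto
  have t1: "2 * sqrt c * \<beta> \<le> (2 * q + w) * \<beta>" using q(2) \<beta>0 by (intro mult_right_mono) auto
  have t1': "2 * sqrt c * \<beta> = c / 2 * Y" unfolding \<beta>_def using b0(3) by (simp add: algebra_simps)
  have t2: "\<beta>\<^sup>2 \<le> c / 16 * Y"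
  proof -
    have "\<beta>\<^sup>2 = c / 16 * (Y * Y)" unfolding \<beta>_def using b0(2) by (simp add: power2_eq_square field_simps)
    also have "\<dots> \<le> c / 16 * Y" using Y c by (intro mult_left_mono) (auto simp: mult_left_le)
    finally show ?thesis .
  qed
  have t3: "(b / dd * y)\<^sup>2 = c / 4 * Y"
    unfolding Y_def power_mult_distrib power_divide b0(2) by simp
  have t4: "- (w * \<kappa> * (q - \<beta>)) \<le> 2 * pi\<^sup>2 * Kw * (Kq + b) * dd * Y"
  proof -
    have "\<bar>q - \<beta>\<bar> \<le> Kq + b" using q(3,4) \<beta>0 b0 by auto
    then have "\<bar>w\<bar> * \<kappa> * \<bar>q - \<beta>\<bar> \<le> Kw * (2 * pi\<^sup>2 * y\<^sup>2) * (Kq + b)"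
      using w \<kappa> by (intro mult_mono mult_nonneg_nonneg) auto
    also have "\<dots> = 2 * pi\<^sup>2 * Kw * (Kq + b) * Y * (dd * dd)" unfolding yY by (simp add: power2_eq_square)
    also have "\<dots> \<le> 2 * pi\<^sup>2 * Kw * (Kq + b) * Y * dd"
      using w q(3,4) b0 Y y by (intro mult_left_mono mult_nonneg_nonneg) (auto simp: mult_left_le)
    finally have "\<bar>w * \<kappa> * (q - \<beta>)\<bar> \<le> 2 * pi\<^sup>2 * Kw * (Kq + b) * Y * dd"
      using \<kappa> by (simp add: abs_mult)
    then show ?thesis by (simp add: algebra_simps abs_le_iff)
  qed
  have t5: "W2 * (b / dd * y) \<le> KV * b * dd * Y"
  proof -
    have "W2 * (b / dd * y) \<le> \<bar>W2\<bar> * (b / dd * \<bar>y\<bar>)"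
      using b0 y abs_ge_self[of "W2 * (b / dd * y)"] by (simp add: abs_mult)
    also have "\<dots> \<le> KV * \<bar>y\<bar> * (b / dd * \<bar>y\<bar>)" using W2 b0 y by (intro mult_right_mono) auto
    also have "\<dots> = KV * b * (y\<^sup>2 / dd)" by (simp add: power2_eq_square)
    also have "\<dots> = KV * b * dd * Y" unfolding yY using y by (simp add: power2_eq_square)
    finally show ?thesis .
  qed
  have small': "(dd * (2 * pi\<^sup>2 * Kw * (Kq + b) + KV * b)) * Y \<le> (3 * c / 16) * Y"
    using small Y by (intro mult_right_mono) auto
  have "(q - \<beta>)\<^sup>2 + (b / dd * y)\<^sup>2 + w * (1 - \<kappa>) * (q - \<beta>) + W2 * (b / dd * y)
      = (q\<^sup>2 + w * q) - (2 * q + w) * \<beta> + \<beta>\<^sup>2 + (b / dd * y)\<^sup>2 + - (w * \<kappa> * (q - \<beta>)) + W2 * (b / dd * y)"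
    by (simp add: power2_eq_square algebra_simps)
  also have "\<dots> \<le> c - c / 2 * Y + c / 16 * Y + c / 4 * Y
       + 2 * pi\<^sup>2 * Kw * (Kq + b) * dd * Y + KV * b * dd * Y"
    using q(1) t1 t1' t2 t3 t4 t5 by linarith
  also have "\<dots> = c - (3 * c / 16) * Y + (dd * (2 * pi\<^sup>2 * Kw * (Kq + b) + KV * b)) * Y"
    by (simp add: algebra_simps)
  finally show ?thesis unfolding \<beta> using small' by linarith
qed

lemma one_minus_cos_le: "1 - cos x \<le> x\<^sup>2 / 2" for x :: real
proof -
  have "1 - cos x = 2 * (sin (x / 2))\<^sup>2" using cos_double_sin[of "x / 2"] by simp
  also have "\<dots> \<le> 2 * (x / 2)\<^sup>2"
    using power_mono[OF abs_sin_x_le_abs_x[of "x / 2"], of 2] by (simp add: power_divide)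
  finally show ?thesis by (simp add: power_divide)
qed

context cellular
begin

text \<open>The primitive on the axis plus a parabola in x2 whose curvature a = b / (x1 - s + 2 r),
  with b = sqrt c / 2, solves the Riccati equation a' = - a^2 / b. The shift by 2 r keeps the pole
  away: for |x1 - s| <= r the denominator runs from r to 3 r.\<close>

definition barrier :: "real \<Rightarrow> real \<Rightarrow> real \<Rightarrow> real^2 \<Rightarrow> real" where
  "barrier c s r x = slope_integral c (x $ 1) - slope_integral c s
     + (sqrt c / 2) / (x $ 1 - s + 2 * r) * (x $ 2)\<^sup>2 / 2"

lemma barrier_gradient:
  assumes "0 < x $ 1 - s + 2 * r"
  shows "GDERIV (barrier c s r) x :>
    pt (slope c (x $ 1) - (sqrt c / 2) / (x $ 1 - s + 2 * r)\<^sup>2 * (x $ 2)\<^sup>2 / 2)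
       ((sqrt c / 2) / (x $ 1 - s + 2 * r) * x $ 2)"
proof -
  have p: "((\<lambda>x::real^2. x $ i) has_derivative (\<lambda>h. h $ i)) (at x)" for i
    using bounded_linear.has_derivative[OF bounded_linear_vec_nth has_derivative_ident] .
  have 1: "((\<lambda>x::real^2. slope_integral c (x $ 1)) has_derivative (\<lambda>h. h $ 1 * slope c (x $ 1))) (at x)"
    by (rule DERIV_compose_FDERIV[OF slope_integral_deriv p])
  have "((\<lambda>t. k / (t - s + 2 * r)) has_real_derivative - k / (x $ 1 - s + 2 * r)\<^sup>2) (at (x $ 1))" for k
    using assms by (auto intro!: derivative_eq_intros simp: power2_eq_square)
  from DERIV_compose_FDERIV[OF this p]
  have 2: "((\<lambda>x::real^2. (sqrt c / 2) / (x $ 1 - s + 2 * r)) has_derivative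
      (\<lambda>h. h $ 1 * (- (sqrt c / 2) / (x $ 1 - s + 2 * r)\<^sup>2))) (at x)" .
  have "((\<lambda>t. t\<^sup>2 / 2) has_real_derivative x $ 2) (at (x $ 2))"
    by (auto intro!: derivative_eq_intros)
  from DERIV_compose_FDERIV[OF this p]
  have 3: "((\<lambda>x::real^2. (x $ 2)\<^sup>2 / 2) has_derivative (\<lambda>h. h $ 2 * x $ 2)) (at x)" .
  have "((\<lambda>x. slope_integral c (x $ 1) - slope_integral c s
     + (sqrt c / 2) / (x $ 1 - s + 2 * r) * ((x $ 2)\<^sup>2 / 2)) has_derivative
     (\<lambda>h. h $ 1 * slope c (x $ 1) - 0 + ((sqrt c / 2) / (x $ 1 - s + 2 * r) * (h $ 2 * x $ 2)
       + h $ 1 * (- (sqrt c / 2) / (x $ 1 - s + 2 * r)\<^sup>2) * ((x $ 2)\<^sup>2 / 2)))) (at x)"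
    by (rule has_derivative_add[OF has_derivative_diff[OF 1 has_derivative_const] has_derivative_mult[OF 2 3]])
  then show ?thesis
    unfolding gderiv_def barrier_def[abs_def]
    by (rule has_derivative_eq_rhs[THEN back_subst[of "\<lambda>f. (f has_derivative _) _"]])
      (auto simp: inner_vec2 fun_eq_iff algebra_simps)
qed

lemma barrier_dominated_on:
  assumes c: "0 < c" and r: "0 < r" "3 * r \<le> 1"
    and small: "3 * r * (2 * pi\<^sup>2 * (2 * pi * \<bar>A\<bar>) * (cost_max c + sqrt c / 2) + 4 * pi\<^sup>2 * \<bar>A\<bar> * (sqrt c / 2)) \<le> 3 * c / 16"
  shows "dominated_on c (cbox (pt (s - r) (- r)) (pt (s + r) r)) (barrier c s r)"
proof (rule gradient_dominated_on)
  show "0 \<le> c" using c by simp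
  show "convex (cbox (pt (s - r) (- r)) (pt (s + r) r))" by (rule convex_box)
  fix x assume x: "x \<in> cbox (pt (s - r) (- r)) (pt (s + r) r)"
  then have x1: "s - r \<le> x $ 1" "x $ 1 \<le> s + r" and x2: "\<bar>x $ 2\<bar> \<le> r"
    by (auto simp: mem_box_cart forall_2)
  let ?dd = "x $ 1 - s + 2 * r"
  have dd: "r \<le> ?dd" "?dd \<le> 3 * r" "0 < ?dd" using x1 r by auto
  show "GDERIV (barrier c s r) x :> pt (slope c (x $ 1) - (sqrt c / 2) / ?dd\<^sup>2 * (x $ 2)\<^sup>2 / 2)
       ((sqrt c / 2) / ?dd * x $ 2)"
    by (rule barrier_gradient[OF dd(3)])
  let ?w = "drift_axis (x $ 1)" and ?q = "slope c (x $ 1)"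
  have W1: "W x $ 1 = ?w * (1 - (1 - cos (2 * pi * x $ 2)))" unfolding W_trig drift_axis_def by simp
  have "(?q - sqrt c / 2 / ?dd\<^sup>2 * (x $ 2)\<^sup>2 / 2)\<^sup>2 + (sqrt c / 2 / ?dd * x $ 2)\<^sup>2
     + ?w * (1 - (1 - cos (2 * pi * x $ 2))) * (?q - sqrt c / 2 / ?dd\<^sup>2 * (x $ 2)\<^sup>2 / 2) + W x $ 2 * (sqrt c / 2 / ?dd * x $ 2) \<le> c"
  proof (rule riccati_barrier_energy[OF c, where Kw = "2 * pi * \<bar>A\<bar>" and Kq = "cost_max c" and KV = "4 * pi\<^sup>2 * \<bar>A\<bar>"])
    show "?q\<^sup>2 + ?w * ?q = c" by (rule slope_energy) (use c in simp)
    have "sqrt c \<le> sqrt (c + ?w\<^sup>2 / 4)" by simp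
    then show "2 * sqrt c \<le> 2 * ?q + ?w" unfolding slope_def by simp
    show "0 \<le> ?q" using slope_pos[OF c] cost_min_pos[OF c] by (meson less_imp_le order_trans)
    show "?q \<le> cost_max c" unfolding slope_eq_cost using cost_le_max[of c "pt (x $ 1) 0" "pt 1 0"] c by simp
    show "\<bar>?w\<bar> \<le> 2 * pi * \<bar>A\<bar>" unfolding drift_axis_def by (simp add: abs_mult mult_left_le)
    show "\<bar>x $ 2\<bar> \<le> ?dd" "0 < ?dd" "?dd \<le> 1" using x2 dd r by auto
    show "0 \<le> 1 - cos (2 * pi * x $ 2)" by simp
    show "1 - cos (2 * pi * x $ 2) \<le> 2 * pi\<^sup>2 * (x $ 2)\<^sup>2"
      using one_minus_cos_le[of "2 * pi * x $ 2"] by (simp add: power_mult_distrib)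
    show "\<bar>W x $ 2\<bar> \<le> 4 * pi\<^sup>2 * \<bar>A\<bar> * \<bar>x $ 2\<bar>"
    proof -
      have "\<bar>W x $ 2\<bar> = 2 * pi * \<bar>A\<bar> * (\<bar>cos (2 * pi * x $ 1)\<bar> * \<bar>sin (2 * pi * x $ 2)\<bar>)"
        unfolding W_trig by (simp add: abs_mult)
      also have "\<dots> \<le> 2 * pi * \<bar>A\<bar> * (1 * \<bar>2 * pi * x $ 2\<bar>)"
        by (intro mult_left_mono mult_mono abs_sin_x_le_abs_x) auto
      finally show ?thesis by (simp add: abs_mult power2_eq_square mult_ac)
    qed
    have "?dd * (2 * pi\<^sup>2 * (2 * pi * \<bar>A\<bar>) * (cost_max c + sqrt c / 2) + 4 * pi\<^sup>2 * \<bar>A\<bar> * (sqrt c / 2))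
      \<le> 3 * r * (2 * pi\<^sup>2 * (2 * pi * \<bar>A\<bar>) * (cost_max c + sqrt c / 2) + 4 * pi\<^sup>2 * \<bar>A\<bar> * (sqrt c / 2))"
      using dd cost_max_pos[OF c] c by (intro mult_right_mono) (auto intro!: add_nonneg_nonneg mult_nonneg_nonneg)
    then show "?dd * (2 * pi\<^sup>2 * (2 * pi * \<bar>A\<bar>) * (cost_max c + sqrt c / 2) + 4 * pi\<^sup>2 * \<bar>A\<bar> * (sqrt c / 2)) \<le> 3 * c / 16"
      using small by linarith
  qed simp
  then show "(norm (pt (?q - (sqrt c / 2) / ?dd\<^sup>2 * (x $ 2)\<^sup>2 / 2) ((sqrt c / 2) / ?dd * x $ 2)))\<^sup>2
      + W x \<bullet> pt (?q - (sqrt c / 2) / ?dd\<^sup>2 * (x $ 2)\<^sup>2 / 2) ((sqrt c / 2) / ?dd * x $ 2) \<le> c"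
    unfolding norm_vec2_sq inner_vec2 W1 by (simp add: add.assoc)
qed

end

section \<open>Propagation of contact points\<close>

context smooth_drift
begin

definition concavity_const :: "real \<Rightarrow> real" where
  "concavity_const c = 2 * cost_max c * semiconcavity c / cost_min c"

text \<open>The radius within which both smallness conditions of the semiconcavity estimate
  hold.\<close>

definition concavity_radius :: "real \<Rightarrow> real" where
  "concavity_radius c = min (1/8) (sqrt (cost_min c / semiconcavity c))"

lemma concavity_const_nonneg: "0 < c \<Longrightarrow> 0 \<le> concavity_const c"
  unfolding concavity_const_def
  using cost_max_pos[of c] semiconcavity_pos[of c] cost_min_pos[of c] by simp

lemma concavity_radius_pos: "0 < c \<Longrightarrow> 0 < concavity_radius c"
  unfolding concavity_radius_def using semiconcavity_pos[of c] cost_min_pos[of c] by simp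

lemma concavity_radiusD:
  assumes "0 < c" "norm d \<le> concavity_radius c"
  shows "norm d \<le> 1/8" "semiconcavity c * (norm d)\<^sup>2 \<le> cost_min c"
proof -
  show "norm d \<le> 1/8" using assms unfolding concavity_radius_def by simp
  have "norm d \<le> sqrt (cost_min c / semiconcavity c)" using assms unfolding concavity_radius_def by simp
  then have "(norm d)\<^sup>2 \<le> (sqrt (cost_min c / semiconcavity c))\<^sup>2" by (intro power_mono) auto
  also have "\<dots> = cost_min c / semiconcavity c"
    using semiconcavity_pos[OF assms(1)] cost_min_pos[OF assms(1)] by simp
  finally show "semiconcavity c * (norm d)\<^sup>2 \<le> cost_min c"
    using semiconcavity_pos[OF assms(1)] by (simp add: field_simps)
qed

lemma maximal_semiconcave:
  assumes c: "0 < c" and f: "dominated c f" "locally_maximal c f"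
    and t: "0 \<le> t" "t \<le> 1" and d: "norm d \<le> concavity_radius c"
  shows "t * f (x + (1 - t) *\<^sub>R d) + (1 - t) * f (x - t *\<^sub>R d)
    \<le> f x + concavity_const c * (t * (1 - t) * (norm d)\<^sup>2)"
  using locally_maximal_semiconcave[OF c f t concavity_radiusD[OF c d]]
  unfolding concavity_const_def by simp

lemma minimal_semiconvex:
  assumes c: "0 < c" and f: "dominated c f" "locally_minimal c f"
    and t: "0 \<le> t" "t \<le> 1" and d: "norm d \<le> concavity_radius c"
  shows "t * - f (x + (1 - t) *\<^sub>R d) + (1 - t) * - f (x - t *\<^sub>R d)
    \<le> - f x + concavity_const c * (t * (1 - t) * (norm d)\<^sup>2)"
proof -
  have "drift.dominated (\<lambda>x. - W x) M c (\<lambda>x. - f x)" using reversed_dominated[of c f] f(1) c by simp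
  moreover have "drift.locally_maximal (\<lambda>x. - W x) c (\<lambda>x. - f x)" using f(2) unfolding locally_minimal_def .
  ultimately show ?thesis
    using smooth_drift.maximal_semiconcave[OF reversed_smooth c, of "\<lambda>x. - f x" t d x] t d by simp
qed

end

text \<open>For a semiconcave function even in the second variable, the one-dimensional supergradient along
  the axis is a supergradient in the plane.\<close>

lemma even_semiconcave:
  fixes F :: "real^2 \<Rightarrow> real"
  assumes even: "\<And>t y. F (pt t (- y)) = F (pt t y)"
    and semi: "\<And>x d t. 0 \<le> t \<Longrightarrow> t \<le> 1 \<Longrightarrow> norm d \<le> \<delta> \<Longrightarrow>
      t * F (x + (1 - t) *\<^sub>R d) + (1 - t) * F (x - t *\<^sub>R d) \<le> F x + C * (t * (1 - t) * (norm d)\<^sup>2)"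
  shows "\<bar>y\<bar> \<le> \<delta> / 2 \<Longrightarrow> F (pt t y) \<le> F (pt t 0) + C * y\<^sup>2"
    and "0 < \<delta> \<Longrightarrow> 0 \<le> C \<Longrightarrow>
      \<exists>q. \<forall>v. norm v \<le> \<delta> / 2 \<longrightarrow> F (pt s 0 + v) \<le> F (pt s 0) + q * v $ 1 + C * (norm v)\<^sup>2"
proof -
  have vert: "F (pt t y) \<le> F (pt t 0) + C * y\<^sup>2" if "\<bar>y\<bar> \<le> \<delta> / 2" for t y
  proof -
    have "1/2 * F (pt t 0 + (1 - 1/2) *\<^sub>R pt 0 (2 * y)) + (1 - 1/2) * F (pt t 0 - (1/2) *\<^sub>R pt 0 (2 * y))
      \<le> F (pt t 0) + C * (1/2 * (1 - 1/2) * (norm (pt 0 (2 * y)))\<^sup>2)"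
      by (rule semi) (use that in auto)
    then show ?thesis using even[of t y] by (simp add: pt_arith power_mult_distrib)
  qed
  then show "\<bar>y\<bar> \<le> \<delta> / 2 \<Longrightarrow> F (pt t y) \<le> F (pt t 0) + C * y\<^sup>2" .
  assume \<delta>: "0 < \<delta>" and C: "0 \<le> C"
  define h where "h t = F (pt (s + t) 0) - F (pt s 0)" for t
  \<comment> \<open>Semiconcavity at the three points -b, 0 and a: every corrected difference
    quotient to the right lies below every one to the left, so a supremum of the former separates
    them.\<close>
  have two: "h a / a - C * a \<le> - (h (- b) / b) + C * b" if ab: "0 < a" "a \<le> \<delta>/2" "0 < b" "b \<le> \<delta>/2" for a b
  proof -
    define t where "t = b / (a + b)"
    have t: "0 \<le> t" "t \<le> 1" "1 - t = a / (a + b)" "(1 - t) * (a + b) = a" "t * (a + b) = b"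
      unfolding t_def using ab by (auto simp: field_simps)
    have "t * F (pt s 0 + (1 - t) *\<^sub>R pt (a + b) 0) + (1 - t) * F (pt s 0 - t *\<^sub>R pt (a + b) 0)
       \<le> F (pt s 0) + C * (t * (1 - t) * (norm (pt (a + b) 0))\<^sup>2)"
      by (rule semi) (use t ab in auto)
    then have "t * h a + (1 - t) * h (- b) \<le> C * (t * (1 - t) * (a + b)\<^sup>2)"
      unfolding h_def pt_arith scaleR_right_distrib using t(4,5) by (simp add: pt_arith algebra_simps)
    also have "t * (1 - t) * (a + b)\<^sup>2 = (t * (a + b)) * ((1 - t) * (a + b))" by (simp add: power2_eq_square)
    also have "\<dots> = b * a" using t by simp
    finally have "(t * h a + (1 - t) * h (- b)) * (a + b) \<le> C * (b * a) * (a + b)"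
      using ab by (intro mult_right_mono) auto
    moreover have "(t * h a + (1 - t) * h (- b)) * (a + b) = (t * (a + b)) * h a + ((1 - t) * (a + b)) * h (- b)"
      by (simp add: algebra_simps)
    ultimately have "b * h a + a * h (- b) \<le> C * (b * a) * (a + b)" using t by simp
    then have "(b * h a + a * h (- b)) / (a * b) \<le> C * (b * a) * (a + b) / (a * b)"
      using ab by (intro divide_right_mono) auto
    moreover have "(b * h a + a * h (- b)) / (a * b) = h a / a + h (- b) / b"
      using ab by (simp add: add_divide_distrib)
    moreover have "C * (b * a) * (a + b) / (a * b) = C * a + C * b"
    proof -
      have "C * (b * a) * (a + b) = (C * a + C * b) * (a * b)" by (simp add: algebra_simps)
      then show ?thesis using ab by simp
    qed
    ultimately show ?thesis by linarith
  qed
  let ?I = "{0<..\<delta>/2}"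
  define q where "q = (SUP a\<in>?I. h a / a - C * a)"
  have I: "\<delta>/2 \<in> ?I" using \<delta> by simp
  have bdd: "bdd_above ((\<lambda>a. h a / a - C * a) ` ?I)"
    using two[OF _ _ _ order_refl] \<delta> by (intro bdd_aboveI[where M = "- (h (- (\<delta>/2)) / (\<delta>/2)) + C * (\<delta>/2)"]) auto
  have pos: "h a \<le> q * a + C * a\<^sup>2" if "0 < a" "a \<le> \<delta>/2" for a
  proof -
    have "h a / a - C * a \<le> q" unfolding q_def by (rule cSUP_upper[OF _ bdd]) (use that in simp)
    then show ?thesis using that by (simp add: field_simps power2_eq_square)
  qed
  have neg: "h (- b) \<le> q * (- b) + C * b\<^sup>2" if b: "0 < b" "b \<le> \<delta>/2" for b
  proof -
    have "q \<le> - (h (- b) / b) + C * b"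
      unfolding q_def by (rule cSUP_least) (use I two b in auto)
    then show ?thesis using b by (simp add: field_simps power2_eq_square)
  qed
  have hor: "h a \<le> q * a + C * a\<^sup>2" if "\<bar>a\<bar> \<le> \<delta>/2" for a
    using pos[of a] neg[of "- a"] that by (cases a "0::real" rule: linorder_cases) (auto simp: h_def)
  have "F (pt s 0 + v) \<le> F (pt s 0) + q * v $ 1 + C * (norm v)\<^sup>2" if v: "norm v \<le> \<delta> / 2" for v
  proof -
    have v12: "\<bar>v $ 1\<bar> \<le> \<delta>/2" "\<bar>v $ 2\<bar> \<le> \<delta>/2" using component_le_norm_cart[of v] v order_trans by blast+
    have "pt s 0 + v = pt (s + v $ 1) (v $ 2)" by (simp add: vec_eq_iff forall_2)
    then have "F (pt s 0 + v) \<le> F (pt (s + v $ 1) 0) + C * (v $ 2)\<^sup>2" using vert[OF v12(2)] by simp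
    moreover have "F (pt (s + v $ 1) 0) \<le> F (pt s 0) + q * v $ 1 + C * (v $ 1)\<^sup>2"
      using hor[OF v12(1)] unfolding h_def by simp
    ultimately show ?thesis unfolding norm_vec2_sq by (simp add: algebra_simps)
  qed
  then show "\<exists>q. \<forall>v. norm v \<le> \<delta> / 2 \<longrightarrow> F (pt s 0 + v) \<le> F (pt s 0) + q * v $ 1 + C * (norm v)\<^sup>2" by blast
qed

lemma equal_slopes:
  fixes a b C \<delta> :: real
  assumes "0 < \<delta>" "0 \<le> C" "\<And>t. \<bar>t\<bar> \<le> \<delta> \<Longrightarrow> a * t \<le> b * t + C * t\<^sup>2"
  shows "a = b"
proof -
  have "\<bar>a - b\<bar> \<le> C * t" if "0 < t" "t \<le> \<delta>" for t
  proof -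
    have "(a - b) * t \<le> (C * t) * t" "(b - a) * t \<le> (C * t) * t"
      using assms(3)[of t] assms(3)[of "- t"] that by (auto simp: algebra_simps power2_eq_square)
    then show ?thesis using that by (simp add: abs_le_iff)
  qed
  then have *: "\<bar>a - b\<bar> \<le> C * min \<delta> (e / (C + 1))" if "0 < e" for e
    using assms(1,2) that by simp
  have "\<bar>a - b\<bar> \<le> 0 + e" if "0 < e" for e
  proof -
    have "C * min \<delta> (e / (C + 1)) \<le> C * (e / (C + 1))" using assms(2) by (intro mult_left_mono) auto
    also have "\<dots> \<le> e" using assms(2) that by (simp add: field_simps)
    finally show ?thesis using *[OF that] by simp
  qed
  then have "\<bar>a - b\<bar> \<le> 0" by (rule field_le_epsilon)
  then show ?thesis by simp
qed

lemma eventually_quadratic_le: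
  fixes x :: "'a::real_normed_vector"
  assumes "0 < e" "0 \<le> C" "0 < \<delta>"
  shows "\<forall>\<^sub>F y in nhds x. norm (y - x) \<le> \<delta> \<and> C * (norm (y - x))\<^sup>2 \<le> e * norm (y - x)"
proof -
  have "C * (norm (y - x))\<^sup>2 \<le> e * norm (y - x)" if "dist y x < min \<delta> (e / (C + 1))" for y
  proof -
    have "norm (y - x) \<le> e / (C + 1)" using that by (simp add: dist_norm)
    then have "norm (y - x) * (C + 1) \<le> e" using assms by (simp add: pos_le_divide_eq)
    moreover have "norm (y - x) * (C + 1) = C * norm (y - x) + norm (y - x)" by (simp add: algebra_simps)
    ultimately have "C * norm (y - x) \<le> e" using norm_ge_zero[of "y - x"] by linarith
    then show ?thesis using mult_right_mono[of "C * norm (y - x)" e "norm (y - x)"]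
      by (simp add: power2_eq_square mult.assoc)
  qed
  moreover have "0 < min \<delta> (e / (C + 1))" using assms by simp
  ultimately show ?thesis unfolding eventually_nhds_metric dist_norm
    by (intro exI[of _ "min \<delta> (e / (C + 1))"]) (auto simp: dist_norm)
qed

context cellular
begin

text \<open>The momentum does not appear, so the notion is invariant under reflection in x1, which
  changes the sign of its first component.\<close>

definition conjugate :: "real \<Rightarrow> (real^2 \<Rightarrow> real) \<Rightarrow> (real^2 \<Rightarrow> real) \<Rightarrow> bool" where
  "conjugate c f g \<longleftrightarrow> dominated c f \<and> dominated c g \<and> locally_maximal c f \<and> locally_minimal c g \<and>
     (\<forall>x. g x \<le> f x) \<and> (\<forall>x. f (reflect2 x) = f x) \<and> (\<forall>x. g (reflect2 x) = g x)"

text \<open>Both \<open>f\<close> and \<open>- g\<close> lie below paraboloids. With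
  \<open>g \<le> f\<close> and contact the two slopes agree, so \<open>f\<close> is squeezed to
  second order around a horizontal gradient. Tested from above and from below, its energy is exactly
  \<open>c\<close>, which leaves two roots.\<close>

lemma conjugate_contact_gradient:
  assumes c: "0 < c" and fg: "conjugate c f g" and touch: "f (pt s 0) = g (pt s 0)"
  obtains q where "q = slope c s \<or> q = - slope c (- s)"
    "\<And>v. norm v \<le> concavity_radius c / 2 \<Longrightarrow> f (pt s 0 + v) \<le> f (pt s 0) + q * v $ 1 + concavity_const c * (norm v)\<^sup>2"
    "\<And>v. norm v \<le> concavity_radius c / 2 \<Longrightarrow> f (pt s 0 + v) \<ge> f (pt s 0) + q * v $ 1 - concavity_const c * (norm v)\<^sup>2"
proof -
  let ?z = "pt s 0" and ?C = "concavity_const c" and ?\<delta> = "concavity_radius c"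
  have dom: "dominated c f" "dominated c g" and lm: "locally_maximal c f" "locally_minimal c g"
    and gf: "\<And>x. g x \<le> f x" and ev: "\<And>x. f (reflect2 x) = f x" "\<And>x. g (reflect2 x) = g x"
    using fg unfolding conjugate_def by auto
  have C: "0 \<le> ?C" and \<delta>: "0 < ?\<delta>" using concavity_const_nonneg[OF c] concavity_radius_pos[OF c] .
  have r2: "reflect2 (pt t y) = pt t (- y)" for t y unfolding reflect2_def by simp
  have evf: "f (pt t (- y)) = f (pt t y)" for t y using ev(1)[of "pt t y"] unfolding r2 .
  have evg: "- g (pt t (- y)) = - g (pt t y)" for t y using ev(2)[of "pt t y"] unfolding r2 by simp
  obtain q where q: "\<And>v. norm v \<le> ?\<delta> / 2 \<Longrightarrow> f (?z + v) \<le> f ?z + q * v $ 1 + ?C * (norm v)\<^sup>2"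
    using even_semiconcave(2)[OF evf maximal_semiconcave[OF c dom(1) lm(1)] \<delta> C, of s] by blast
  obtain q' where q': "\<And>v. norm v \<le> ?\<delta> / 2 \<Longrightarrow> - g (?z + v) \<le> - g ?z + q' * v $ 1 + ?C * (norm v)\<^sup>2"
    using even_semiconcave(2)[of "\<lambda>x. - g x", OF evg minimal_semiconvex[OF c dom(2) lm(2)] \<delta> C, of s] by blast
  have low: "f (?z + v) \<ge> f ?z - q' * v $ 1 - ?C * (norm v)\<^sup>2" if "norm v \<le> ?\<delta> / 2" for v
    using q'[OF that] gf[of "?z + v"] touch by simp
  have "- q' = q"
  proof (rule equal_slopes[of "?\<delta> / 2" "2 * ?C"])
    fix t :: real assume "\<bar>t\<bar> \<le> ?\<delta> / 2"
    then show "- q' * t \<le> q * t + 2 * ?C * t\<^sup>2" using q[of "pt t 0"] low[of "pt t 0"] by simp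
  qed (use C \<delta> in auto)
  then have low': "f (?z + v) \<ge> f ?z + q * v $ 1 - ?C * (norm v)\<^sup>2" if "norm v \<le> ?\<delta> / 2" for v
    using low[OF that] by auto
  have \<delta>2: "0 < ?\<delta> / 2" using \<delta> by simp
  have "(norm (pt q 0))\<^sup>2 + W ?z \<bullet> pt q 0 \<le> c"
  proof (rule dominated_touch_above[OF _ dom(1)])
    fix e :: real assume "0 < e"
    show "\<forall>\<^sub>F y in nhds ?z. f y \<le> f ?z + pt q 0 \<bullet> (y - ?z) + e * norm (y - ?z)"
      using eventually_quadratic_le[OF \<open>0 < e\<close> C \<delta>2, of ?z]
    proof eventually_elim
      case (elim y)
      then show ?case using q[of "y - ?z"] by (simp add: inner_vec2)
    qed
  qed (use c in simp)
  moreover have "c \<le> (norm (pt q 0))\<^sup>2 + W ?z \<bullet> pt q 0"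
  proof (rule locally_maximal_touch_below[OF c lm(1)])
    fix e :: real assume "0 < e"
    show "\<forall>\<^sub>F y in nhds ?z. f ?z + pt q 0 \<bullet> (y - ?z) - e * norm (y - ?z) \<le> f y"
      using eventually_quadratic_le[OF \<open>0 < e\<close> C \<delta>2, of ?z]
    proof eventually_elim
      case (elim y)
      then show ?case using low'[of "y - ?z"] by (simp add: inner_vec2)
    qed
  qed
  ultimately have "q\<^sup>2 + drift_axis s * q = c" by (simp add: W_axis inner_vec2)
  then have "q = slope c s \<or> q = - slope c (- s)" by (intro slope_roots) (use c in auto)
  then show ?thesis using that[OF _ q low'] by blast
qed

text \<open>Contact points propagate along the axis. Otherwise \<open>g\<close> would lie below a local barrier: near the
  axis its graph opens with curvature of order \<open>1/r\<close> at distance \<open>r\<close>, which exceeds the semiconcavity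
  constant of \<open>f\<close>; away from the axis the cone of the cost dominates.\<close>

lemma conjugate_propagation:
  assumes c: "0 < c" and fg: "conjugate c f g"
  obtains r1 where "0 < r1"
    "\<And>s r. f (pt s 0) = g (pt s 0) \<Longrightarrow>
       (\<And>v. norm v \<le> concavity_radius c / 2 \<Longrightarrow>
          f (pt s 0 + v) \<le> f (pt s 0) + slope c s * v $ 1 + concavity_const c * (norm v)\<^sup>2) \<Longrightarrow>
       0 < r \<Longrightarrow> r \<le> r1 \<Longrightarrow>
       f (pt s 0) + (slope_integral c (s + r) - slope_integral c s) \<le> g (pt (s + r) 0)"
proof -
  let ?C = "concavity_const c" and ?\<delta> = "concavity_radius c / 2"
  let ?M = "16 * pi\<^sup>2 * \<bar>A\<bar>" and ?cm = "cost_min c" and ?cM = "cost_max c"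
  have dom: "dominated c f" "dominated c g" and lm: "locally_maximal c f" "locally_minimal c g"
    and gf: "\<And>x. g x \<le> f x" and ev: "\<And>x. f (reflect2 x) = f x"
    using fg unfolding conjugate_def by auto
  have c0: "0 \<le> c" using c by simp
  have C: "0 \<le> ?C" and \<delta>: "0 < ?\<delta>" using concavity_const_nonneg[OF c] concavity_radius_pos[OF c] by auto
  have cm: "0 < ?cm" and cM: "0 < ?cM" using cost_min_pos[OF c] cost_max_pos[OF c] .
  have sc: "0 < sqrt c" using c by simp
  have vert: "f (pt t y) \<le> f (pt t 0) + ?C * y\<^sup>2" if "\<bar>y\<bar> \<le> ?\<delta>" for t y
  proof (rule even_semiconcave(1)[OF _ maximal_semiconcave[OF c dom(1) lm(1)]])
    show "f (pt t (- y)) = f (pt t y)" for t y using ev[of "pt t y"] unfolding reflect2_def by simp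
  qed (use that in auto)
  define K1 where "K1 = 2 * pi\<^sup>2 * (2 * pi * \<bar>A\<bar>) * (?cM + sqrt c / 2) + 4 * pi\<^sup>2 * \<bar>A\<bar> * (sqrt c / 2)"
  define K3 where "K3 = 4 * ?M * ?cM / ?cm"
  have K1: "0 \<le> K1" unfolding K1_def using cM sc by simp
  have K3: "0 \<le> K3" unfolding K3_def using cM cm by simp
  \<comment> \<open>In this order the bounds ensure: the barrier energy is at most \<open>c\<close>;
    the box fits into the ball of radius 1/2; it stays within the semiconcavity radius;
    \<open>k \<le> 1\<close>; on the right side the barrier has curvature at least 2 (C + 1); on the
    other sides the cone beats curvature and shrinking.\<close>
  define r1 where "r1 = min (c / (16 * (K1 + 1))) (min (1/6) (min (?\<delta> / 2) (min (?cm / (2 * (?M + 1)))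
    (min (sqrt c / 2 / (6 * (?C + 1))) (sqrt c / 5 / (K3 + 2 * ?C + 1))))))"
  have "0 < K1 + 1" "0 < ?M + 1" "0 < ?C + 1" "0 < K3 + 2 * ?C + 1"
    using K1 C K3 by (auto simp: add_nonneg_pos)
  then have r1: "0 < r1" unfolding r1_def using c \<delta> cm sc by (simp only: min_less_iff_conj) simp
  show ?thesis
  proof (rule that[OF r1])
    fix s r
    assume touch: "f (pt s 0) = g (pt s 0)"
      and grad: "\<And>v. norm v \<le> ?\<delta> \<Longrightarrow> f (pt s 0 + v) \<le> f (pt s 0) + slope c s * v $ 1 + ?C * (norm v)\<^sup>2"
      and r: "0 < r" "r \<le> r1"
    have r_le: "r \<le> c / (16 * (K1 + 1))" "r \<le> 1/6" "r \<le> ?\<delta> / 2" "r \<le> ?cm / (2 * (?M + 1))"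
      "r \<le> sqrt c / 2 / (6 * (?C + 1))" "r \<le> sqrt c / 5 / (K3 + 2 * ?C + 1)"
      by (rule order_trans[OF r(2)], simp only: r1_def min_le_iff_disj order_refl simp_thms)+
    let ?z = "pt s 0" and ?V = "cbox (pt (s - r) (- r)) (pt (s + r) r)"
    let ?\<Delta> = "slope_integral c (s + r) - slope_integral c s"
    have fr: "f (pt (s + r) 0) \<le> f ?z + ?\<Delta>"
      using axis_increment_le[OF c0 dom(1), of s "s + r"] r by simp
    show "f ?z + ?\<Delta> \<le> g (pt (s + r) 0)"
    proof (rule ccontr)
      assume "\<not> f ?z + ?\<Delta> \<le> g (pt (s + r) 0)"
      define e where "e = f ?z + ?\<Delta> - g (pt (s + r) 0)"
      have e: "0 < e" unfolding e_def using \<open>\<not> _\<close> by simp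
      \<comment> \<open>Up to height \<open>y0\<close> the Lipschitz bound of \<open>g\<close> uses
        only half of the gap \<open>e\<close>. Below, \<open>\<eta>\<close> respects three margins:
        e / 2 up to that height on the right side, \<open>y0\<^sup>2\<close> beyond it, and the
        margin of the cone on the other sides.\<close>
      define y0 where "y0 = e / (2 * ?cM)"
      have y0: "0 < y0" "?cM * y0 = e / 2" unfolding y0_def using e cM by auto
      define \<eta> where "\<eta> = min (e / 2) (min (y0\<^sup>2) (sqrt c / 5 * r))"
      have \<eta>: "0 < \<eta>" "\<eta> \<le> e / 2" "\<eta> \<le> y0\<^sup>2" "\<eta> \<le> sqrt c / 5 * r"
        unfolding \<eta>_def using e y0 sc r by auto
      define k where "k = 2 * ?M * r / ?cm"
      have "r * (2 * (?M + 1)) \<le> ?cm" using r_le(4) by (simp add: pos_le_divide_eq add_nonneg_pos)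
      then have k: "0 \<le> k" "k \<le> 1" "k * ?cm = 2 * ?M * r"
        unfolding k_def using cm r by (auto simp: pos_divide_le_eq algebra_simps)
      let ?D1 = "\<lambda>x. (1 - k) * cost c ?z (x - ?z)" and ?D2 = "barrier c s r"
      \<comment> \<open>The barrier controls the right side of the box and the cone the other three.
        At \<open>?z\<close> both vanish, so \<open>?h\<close> falls short of \<open>g\<close> there
        by \<open>\<eta>\<close>, against local minimality.\<close>
      let ?h = "\<lambda>x. max (?D1 x) (?D2 x) + (f ?z - \<eta>)"
      have inV: "\<bar>x $ 1 - s\<bar> \<le> r \<and> \<bar>x $ 2\<bar> \<le> r" if "x \<in> ?V" for x
        using that by (auto simp: mem_box_cart forall_2 abs_le_iff)
      have nV: "norm (x - ?z) \<le> 2 * r" if "x \<in> ?V" for x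
        using norm_vec2_le[of "x - ?z"] inV[OF that] by simp
      have D1: "dominated_on c ?V ?D1"
      proof (rule cone_dominated_on[OF c0 k(1,2)])
        fix x assume "x \<in> ?V"
        show "?M * norm (x - ?z) \<le> k * ?cm"
          unfolding k(3) using mult_left_mono[OF nV[OF \<open>x \<in> ?V\<close>], of ?M] by simp
      qed
      have D2: "dominated_on c ?V ?D2"
      proof (rule barrier_dominated_on[OF c r(1)])
        show "3 * r * (2 * pi\<^sup>2 * (2 * pi * \<bar>A\<bar>) * (?cM + sqrt c / 2) + 4 * pi\<^sup>2 * \<bar>A\<bar> * (sqrt c / 2)) \<le> 3 * c / 16"
        proof -
          have "r * (16 * (K1 + 1)) \<le> c" using r_le(1) K1 by (simp add: pos_le_divide_eq)
          then have "r * K1 \<le> c / 16" using r by (simp add: algebra_simps)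
          moreover have "3 * r * K1 = 3 * (r * K1)" by (rule mult.assoc)
          ultimately show ?thesis unfolding K1_def[symmetric] by linarith
        qed
      qed (use r_le in simp)
      have hdom: "dominated_on c ?V ?h"
        by (rule dominated_on_add_const[OF dominated_on_max[OF D1 D2]])
      have "g ?z \<le> ?h ?z"
      proof (rule locally_minimalD[OF c0 lm(2) compact_cbox _ hdom])
        show "?V \<subseteq> ball ?z (1/2)"
        proof
          fix x assume "x \<in> ?V"
          then show "x \<in> ball ?z (1/2)" using nV[of x] r_le(2) by (simp add: dist_norm norm_minus_commute)
        qed
        show "?z \<in> ?V" using r by (simp add: mem_box_cart forall_2)
        fix x assume "x \<in> frontier ?V"
        then have xV: "x \<in> ?V" and xb: "x \<notin> box (pt (s - r) (- r)) (pt (s + r) r)"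
          unfolding frontier_cbox by auto
        define v where "v = x - ?z"
        have v: "v $ 1 = x $ 1 - s" "v $ 2 = x $ 2" unfolding v_def by simp_all
        have vr: "\<bar>v $ 1\<bar> \<le> r" "\<bar>v $ 2\<bar> \<le> r" using inV[OF xV] unfolding v by auto
        have nv: "norm v \<le> 2 * r" using nV[OF xV] unfolding v_def .
        show "g x \<le> ?h x"
        proof (cases "v $ 1 = r")
          case True
          then have x: "x = pt (s + r) (x $ 2)" using v by (simp add: vec_eq_iff forall_2)
          have D2x: "?D2 x = ?\<Delta> + (sqrt c / 2) / (3 * r) * (x $ 2)\<^sup>2 / 2"
          proof -
            have "x $ 1 = s + r" using True v(1) by simp
            then show ?thesis unfolding barrier_def by simp
          qed
          have "0 < 6 * (?C + 1)" "0 < 3 * r" using C r by auto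
          note div = this[THEN pos_le_divide_eq]
          have "r * (6 * (?C + 1)) \<le> sqrt c / 2" using r_le(5) div(1) by blast
          moreover have "2 * (?C + 1) * (3 * r) = r * (6 * (?C + 1))" by (simp add: algebra_simps)
          ultimately have a: "2 * (?C + 1) \<le> (sqrt c / 2) / (3 * r)" unfolding div(2) by linarith
          have "g x \<le> f ?z - \<eta> + ?D2 x"
          proof (cases "\<bar>x $ 2\<bar> \<le> y0")
            case True
            have "g x - g (pt (s + r) 0) \<le> ?cM * norm (x - pt (s + r) 0)"
              by (rule dominated_lip_le[OF c0 dom(2)])
            also have "norm (x - pt (s + r) 0) = \<bar>x $ 2\<bar>" by (subst x) (simp add: pt_arith)
            also have "?cM * \<bar>x $ 2\<bar> \<le> ?cM * y0" using True cM by (intro mult_left_mono) auto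
            finally have "g x \<le> f ?z + ?\<Delta> - e + e / 2" using y0(2) e_def by linarith
            moreover have "0 \<le> (sqrt c / 2) / (3 * r) * (x $ 2)\<^sup>2 / 2" using sc r by simp
            ultimately show ?thesis unfolding D2x using \<eta>(2) by linarith
          next
            case False
            then have "y0\<^sup>2 \<le> (x $ 2)\<^sup>2" using power_mono[of y0 "\<bar>x $ 2\<bar>" 2] y0 by simp
            moreover have "2 * (?C + 1) * (x $ 2)\<^sup>2 / 2 \<le> (sqrt c / 2) / (3 * r) * (x $ 2)\<^sup>2 / 2"
              using a by (intro divide_right_mono mult_right_mono) auto
            then have "?C * (x $ 2)\<^sup>2 + (x $ 2)\<^sup>2 \<le> (sqrt c / 2) / (3 * r) * (x $ 2)\<^sup>2 / 2"
              by (simp add: algebra_simps)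
            moreover have "f x \<le> f (pt (s + r) 0) + ?C * (x $ 2)\<^sup>2"
              by (subst x, rule vert) (use vr v r_le(3) \<delta> in auto)
            ultimately show ?thesis unfolding D2x using gf[of x] fr \<eta>(3) by linarith
          qed
          then show ?thesis using max.cobounded2[of "?D2 x" "?D1 x"] by simp
        next
          case False
          \<comment> \<open>On the horizontal sides 4/5 + 4/25 < 1 makes the constant 2/5 possible;
            on the left side \<open>v $ 1\<close> is negative. The cone therefore exceeds the linear
            part by 2 sqrt c r / 5, half for curvature and shrinking, half for
            \<open>\<eta>\<close>.\<close>
          have side: "v $ 1 + 2/5 * r \<le> norm v"
          proof (cases "\<bar>v $ 2\<bar> = r")
            case True
            have "(v $ 1 + 2/5 * r)\<^sup>2 = (v $ 1)\<^sup>2 + 4/5 * (v $ 1 * r) + 4/25 * r\<^sup>2"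
              by (simp add: power2_sum power_mult_distrib power_divide)
            also have "v $ 1 * r \<le> r * r" using vr(1) r by (intro mult_right_mono) auto
            also have "(v $ 1)\<^sup>2 + 4/5 * (r * r) + 4/25 * r\<^sup>2 \<le> (v $ 1)\<^sup>2 + \<bar>v $ 2\<bar>\<^sup>2"
              unfolding True by (simp add: power2_eq_square)
            finally have "(v $ 1 + 2/5 * r)\<^sup>2 \<le> (norm v)\<^sup>2" unfolding norm_vec2_sq by simp
            then show ?thesis by (rule power2_le_imp_le) simp
          next
            case F: False
            have "v $ 1 = - r"
              using xb False F vr unfolding v mem_box_cart forall_2 by (auto simp: abs_le_iff)
            then show ?thesis using norm_ge_zero[of v] r by linarith
          qed
          let ?N = "sqrt (c + (drift_axis s)\<^sup>2 / 4)"
          have costv: "cost c ?z v - slope c s * v $ 1 = ?N * (norm v - v $ 1)"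
            unfolding cost_def slope_def W_axis by (simp add: inner_vec2 algebra_simps)
          have "sqrt c * (2/5 * r) \<le> ?N * (norm v - v $ 1)"
            using side sc r by (intro mult_mono) auto
          then have cs: "slope c s * v $ 1 + sqrt c * (2/5 * r) \<le> cost c ?z v" using costv by linarith
          have "k * cost c ?z v \<le> k * (?cM * (2 * r))"
            using cM k(1) by (intro mult_left_mono order_trans[OF cost_le_max[OF c0] mult_left_mono[OF nv]]) auto
          also have "\<dots> = K3 * r * r" unfolding k_def K3_def by simp
          finally have kc: "k * cost c ?z v \<le> K3 * r * r" .
          have "(norm v)\<^sup>2 = (v $ 1)\<^sup>2 + (v $ 2)\<^sup>2" by (rule norm_vec2_sq)
          also have "\<dots> \<le> r\<^sup>2 + r\<^sup>2"
            using power_mono[OF vr(1) abs_ge_zero, of 2] power_mono[OF vr(2) abs_ge_zero, of 2] by simp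
          finally have "?C * (norm v)\<^sup>2 \<le> ?C * (2 * (r * r))" using C by (intro mult_left_mono) (auto simp: power2_eq_square)
          moreover have "0 < K3 + 2 * ?C + 1" using K3 C by simp
          then have "r * (K3 + 2 * ?C + 1) \<le> sqrt c / 5" using r_le(6) pos_le_divide_eq by blast
          then have rK: "(r * (K3 + 2 * ?C + 1)) * r \<le> (sqrt c / 5) * r" using r by (intro mult_right_mono) auto
          have "K3 * r * r + ?C * (2 * (r * r)) \<le> sqrt c / 5 * r"
          proof -
            have "(r * (K3 + 2 * a + 1)) * r = K3 * r * r + a * (2 * (r * r)) + r * r" for a
              by (simp add: algebra_simps)
            from this[of ?C] show ?thesis using rK zero_le_square[of r] by linarith
          qed
          moreover have "f (?z + v) \<le> f ?z + slope c s * v $ 1 + ?C * (norm v)\<^sup>2"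
            by (rule grad) (use nv r_le(3) in simp)
          moreover have "?z + v = x" unfolding v_def by simp
          moreover have "(1 - k) * cost c ?z v = cost c ?z v - k * cost c ?z v" by (simp add: algebra_simps)
          moreover have "sqrt c * (2/5 * r) = 2 * (sqrt c / 5 * r)" by simp
          ultimately have "f x \<le> f ?z - \<eta> + (1 - k) * cost c ?z v"
            using cs kc \<eta>(4) by (simp only:)
          then show ?thesis using gf[of x] max.cobounded1[of "?D1 x" "?D2 x"] unfolding v_def by simp
        qed
      qed
      moreover have "?D2 ?z = 0" unfolding barrier_def by simp
      ultimately show False using touch \<eta>(1) by simp
    qed
  qed
qed

end

section \<open>Strictness on the axis\<close>

lemma sqrt_diff_ge:
  fixes a x N :: real
  assumes "0 < a" "0 \<le> x" "sqrt (a + x) \<le> N"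
  shows "x / (2 * N) \<le> sqrt (a + x) - sqrt a"
proof -
  have le: "sqrt a \<le> sqrt (a + x)" and N: "0 < N" using assms by (auto intro: less_le_trans[of _ "sqrt (a + x)"])
  have "x = (sqrt (a + x))\<^sup>2 - (sqrt a)\<^sup>2" using assms by simp
  also have "\<dots> = (sqrt (a + x) - sqrt a) * (sqrt (a + x) + sqrt a)" by (simp add: power2_eq_square algebra_simps)
  also have "\<dots> \<le> (sqrt (a + x) - sqrt a) * (2 * N)"
    using le assms(3) by (intro mult_left_mono) linarith+
  finally show ?thesis using N by (simp add: pos_divide_le_eq)
qed

definition clamp_half :: "real \<Rightarrow> real" where "clamp_half x = max (-1/2) (min (1/2) x)"

text \<open>A staircase: near an integer \<open>m\<close> it rises from \<open>m - 1/2\<close> to \<open>m + 1/2\<close> over \<open>[m - \<epsilon>, m + \<epsilon>]\<close>.\<close>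

definition staircase :: "real \<Rightarrow> real \<Rightarrow> real" where
  "staircase \<epsilon> t = of_int \<lfloor>t + 1/2\<rfloor> + clamp_half ((t - of_int \<lfloor>t + 1/2\<rfloor>) / (2 * \<epsilon>))"

lemma staircase_add_1: "staircase \<epsilon> (t + 1) = staircase \<epsilon> t + 1"
proof -
  have "\<lfloor>t + 1 + 1/2\<rfloor> = \<lfloor>t + 1/2\<rfloor> + 1" by linarith
  then show ?thesis unfolding staircase_def by simp
qed

lemma clamp_half_const: "1/2 \<le> x \<Longrightarrow> clamp_half x = 1/2" "x \<le> -1/2 \<Longrightarrow> clamp_half x = -1/2"
  unfolding clamp_half_def by auto

lemma clamp_half_lipschitz: "clamp_half x - clamp_half y \<le> \<bar>x - y\<bar>"
  unfolding clamp_half_def by linarith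

text \<open>Farther than \<open>\<epsilon>\<close> from the integers the staircase is flat, so the
  formula around \<open>m\<close> persists past the rounding point, up to the next riser.\<close>

lemma staircase_near:
  assumes \<epsilon>: "0 < \<epsilon>" "\<epsilon> \<le> 1/4" and t: "\<bar>t - of_int m\<bar> \<le> 1 - \<epsilon>"
  shows "staircase \<epsilon> t = of_int m + clamp_half ((t - of_int m) / (2 * \<epsilon>))"
proof -
  let ?n = "\<lfloor>t + 1/2\<rfloor>"
  have n: "- 1/2 \<le> t - of_int ?n" "t - of_int ?n < 1/2" by linarith+
  have big: "1/2 \<le> x / (2 * \<epsilon>)" if "\<epsilon> \<le> x" for x using that \<epsilon> by (simp add: pos_le_divide_eq)
  have small: "x / (2 * \<epsilon>) \<le> -1/2" if "x \<le> - \<epsilon>" for x using that \<epsilon> by (simp add: pos_divide_le_eq)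
  have "?n = m \<or> ?n = m + 1 \<or> ?n = m - 1" using n t \<epsilon> by linarith
  then consider "?n = m" | "?n = m + 1" | "?n = m - 1" by blast
  then show ?thesis
  proof cases
    case 2
    have "clamp_half ((t - of_int (m + 1)) / (2 * \<epsilon>)) = -1/2"
      by (rule clamp_half_const(2)[OF small]) (use t in simp)
    moreover have "clamp_half ((t - of_int m) / (2 * \<epsilon>)) = 1/2"
      by (rule clamp_half_const(1)[OF big]) (use n 2 \<epsilon> in linarith)
    ultimately show ?thesis unfolding staircase_def 2 by simp
  next
    case 3
    have "clamp_half ((t - of_int (m - 1)) / (2 * \<epsilon>)) = 1/2"
      by (rule clamp_half_const(1)[OF big]) (use t in simp)
    moreover have "clamp_half ((t - of_int m) / (2 * \<epsilon>)) = -1/2"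
      by (rule clamp_half_const(2)[OF small]) (use n 3 \<epsilon> in linarith)
    ultimately show ?thesis unfolding staircase_def 3 by simp
  qed (simp add: staircase_def)
qed

context cellular
begin

text \<open>The part of \<open>slope\<close> that is odd in t integrates to zero over a period. The
  even part exceeds \<open>sqrt c\<close> by at least a multiple of sin^2, and that multiple is
  positive because \<open>A \<noteq> 0\<close>.\<close>

lemma slope_integral_period:
  assumes c: "0 < c"
  shows "sqrt c < slope_integral c (s + 1) - slope_integral c s"
proof -
  define k where "k = pi\<^sup>2 * A\<^sup>2 / (4 * cost_max c)"
  have k: "0 < k" unfolding k_def using A_nonzero cost_max_pos[OF c] by simp
  \<comment> \<open>The cosine cancels the odd part of \<open>slope\<close>; the last term is a
    primitive of \<open>k * (1 - cos (4 * pi * t))\<close>, whose increment over a period is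
    \<open>k\<close>.\<close>
  let ?G = "\<lambda>t. slope_integral c t + (A / 2) * cos (2 * pi * t) - sqrt c * t - k * (t - sin (4 * pi * t) / (4 * pi))"
  let ?G' = "\<lambda>t. slope c t - pi * A * sin (2 * pi * t) - sqrt c - k * (1 - cos (4 * pi * t))"
  have der: "(?G has_real_derivative ?G' t) (at t)" for t
    by (auto intro!: derivative_eq_intros slope_integral_deriv)
  have nonneg: "0 \<le> ?G' t" for t
  proof -
    let ?w = "drift_axis t"
    have w2: "?w\<^sup>2 / 4 = pi\<^sup>2 * A\<^sup>2 * (sin (2 * pi * t))\<^sup>2"
      unfolding drift_axis_def by (simp add: power_mult_distrib)
    have "sqrt (c + ?w\<^sup>2 / 4) \<le> cost_max c"
    proof -
      have "sqrt (c + ?w\<^sup>2 / 4) = slope c t / 2 + slope c (- t) / 2"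
        unfolding slope_def drift_axis_def by (simp add: field_simps)
      moreover have "slope c u \<le> cost_max c" for u
        unfolding slope_eq_cost using cost_le_max[of c "pt u 0" "pt 1 0"] c by simp
      from this[of t] this[of "- t"] have "slope c t / 2 + slope c (- t) / 2 \<le> cost_max c" by linarith
      ultimately show ?thesis by simp
    qed
    then have "?w\<^sup>2 / 4 / (2 * cost_max c) \<le> sqrt (c + ?w\<^sup>2 / 4) - sqrt c"
      by (intro sqrt_diff_ge c) auto
    moreover have "?w\<^sup>2 / 4 / (2 * cost_max c) = k * (2 * (sin (2 * pi * t))\<^sup>2)"
      unfolding w2 k_def by simp
    moreover have "2 * (sin (2 * pi * t))\<^sup>2 = 1 - cos (4 * pi * t)"
      using cos_double_sin[of "2 * pi * t"] by (simp add: mult.assoc)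
    moreover have "slope c t - pi * A * sin (2 * pi * t) = sqrt (c + ?w\<^sup>2 / 4)"
      unfolding slope_def drift_axis_def by simp
    ultimately show ?thesis by simp
  qed
  have "?G s \<le> ?G (s + 1)"
    by (rule DERIV_nonneg_imp_nondecreasing[of s "s + 1" ?G]) (use der nonneg in \<open>auto intro!: exI\<close>)
  moreover have "cos (2 * pi * (s + 1)) = cos (2 * pi * s)"
    using cos_periodic[of "2 * pi * s"] by (simp add: algebra_simps)
  moreover have "sin (4 * pi * (s + 1)) = sin (4 * pi * s)"
    using sin_periodic[of "4 * pi * s"] sin_periodic[of "4 * pi * s + 2 * pi"] by (simp add: algebra_simps)
  ultimately show ?thesis using k by (simp add: algebra_simps)
qed

text \<open>The lower bound for \<open>g\<close> and the upper bound on axis increments enclose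
  \<open>f\<close>, so the whole step consists of contact points. The gradient at its end cannot be
  the negative root, since \<open>f\<close> arrives there increasing.\<close>

lemma conjugate_step:
  assumes c: "0 < c" and fg: "conjugate c f g" and r: "0 < r"
    and ext: "\<And>r'. 0 < r' \<Longrightarrow> r' \<le> r \<Longrightarrow>
       f (pt s 0) + (slope_integral c (s + r') - slope_integral c s) \<le> g (pt (s + r') 0)"
  shows "f (pt (s + r) 0) = f (pt s 0) + (slope_integral c (s + r) - slope_integral c s)"
    "f (pt (s + r) 0) = g (pt (s + r) 0)"
    "norm v \<le> concavity_radius c / 2 \<Longrightarrow>
       f (pt (s + r) 0 + v) \<le> f (pt (s + r) 0) + slope c (s + r) * v $ 1 + concavity_const c * (norm v)\<^sup>2"
proof -
  have fd: "dominated c f" and gf: "\<And>x. g x \<le> f x" using fg unfolding conjugate_def by auto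
  have sat: "f (pt (s + r') 0) = f (pt s 0) + (slope_integral c (s + r') - slope_integral c s)"
    and "f (pt (s + r') 0) = g (pt (s + r') 0)" if "0 < r'" "r' \<le> r" for r'
    using ext[OF that] gf[of "pt (s + r') 0"] axis_increment_le[OF _ fd, of s "s + r'"] that c by auto
  then show touch: "f (pt (s + r) 0) = g (pt (s + r) 0)"
    and "f (pt (s + r) 0) = f (pt s 0) + (slope_integral c (s + r) - slope_integral c s)"
    using r by auto
  obtain q where q: "q = slope c (s + r) \<or> q = - slope c (- (s + r))"
    and up: "\<And>v. norm v \<le> concavity_radius c / 2 \<Longrightarrow>
      f (pt (s + r) 0 + v) \<le> f (pt (s + r) 0) + q * v $ 1 + concavity_const c * (norm v)\<^sup>2"
    and low: "\<And>v. norm v \<le> concavity_radius c / 2 \<Longrightarrow>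
      f (pt (s + r) 0 + v) \<ge> f (pt (s + r) 0) + q * v $ 1 - concavity_const c * (norm v)\<^sup>2"
    using conjugate_contact_gradient[OF c fg touch] by blast
  have "q \<noteq> - slope c (- (s + r))"
  proof
    assume qn: "q = - slope c (- (s + r))"
    let ?C = "concavity_const c" and ?m = "cost_min c"
    have m: "0 < ?m" by (rule cost_min_pos[OF c])
    have C: "0 \<le> ?C" by (rule concavity_const_nonneg[OF c])
    have rad: "0 < concavity_radius c" by (rule concavity_radius_pos[OF c])
    \<comment> \<open>Moving back by \<open>t\<close> lowers \<open>f\<close> by at least
      \<open>t * ?m\<close>, whereas the negative root would raise it by that much up to
      \<open>?C * t\<^sup>2\<close>; this \<open>t\<close> makes the quadratic term too small to
      reconcile them.\<close>
    define t where "t = min (r / 2) (min (concavity_radius c / 2) (?m / (?C + 1)))"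
    have C1: "0 < ?C + 1" using C by simp
    have "t \<le> r / 2" "t \<le> concavity_radius c / 2" "t \<le> ?m / (?C + 1)"
      by (simp_all only: t_def min_le_iff_disj order_refl simp_thms)
    moreover have "0 < t" unfolding t_def using r m C1 rad by (simp only: min_less_iff_conj) simp
    ultimately have t: "0 < t" "t < r" "t \<le> concavity_radius c / 2" "t \<le> ?m / (?C + 1)"
      using r by linarith+
    have "t * (?C + 1) \<le> ?m" using t(4) pos_le_divide_eq[OF C1] by blast
    then have Ct: "?C * t \<le> ?m" using t(1) by (simp only: distrib_left mult.commute)
    have "s + (r - t) \<le> s + r" using t by simp
    then obtain \<xi> where \<xi>: "slope_integral c (s + r) - slope_integral c (s + (r - t)) = (s + r - (s + (r - t))) * slope c \<xi>"
      by (rule slope_integral_mvt)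
    have "f (pt (s + (r - t)) 0) - f (pt (s + r) 0) = - (t * slope c \<xi>)"
      using sat[of "r - t"] sat[of r] t r \<xi> by simp
    also have "\<dots> \<le> - (t * ?m)" using slope_pos[OF c, of \<xi>] t by simp
    finally have "f (pt (s + (r - t)) 0) \<le> f (pt (s + r) 0) - t * ?m" by simp
    moreover have "f (pt (s + r) 0 + pt (- t) 0) \<ge> f (pt (s + r) 0) + q * (- t) - ?C * t\<^sup>2"
      using low[of "pt (- t) 0"] t by simp
    moreover have "pt (s + r) 0 + pt (- t) 0 = pt (s + (r - t)) 0" by (simp add: pt_arith add_diff_eq)
    moreover have "q * (- t) \<ge> t * ?m" unfolding qn using slope_pos[OF c, of "- (s + r)"] t by simp
    ultimately have "2 * (t * ?m) \<le> ?C * t\<^sup>2" by (simp only:)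
    also have "\<dots> = t * (?C * t)" by (simp add: power2_eq_square)
    also have "\<dots> \<le> t * ?m" using Ct t by (intro mult_left_mono) auto
    finally show False using t(1) m mult_pos_pos[of t ?m] by linarith
  qed
  with q up show "norm v \<le> concavity_radius c / 2 \<Longrightarrow>
       f (pt (s + r) 0 + v) \<le> f (pt (s + r) 0) + slope c (s + r) * v $ 1 + concavity_const c * (norm v)\<^sup>2"
    by blast
qed

text \<open>The admissible step is independent of the point, so \<open>n\<close> steps of length 1 /
  n traverse a period; contact and the sign of the gradient are carried along.\<close>

lemma conjugate_period:
  assumes c: "0 < c" and fg: "conjugate c f g" and touch: "f (pt s 0) = g (pt s 0)"
    and grad: "\<And>v. norm v \<le> concavity_radius c / 2 \<Longrightarrow>
      f (pt s 0 + v) \<le> f (pt s 0) + slope c s * v $ 1 + concavity_const c * (norm v)\<^sup>2"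
  shows "f (pt (s + 1) 0) - f (pt s 0) = slope_integral c (s + 1) - slope_integral c s"
proof -
  obtain r1 where r1: "0 < r1" and ext: "\<And>s r. f (pt s 0) = g (pt s 0) \<Longrightarrow>
       (\<And>v. norm v \<le> concavity_radius c / 2 \<Longrightarrow>
          f (pt s 0 + v) \<le> f (pt s 0) + slope c s * v $ 1 + concavity_const c * (norm v)\<^sup>2) \<Longrightarrow>
       0 < r \<Longrightarrow> r \<le> r1 \<Longrightarrow>
       f (pt s 0) + (slope_integral c (s + r) - slope_integral c s) \<le> g (pt (s + r) 0)"
    using conjugate_propagation[OF c fg] by blast
  obtain n :: nat where n: "1 / r1 < real n" using reals_Archimedean2 by blast
  have n0: "0 < real n" using n r1 by (meson divide_pos_pos less_trans zero_less_one)
  define r where "r = 1 / real n"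
  have r: "0 < r" "r \<le> r1" unfolding r_def using n0 n r1 by (auto simp: field_simps)
  have "f (pt (s + k * r) 0) = g (pt (s + k * r) 0) \<and>
      f (pt (s + k * r) 0) - f (pt s 0) = slope_integral c (s + k * r) - slope_integral c s \<and>
      (\<forall>v. norm v \<le> concavity_radius c / 2 \<longrightarrow> f (pt (s + k * r) 0 + v)
        \<le> f (pt (s + k * r) 0) + slope c (s + k * r) * v $ 1 + concavity_const c * (norm v)\<^sup>2)" for k :: nat
  proof (induction k)
    case 0
    show ?case using touch grad by simp
  next
    case (Suc k)
    let ?s = "s + k * r"
    have step: "f (pt ?s 0) + (slope_integral c (?s + r') - slope_integral c ?s) \<le> g (pt (?s + r') 0)"
      if "0 < r'" "r' \<le> r" for r'
      by (rule ext) (use Suc that r in auto)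
    have eq: "s + Suc k * r = ?s + r" by (simp add: algebra_simps)
    show ?case unfolding eq using conjugate_step[OF c fg r(1) step] Suc by auto
  qed
  from this[of n] show ?thesis unfolding r_def using n0 by simp
qed

text \<open>Reflection in x1 exchanges the two horizontal momenta, which reduces the negative root
  to the positive one.\<close>

lemma conjugate_reflect: "0 \<le> c \<Longrightarrow> conjugate c f g \<Longrightarrow> conjugate c (\<lambda>x. f (reflect1 x)) (\<lambda>x. g (reflect1 x))"
proof -
  have "reflect1 (reflect2 x) = reflect2 (reflect1 x)" for x by (simp add: vec_eq_iff forall_2)
  then show "0 \<le> c \<Longrightarrow> conjugate c f g \<Longrightarrow> conjugate c (\<lambda>x. f (reflect1 x)) (\<lambda>x. g (reflect1 x))"
    unfolding conjugate_def
    using dominated_reflect(1) locally_maximal_reflect locally_minimal_reflect by simp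
qed

lemma axis_shift: "equivariant (pt l m) f \<Longrightarrow> f (pt (s + 1) 0) = f (pt s 0) + l"
proof -
  have "pt (s + 1) 0 = pt s 0 + axis 1 1" by (simp add: vec_eq_iff forall_2 axis_def)
  then show "equivariant (pt l m) f \<Longrightarrow> f (pt (s + 1) 0) = f (pt s 0) + l"
    unfolding equivariant_def by simp
qed

text \<open>If the axis carried a point without strict admissible function, the whole axis would be calibrated,
  which forces \<open>l\<close> to be the period of \<open>slope_integral\<close>, a number exceeding \<open>sqrt c\<close>.\<close>

lemma strict_on_axis:
  assumes l: "0 < l" "l\<^sup>2 \<le> c" and ex: "admissible c (pt l 0) f0"
  shows "strict_on c (pt l 0) {pt s 0}"
proof (rule ccontr)
  assume ns: "\<not> strict_on c (pt l 0) {pt s 0}"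
  have c: "0 < c" using l by (meson less_le_trans zero_less_power)
  have r2: "reflect2 (pt t 0) = pt t 0" for t unfolding reflect2_def by simp
  have lc: "l \<le> sqrt c" using l by (intro real_le_rsqrt) auto
  obtain f g where fg: "admissible c (pt l 0) f" "admissible c (pt l 0) g" "locally_maximal c f" "locally_minimal c g"
    "\<And>x. g x \<le> f x" and touch: "f (pt s 0) = g (pt s 0)"
    and ev: "\<And>x. f (reflect2 x) = f x" "\<And>x. g (reflect2 x) = g x"
  proof (rule conjugate_pair[OF c ex ns, of reflect2])
    show "admissible c (pt l 0) (h \<circ> reflect2)" if "admissible c (pt l 0) h" for h
      using admissible_reflect(2)[OF that] unfolding r2 comp_def .
  qed (use r2 in auto)
  have conj: "conjugate c f g" using fg ev unfolding conjugate_def admissible_def by simp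
  have eq: "equivariant (pt l 0) f" using fg(1) unfolding admissible_def by simp
  obtain q where q: "q = slope c s \<or> q = - slope c (- s)"
    and up: "\<And>v. norm v \<le> concavity_radius c / 2 \<Longrightarrow>
      f (pt s 0 + v) \<le> f (pt s 0) + q * v $ 1 + concavity_const c * (norm v)\<^sup>2"
    and "\<And>v. norm v \<le> concavity_radius c / 2 \<Longrightarrow>
      f (pt s 0 + v) \<ge> f (pt s 0) + q * v $ 1 - concavity_const c * (norm v)\<^sup>2"
    using conjugate_contact_gradient[OF c conj touch] by blast
  from q show False
  proof
    assume "q = slope c s"
    then have "f (pt (s + 1) 0) - f (pt s 0) = slope_integral c (s + 1) - slope_integral c s"
      using conjugate_period[OF c conj touch] up by blast
    then show False using axis_shift[OF eq, of s] slope_integral_period[OF c, of s] lc by simp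
  next
    \<comment> \<open>After reflection the axis is followed to the left, and the same argument shows
      that \<open>- l\<close> equals a positive period.\<close>
    assume q: "q = - slope c (- s)"
    let ?f = "\<lambda>x. f (reflect1 x)" and ?g = "\<lambda>x. g (reflect1 x)"
    have r1: "reflect1 (pt t 0) = pt (- t) 0" for t unfolding reflect1_def by simp
    have "?f (pt (- s + 1) 0) - ?f (pt (- s) 0) = slope_integral c (- s + 1) - slope_integral c (- s)"
    proof (rule conjugate_period[OF c conjugate_reflect[OF _ conj]])
      show "?f (pt (- s) 0) = ?g (pt (- s) 0)" using touch unfolding r1 by simp
      fix v :: "real^2" assume v: "norm v \<le> concavity_radius c / 2"
      have "reflect1 (pt (- s) 0 + v) = pt s 0 + reflect1 v" by (simp add: vec_eq_iff forall_2)
      then show "?f (pt (- s) 0 + v) \<le> ?f (pt (- s) 0) + slope c (- s) * v $ 1 + concavity_const c * (norm v)\<^sup>2"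
        using up[of "reflect1 v"] v unfolding r1 q by simp
    qed (use c in simp)
    then have "f (pt (s - 1) 0) - f (pt s 0) = slope_integral c (- s + 1) - slope_integral c (- s)"
      unfolding r1 by simp
    moreover have "f (pt s 0) = f (pt (s - 1) 0) + l" using axis_shift[OF eq, of "s - 1"] by simp
    moreover have "0 \<le> sqrt c" using c by simp
    ultimately show False using slope_integral_period[OF c, of "- s"] l by linarith
  qed
qed

lemma admissible_tilted:
  assumes l: "0 < l" "l\<^sup>2 \<le> c" and ex: "admissible c (pt l 0) f0"
  obtains \<mu> f where "0 < \<mu>" "admissible c (pt l \<mu>) f"
proof -
  have c: "0 < c" using l by (meson less_le_trans zero_less_power)
  let ?T = "(\<lambda>t. pt t 0) ` {0..1}"
  have "continuous_on {0..1} (\<lambda>t. pt t 0)"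
    by (rule continuous_on_eq[of _ "\<lambda>t. t *\<^sub>R axis 1 1"])
      (auto intro!: continuous_intros simp: vec_eq_iff forall_2 axis_def)
  then have "compact ?T" by (intro compact_continuous_image) auto
  then have "strict_on c (pt l 0) ?T"
    by (rule strict_on_compact[OF _ ex c]) (use strict_on_axis[OF l ex] in auto)
  define T' where "T' = {x + k |x k. x \<in> ?T \<and> k \<in> lattice}"
  have st: "strict_on c (pt l 0) T'"
    unfolding T'_def by (rule strict_on_translates) fact
  have inT: "pt t (of_int n) \<in> T'" for t n
  proof -
    have "pt t (of_int n) = pt (frac t) 0 + pt (of_int \<lfloor>t\<rfloor>) (of_int n)"
      by (simp add: pt_arith frac_def)
    moreover have "pt (frac t) 0 \<in> ?T" using frac_ge_0[of t] frac_lt_1[of t] by force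
    moreover have "pt (of_int \<lfloor>t\<rfloor>) (of_int n) \<in> lattice" unfolding lattice_def by (simp add: forall_2)
    ultimately show ?thesis unfolding T'_def by blast
  qed
  obtain f d r K where f: "admissible c (pt l 0) f" "0 < d" "d \<le> c" "0 < r"
    and fT: "\<And>z x y. z \<in> T' \<Longrightarrow> x \<in> ball z r \<Longrightarrow> y \<in> ball z r \<Longrightarrow>
      f y - f x \<le> cost (c - d) x (y - x) + K * (norm (y - x))\<^sup>2"
    using st by (rule strict_onE) metis
  have fd: "dominated c f" and fe: "equivariant (pt l 0) f" using f(1) unfolding admissible_def by auto
  have "0 \<le> c - d" "c - d < c" using f(2,3) by auto
  then obtain \<kappa> where \<kappa>: "0 < \<kappa>" "\<And>x v. cost (c - d) x v + \<kappa> * norm v \<le> cost c x v"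
    using cost_gap[of "c - d" c] by blast
  \<comment> \<open>With \<open>x\<close> within 2 \<epsilon> of a horizontal lattice line and
    \<open>y\<close> within \<epsilon> of \<open>x\<close>, both must lie in one ball of radius
    \<open>r\<close>.\<close>
  define \<epsilon> where "\<epsilon> = min (1/4) (r / 4)"
  have \<epsilon>: "0 < \<epsilon>" "\<epsilon> \<le> 1/4" "3 * \<epsilon> < r" unfolding \<epsilon>_def using f(4) by auto
  \<comment> \<open>The staircase has slope at most 1 / (2 \<epsilon>), so this tilt spends exactly
    the free slope \<open>\<kappa>\<close>.\<close>
  define \<mu> where "\<mu> = 2 * \<epsilon> * \<kappa>"
  have \<mu>: "0 < \<mu>" unfolding \<mu>_def using \<epsilon> \<kappa> by simp
  define h where "h x = f x + \<mu> * staircase \<epsilon> (x $ 2)" for x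
  have "dominated c h"
  proof (rule dominatedI[OF _ \<epsilon>(1), of _ _ "max (16 * pi\<^sup>2 * \<bar>A\<bar>) K"])
    fix x y :: "real^2" assume xy: "norm (y - x) < \<epsilon>"
    let ?K = "max (16 * pi\<^sup>2 * \<bar>A\<bar>) K" and ?n = "\<lfloor>x $ 2 + 1/2\<rfloor>"
    have comp: "\<bar>y $ 2 - x $ 2\<bar> \<le> norm (y - x)" using component_le_norm_cart[of "y - x" 2] by simp
    have xn: "\<bar>x $ 2 - of_int ?n\<bar> \<le> 1/2" by linarith
    have sx: "staircase \<epsilon> (x $ 2) = of_int ?n + clamp_half ((x $ 2 - of_int ?n) / (2 * \<epsilon>))"
      by (rule staircase_near[OF \<epsilon>(1,2)]) (use xn \<epsilon> in linarith)
    have sy: "staircase \<epsilon> (y $ 2) = of_int ?n + clamp_half ((y $ 2 - of_int ?n) / (2 * \<epsilon>))"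
      by (rule staircase_near[OF \<epsilon>(1,2)]) (use xn xy comp \<epsilon> in linarith)
    have K1: "16 * pi\<^sup>2 * \<bar>A\<bar> * (norm (y - x))\<^sup>2 \<le> ?K * (norm (y - x))\<^sup>2"
      and K2: "K * (norm (y - x))\<^sup>2 \<le> ?K * (norm (y - x))\<^sup>2" by (intro mult_right_mono; simp)+
    show "h y - h x \<le> cost c x (y - x) + ?K * (norm (y - x))\<^sup>2"
    \<comment> \<open>The threshold is twice the half-width of a riser; beyond it \<open>x\<close>
      and \<open>y\<close> lie on the same flat step.\<close>
    proof (cases "\<bar>x $ 2 - of_int ?n\<bar> < 2 * \<epsilon>")
      case True
      have "norm (x - pt (x $ 1) (of_int ?n)) < 2 * \<epsilon>"
        using norm_vec2_le[of "x - pt (x $ 1) (of_int ?n)"] True by simp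
      moreover have "norm (y - pt (x $ 1) (of_int ?n)) \<le> norm (y - x) + norm (x - pt (x $ 1) (of_int ?n))"
        using norm_triangle_ineq[of "y - x" "x - pt (x $ 1) (of_int ?n)"] by simp
      ultimately have "x \<in> ball (pt (x $ 1) (of_int ?n)) r" "y \<in> ball (pt (x $ 1) (of_int ?n)) r"
        using \<epsilon> xy by (auto simp: dist_norm norm_minus_commute)
      from fT[OF inT this] have "f y - f x \<le> cost (c - d) x (y - x) + K * (norm (y - x))\<^sup>2" .
      moreover have "\<mu> * (staircase \<epsilon> (y $ 2) - staircase \<epsilon> (x $ 2)) \<le> \<kappa> * norm (y - x)"
      proof -
        have "staircase \<epsilon> (y $ 2) - staircase \<epsilon> (x $ 2) \<le> \<bar>(y $ 2 - of_int ?n) / (2 * \<epsilon>) - (x $ 2 - of_int ?n) / (2 * \<epsilon>)\<bar>"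
          unfolding sx sy using clamp_half_lipschitz by simp
        also have "\<dots> = \<bar>y $ 2 - x $ 2\<bar> / (2 * \<epsilon>)" using \<epsilon>(1) by (simp add: abs_divide flip: diff_divide_distrib)
        also have "\<dots> \<le> norm (y - x) / (2 * \<epsilon>)" using comp \<epsilon>(1) by (intro divide_right_mono) auto
        finally have "\<mu> * (staircase \<epsilon> (y $ 2) - staircase \<epsilon> (x $ 2)) \<le> \<mu> * (norm (y - x) / (2 * \<epsilon>))"
          using \<mu> by (intro mult_left_mono) auto
        also have "\<dots> = \<kappa> * norm (y - x)" unfolding \<mu>_def using \<epsilon>(1) by simp
        finally show ?thesis .
      qed
      ultimately show ?thesis unfolding h_def using \<kappa>(2)[of x "y - x"] K2 by (simp add: algebra_simps)
    next
      case False
      have "staircase \<epsilon> (y $ 2) = staircase \<epsilon> (x $ 2)"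
      proof (cases "x $ 2 - of_int ?n \<ge> 0")
        case True
        then have "\<epsilon> \<le> x $ 2 - of_int ?n" "\<epsilon> \<le> y $ 2 - of_int ?n" using False \<epsilon> comp xy by linarith+
        then have "1/2 \<le> (x $ 2 - of_int ?n) / (2 * \<epsilon>)" "1/2 \<le> (y $ 2 - of_int ?n) / (2 * \<epsilon>)"
          using \<epsilon>(1) by (auto simp: pos_le_divide_eq)
        then show ?thesis unfolding sx sy by (simp only: clamp_half_const(1))
      next
        case F: False
        then have "x $ 2 - of_int ?n \<le> - \<epsilon>" "y $ 2 - of_int ?n \<le> - \<epsilon>" using False \<epsilon> comp xy by linarith+
        then have "(x $ 2 - of_int ?n) / (2 * \<epsilon>) \<le> -1/2" "(y $ 2 - of_int ?n) / (2 * \<epsilon>) \<le> -1/2"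
          using \<epsilon>(1) by (auto simp: pos_divide_le_eq)
        then show ?thesis unfolding sx sy by (simp only: clamp_half_const(2))
      qed
      then show ?thesis unfolding h_def using dominatedD[OF fd, of y x] K1 by simp
    qed
  qed (use c in simp)
  moreover have "equivariant (pt l \<mu>) h"
    unfolding equivariant_def h_def
  proof (intro allI)
    fix x :: "real^2" and i :: 2
    show "f (x + axis i 1) + \<mu> * staircase \<epsilon> ((x + axis i 1) $ 2) = f x + \<mu> * staircase \<epsilon> (x $ 2) + pt l \<mu> $ i"
      using exhaust_2[of i] fe staircase_add_1[of \<epsilon> "x $ 2"]
      by (auto simp: equivariant_def axis_def algebra_simps)
  qed
  ultimately show ?thesis using that[OF \<mu>] unfolding admissible_def by blast
qed

end

section \<open>The averaging bound\<close>

text \<open>A primitive of a periodic function has a constant increment over unit intervals. The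
  sign \<open>\<sigma>\<close> allows the reversed traversal that one of the diagonals
  requires.\<close>

lemma integral_periodic:
  fixes \<phi> :: "real \<Rightarrow> real"
  assumes cont: "continuous_on UNIV \<phi>" and per: "\<And>t. \<phi> (t + 1) = \<phi> t" and \<sigma>: "\<sigma> = 1 \<or> \<sigma> = -1"
  shows "integral {0..1} (\<lambda>t. \<phi> (s + \<sigma> * t)) = integral {0..1} \<phi>"
proof -
  have "\<exists>F. \<forall>t. - \<infinity> < ereal t \<longrightarrow> ereal t < \<infinity> \<longrightarrow> (F has_vector_derivative \<phi> t) (at t)"
    by (rule einterval_antiderivative) (use cont in \<open>auto simp: continuous_on_eq_continuous_at\<close>)
  then obtain F where F: "\<And>t. (F has_real_derivative \<phi> t) (at t)"
    by (auto simp: has_real_derivative_iff_has_vector_derivative)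
  have D: "F (s + 1) - F s = F 1 - F 0" for s
  proof -
    have "((\<lambda>s. F (s + 1) - F s) has_real_derivative 0) (at s)" for s
      using DERIV_diff[OF F[of "s + 1", unfolded DERIV_shift] F[of s]] per by simp
    then show ?thesis using DERIV_isconst_all[of "\<lambda>s. F (s + 1) - F s" s 0] by simp
  qed
  have "((\<lambda>t. \<phi> (s + \<sigma> * t)) has_integral \<sigma> * F (s + \<sigma> * 1) - \<sigma> * F (s + \<sigma> * 0)) {0..1}"
  proof (rule fundamental_theorem_of_calculus)
    fix t :: real
    have "((\<lambda>t. \<sigma> * F (s + \<sigma> * t)) has_real_derivative \<phi> (s + \<sigma> * t)) (at t)"
    proof -
      have "((\<lambda>t. s + \<sigma> * t) has_real_derivative \<sigma>) (at t)" by (auto intro!: derivative_eq_intros)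
      from DERIV_cmult[OF DERIV_chain2[OF F this], of \<sigma>] show ?thesis using \<sigma> by auto
    qed
    then show "((\<lambda>t. \<sigma> * F (s + \<sigma> * t)) has_vector_derivative \<phi> (s + \<sigma> * t)) (at t within {0..1})"
      using has_vector_derivative_at_within has_real_derivative_iff_has_vector_derivative by blast
  qed simp
  then have "integral {0..1} (\<lambda>t. \<phi> (s + \<sigma> * t)) = \<sigma> * F (s + \<sigma>) - \<sigma> * F s"
    by (simp add: integral_unique)
  also have "\<dots> = F 1 - F 0" using \<sigma> D[of s] D[of "s - 1"] by auto
  also have "\<dots> = integral {0..1} \<phi>"
  proof (rule integral_unique[symmetric, OF fundamental_theorem_of_calculus])
    show "(F has_vector_derivative \<phi> x) (at x within {0..1})" for x
      using F[of x] has_vector_derivative_at_within has_real_derivative_iff_has_vector_derivative by blast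
  qed simp
  finally show ?thesis .
qed

text \<open>Iterated one-dimensional integrals suit the shears, which act as translations in one
  variable at a time.\<close>

definition torus_mean :: "(real^2 \<Rightarrow> real) \<Rightarrow> real" where
  "torus_mean u = integral {0..1} (\<lambda>a. integral {0..1} (\<lambda>b. u (pt a b)))"

lemma continuous_on_pt [continuous_intros]:
  fixes f g :: "'a::topological_space \<Rightarrow> real"
  assumes "continuous_on S f" "continuous_on S g"
  shows "continuous_on S (\<lambda>x. pt (f x) (g x))"
proof -
  have "pt (f x) (g x) = f x *\<^sub>R axis 1 1 + g x *\<^sub>R axis 2 1" for x
    by (simp add: vec_eq_iff forall_2 axis_def)
  then show ?thesis using assms by (auto intro!: continuous_intros)
qed

lemma continuous_on_compose_pt:
  fixes u :: "real^2 \<Rightarrow> real"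
  assumes "continuous_on UNIV u" "continuous_on S f" "continuous_on S g"
  shows "continuous_on S (\<lambda>x. u (pt (f x) (g x)))"
  by (rule continuous_on_compose2[OF assms(1) continuous_on_pt[OF assms(2,3)]]) auto

lemma continuous_inner_integral:
  fixes F :: "real \<Rightarrow> real \<Rightarrow> real"
  assumes "continuous_on UNIV (\<lambda>z. F (fst z) (snd z))"
  shows "continuous_on {0..1} (\<lambda>a. integral {0..1} (F a))"
proof -
  have "continuous_on ({0..1} \<times> cbox 0 1) (\<lambda>(a, b). F a b)"
    by (rule continuous_on_eq[OF continuous_on_subset[OF assms]]) auto
  then show ?thesis using integral_continuous_on_param[of "{0..1}" 0 1 F] by simp
qed

lemma swap_unit_integrals:
  fixes F :: "real \<Rightarrow> real \<Rightarrow> real"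
  assumes "continuous_on UNIV (\<lambda>z. F (fst z) (snd z))"
  shows "integral {0..1} (\<lambda>a. integral {0..1} (\<lambda>b. F a b)) = integral {0..1} (\<lambda>b. integral {0..1} (\<lambda>a. F a b))"
proof -
  have "continuous_on (cbox (0, 0) (1, 1)) (\<lambda>(a, b). F a b)"
    by (rule continuous_on_eq[OF continuous_on_subset[OF assms]]) auto
  then show ?thesis using integral_swap_continuous[of 0 0 1 1 F] by simp
qed

lemma torus_mean_linear:
  assumes u: "continuous_on UNIV u" and v: "continuous_on UNIV v"
  shows "torus_mean (\<lambda>x. u x + k * v x) = torus_mean u + k * torus_mean v"
proof -
  have cont: "continuous_on UNIV (\<lambda>z. w (pt (fst z) (snd z)))" if "continuous_on UNIV w" for w :: "real^2 \<Rightarrow> real"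
    by (rule continuous_on_compose_pt[OF that]) (auto intro: continuous_intros)
  have in1: "(\<lambda>b. w (pt a b)) integrable_on {0..1}" if "continuous_on UNIV w" for w :: "real^2 \<Rightarrow> real" and a
    by (rule integrable_continuous_real, rule continuous_on_compose_pt[OF that]) (auto intro: continuous_intros)
  have in2: "(\<lambda>a. integral {0..1} (\<lambda>b. w (pt a b))) integrable_on {0..1}" if "continuous_on UNIV w" for w :: "real^2 \<Rightarrow> real"
    by (rule integrable_continuous_real, rule continuous_inner_integral[OF cont[OF that]])
  have "integral {0..1} (\<lambda>b. u (pt a b) + k * v (pt a b))
      = integral {0..1} (\<lambda>b. u (pt a b)) + k * integral {0..1} (\<lambda>b. v (pt a b))" for a
    using integral_add[OF in1[OF u] integrable_on_mult_right[OF in1[OF v]], of a k a]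
    by (simp add: integral_mult_right)
  then show ?thesis unfolding torus_mean_def
    using integral_add[OF in2[OF u] integrable_on_mult_right[OF in2[OF v]], of k]
    by (simp add: integral_mult_right)
qed

lemma torus_mean_le:
  assumes u: "continuous_on UNIV u" and k: "\<And>x. u x \<le> k"
  shows "torus_mean u \<le> k"
proof -
  have cont: "continuous_on UNIV (\<lambda>z. u (pt (fst z) (snd z)))"
    by (rule continuous_on_compose_pt[OF u]) (auto intro: continuous_intros)
  have "integral {0..1} (\<lambda>b. u (pt a b)) \<le> integral {0..1} (\<lambda>b::real. k)" for a
    by (intro integral_le integrable_continuous_real continuous_on_compose_pt[OF u] continuous_intros k)
  then have "integral {0..1} (\<lambda>b. u (pt a b)) \<le> k" for a by simp
  then have "torus_mean u \<le> integral {0..1} (\<lambda>a::real. k)"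
    unfolding torus_mean_def
    by (intro integral_le[OF integrable_continuous_real[OF continuous_inner_integral[OF cont]]]) auto
  then show ?thesis by simp
qed

lemma torus_periodic_pt:
  assumes "torus_periodic u"
  shows "u (pt (a + of_int m) (b + of_int n)) = u (pt a b)"
proof -
  have "pt (of_int m) (of_int n) \<in> lattice" unfolding lattice_def by (simp add: forall_2)
  from torus_periodic_lattice[OF assms this, of "pt a b"] show ?thesis by (simp add: pt_arith)
qed

text \<open>The map preserves r = x1 + \<sigma> x2. In the coordinates (x1, r) it translates x1 by G
  r, which leaves the mean over a period unchanged.\<close>

lemma torus_mean_shear:
  assumes u: "continuous_on UNIV u" "torus_periodic u" and G: "continuous_on UNIV G" "\<And>t. G (t + 1) = G t"
    and \<sigma>: "\<sigma> = 1 \<or> \<sigma> = -1"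
  shows "torus_mean (\<lambda>x. u (pt (x $ 1 + G (x $ 1 + \<sigma> * x $ 2)) (x $ 2 - \<sigma> * G (x $ 1 + \<sigma> * x $ 2)))) = torus_mean u"
proof -
  have \<sigma>2: "\<sigma> * (\<sigma> * b) = b" for b :: real using \<sigma> by auto
  have per: "u (pt (a + 1) (b + \<sigma>)) = u (pt a b)" "u (pt (a + 1) (b - \<sigma>)) = u (pt a b)"
    "u (pt a (b + \<sigma>)) = u (pt a b)" for a b
    using \<sigma> torus_periodic_pt[OF u(2), of a 1 b 1] torus_periodic_pt[OF u(2), of a 1 b "-1"]
      torus_periodic_pt[OF u(2), of a 0 b 1] torus_periodic_pt[OF u(2), of a 0 b "-1"] by auto
  \<comment> \<open>The integrand in the coordinates a = x1 and r, where x2 = \<sigma> (r -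
    a).\<close>
  let ?\<Psi> = "\<lambda>H a r. u (pt (a + H r) (\<sigma> * (r - a - H r)))"
  have inner: "integral {0..1} (\<lambda>b. u (pt (a + H (a + \<sigma> * b)) (b - \<sigma> * H (a + \<sigma> * b))))
      = integral {0..1} (?\<Psi> H a)"
    if H: "continuous_on UNIV H" "\<And>t. H (t + 1) = H t" for H a
  proof -
    have Hc: "continuous_on S (\<lambda>z. H (k z))" if "continuous_on S k" for S and k :: "'c::topological_space \<Rightarrow> real"
      by (rule continuous_on_compose2[OF H(1) that]) auto
    have "integral {0..1} (\<lambda>b. ?\<Psi> H a (a + \<sigma> * b)) = integral {0..1} (?\<Psi> H a)"
    proof (rule integral_periodic[OF _ _ \<sigma>])
      show "continuous_on UNIV (?\<Psi> H a)"
        by (intro continuous_on_compose_pt[OF u(1)] continuous_intros Hc)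
      fix t
      have "\<sigma> * (t + 1 - a - H t) = \<sigma> * (t - a - H t) + \<sigma>" by (simp add: algebra_simps)
      then show "?\<Psi> H a (t + 1) = ?\<Psi> H a t" using per(3) unfolding H(2) by simp
    qed
    moreover have "?\<Psi> H a (a + \<sigma> * b) = u (pt (a + H (a + \<sigma> * b)) (b - \<sigma> * H (a + \<sigma> * b)))" for b
      by (simp only: add_diff_cancel_left' right_diff_distrib \<sigma>2)
    ultimately show ?thesis by simp
  qed
  have cont: "continuous_on UNIV (\<lambda>z. ?\<Psi> H (fst z) (snd z))" if H: "continuous_on UNIV H" for H
    by (intro continuous_on_compose_pt[OF u(1)] continuous_intros continuous_on_compose2[OF H]) auto
  have outer: "integral {0..1} (\<lambda>a. ?\<Psi> G a r) = integral {0..1} (\<lambda>a. ?\<Psi> (\<lambda>_. 0) a r)" for r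
  proof -
    have "integral {0..1} (\<lambda>a. ?\<Psi> (\<lambda>_. 0) (G r + 1 * a) r) = integral {0..1} (\<lambda>a. ?\<Psi> (\<lambda>_. 0) a r)"
    proof (rule integral_periodic)
      show "continuous_on UNIV (\<lambda>a. ?\<Psi> (\<lambda>_. 0) a r)"
        by (intro continuous_on_compose_pt[OF u(1)] continuous_intros)
      fix a
      have "\<sigma> * (r - (a + 1) - 0) = \<sigma> * (r - a - 0) - \<sigma>" by (simp add: algebra_simps)
      then show "?\<Psi> (\<lambda>_. 0) (a + 1) r = ?\<Psi> (\<lambda>_. 0) a r" using per(2) by simp
    qed simp
    then show ?thesis by (simp add: algebra_simps)
  qed
  have "torus_mean (\<lambda>x. u (pt (x $ 1 + G (x $ 1 + \<sigma> * x $ 2)) (x $ 2 - \<sigma> * G (x $ 1 + \<sigma> * x $ 2))))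
      = integral {0..1} (\<lambda>a. integral {0..1} (?\<Psi> G a))"
    unfolding torus_mean_def using inner[OF G] by simp
  also have "\<dots> = integral {0..1} (\<lambda>r. integral {0..1} (\<lambda>a. ?\<Psi> G a r))"
    by (rule swap_unit_integrals[OF cont[OF G(1)]])
  also have "\<dots> = integral {0..1} (\<lambda>r. integral {0..1} (\<lambda>a. ?\<Psi> (\<lambda>_. 0) a r))"
    unfolding outer ..
  also have "\<dots> = integral {0..1} (\<lambda>a. integral {0..1} (?\<Psi> (\<lambda>_. 0) a))"
    by (rule swap_unit_integrals[OF cont, symmetric]) simp
  also have "\<dots> = torus_mean u"
    unfolding torus_mean_def using inner[of "\<lambda>_. 0"] by simp
  finally show ?thesis .
qed

lemma torus_mean_translate:
  assumes u: "continuous_on UNIV u" "torus_periodic u"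
  shows "torus_mean (\<lambda>x. u (x + k)) = torus_mean u"
proof -
  have shift1: "integral {0..1} (\<lambda>b. u (pt a (s + 1 * b))) = integral {0..1} (\<lambda>b. u (pt a b))" for a s
  proof (rule integral_periodic)
    show "continuous_on UNIV (\<lambda>b. u (pt a b))" by (intro continuous_on_compose_pt[OF u(1)] continuous_intros)
    show "u (pt a (t + 1)) = u (pt a t)" for t using torus_periodic_pt[OF u(2), of a 0 t 1] by simp
  qed simp
  have shift2: "integral {0..1} (\<lambda>a. u (pt (s + 1 * a) b)) = integral {0..1} (\<lambda>a. u (pt a b))" for b s
  proof (rule integral_periodic)
    show "continuous_on UNIV (\<lambda>a. u (pt a b))" by (intro continuous_on_compose_pt[OF u(1)] continuous_intros)
    show "u (pt (t + 1) b) = u (pt t b)" for t using torus_periodic_pt[OF u(2), of t 1 b 0] by simp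
  qed simp
  have "pt a b + k = pt (k $ 1 + 1 * a) (k $ 2 + 1 * b)" for a b by (simp add: vec_eq_iff forall_2)
  then have "torus_mean (\<lambda>x. u (x + k)) = integral {0..1} (\<lambda>a. integral {0..1} (\<lambda>b. u (pt (k $ 1 + 1 * a) b)))"
    unfolding torus_mean_def using shift1 by simp
  also have "\<dots> = integral {0..1} (\<lambda>b. integral {0..1} (\<lambda>a. u (pt (k $ 1 + 1 * a) b)))"
    by (rule swap_unit_integrals) (intro continuous_on_compose_pt[OF u(1)] continuous_intros)
  also have "\<dots> = integral {0..1} (\<lambda>b. integral {0..1} (\<lambda>a. u (pt a b)))" unfolding shift2 ..
  also have "\<dots> = torus_mean u" unfolding torus_mean_def
    by (rule swap_unit_integrals[symmetric]) (intro continuous_on_compose_pt[OF u(1)] continuous_intros)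
  finally show ?thesis .
qed

context cellular
begin

text \<open>The field \<open>W\<close> is a sum of two diagonal shears, so the step \<open>x + h (W x + 2 p)\<close> is, up to
  \<open>O(h\<^sup>2)\<close>, a composition of mean preserving maps. Averaging the increment of an admissible function
  over this step yields the bound.\<close>

lemma crit_ge_norm_sq: "(norm p)\<^sup>2 \<le> crit p"
proof (rule crit_greatest)
  fix c f assume c: "0 \<le> c" and f: "admissible c p f"
  have fd: "dominated c f" and fe: "equivariant p f" using f unfolding admissible_def by auto
  define u where "u x = f x - p \<bullet> x" for x
  have uc: "continuous_on UNIV u"
    unfolding u_def by (intro continuous_intros dominated_continuous[OF c fd])
  have up: "torus_periodic u" using fe unfolding u_def equivariant_iff_periodic .
  let ?L = "16 * pi\<^sup>2 * \<bar>A\<bar>"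
  define D where "D = 2 * norm p + 2 * pi * \<bar>A\<bar>"
  define V where "V = 4 * pi * \<bar>A\<bar> + 2 * norm p"
  define K where "K = ?L * V\<^sup>2 + (cost_max c + norm p) * (?L * D)"
  have profc: "continuous_on S (\<lambda>x. profile (k x))" if "continuous_on S k" for S and k :: "'c::t2_space \<Rightarrow> real"
    unfolding profile_def by (intro continuous_intros that)
  have Wc: "continuous_on UNIV (\<lambda>x. p \<bullet> W x)"
    unfolding inner_vec2 W_components by (intro continuous_intros profc)
  have Wmean: "torus_mean (\<lambda>x. p \<bullet> W x) = 0"
  proof -
    \<comment> \<open>Shifting x1 by half a period changes the sign of the whole field, so its mean
      vanishes.\<close>
    have half: "profile (t + 1/2) = - profile t" for t
      unfolding profile_def distrib_left using sin_periodic_pi[of "2 * pi * t"] by simp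
    have "W (x + pt (1/2) 0) = - W x" for x
    proof -
      have "profile (x $ 1 + 1/2 + x $ 2) = - profile (x $ 1 + x $ 2)"
        using half[of "x $ 1 + x $ 2"] by (simp add: algebra_simps)
      moreover have "profile (x $ 1 + 1/2 - x $ 2) = - profile (x $ 1 - x $ 2)"
        using half[of "x $ 1 - x $ 2"] by (simp add: algebra_simps)
      ultimately show ?thesis by (simp add: vec_eq_iff forall_2 W_components)
    qed
    then have "torus_mean (\<lambda>x. - (p \<bullet> W x)) = torus_mean (\<lambda>x. p \<bullet> W x)"
      using torus_mean_translate[OF Wc, of "pt (1/2) 0"] W_periodic by (simp add: torus_periodic_def)
    moreover have "torus_mean (\<lambda>x. 0 + (-1) * (p \<bullet> W x)) = torus_mean (\<lambda>x. 0) + (-1) * torus_mean (\<lambda>x. p \<bullet> W x)"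
      by (rule torus_mean_linear[OF _ Wc]) simp
    moreover have "torus_mean (\<lambda>x. 0) = 0" unfolding torus_mean_def by simp
    ultimately show ?thesis by simp
  qed
  have key: "(norm p)\<^sup>2 - c \<le> h * K" if h: "0 < h" for h
  proof -
    define H where "H t = - (h * profile t)" for t
    have Hc: "continuous_on UNIV H" unfolding H_def by (intro continuous_intros profc)
    have Hp: "H (t + 1) = H t" for t unfolding H_def using profile_periodic[of t 1] by simp
    define S1 where "S1 x = pt (x $ 1 + H (x $ 1 + 1 * x $ 2)) (x $ 2 - 1 * H (x $ 1 + 1 * x $ 2))" for x :: "real^2"
    define S2 where "S2 x = pt (x $ 1 + H (x $ 1 + -1 * x $ 2)) (x $ 2 - -1 * H (x $ 1 + -1 * x $ 2))" for x :: "real^2"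
    have H': "H (t - 1) = H t" for t using Hp[of "t - 1"] by simp
    have "S1 (x + axis i 1) = S1 x + axis i 1" "S2 (x + axis i 1) = S2 x + axis i 1" for x and i :: 2
      unfolding S1_def S2_def using exhaust_2[of i] Hp[of "x $ 1 + x $ 2"] Hp[of "x $ 1 - x $ 2"] H'[of "x $ 1 - x $ 2"]
      by (auto simp: vec_eq_iff forall_2 axis_def algebra_simps)
    then have per: "torus_periodic (\<lambda>x. u (S1 x))" "torus_periodic (\<lambda>x. u (S1 (S2 x)))"
      using up unfolding torus_periodic_def by simp_all
    have S1c: "continuous_on UNIV S1"
      unfolding S1_def by (intro continuous_intros continuous_on_compose2[OF Hc]) auto
    have S2c: "continuous_on UNIV S2"
      unfolding S2_def by (intro continuous_intros continuous_on_compose2[OF Hc]) auto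
    have c1: "continuous_on UNIV (\<lambda>x. u (S1 x))" by (rule continuous_on_compose2[OF uc S1c]) auto
    have c2: "continuous_on UNIV (\<lambda>x. u (S1 (S2 x)))" by (rule continuous_on_compose2[OF c1 S2c]) auto
    define y where "y x = S1 (S2 (x + (2 * h) *\<^sub>R p))" for x
    have c3: "continuous_on UNIV (\<lambda>x. u (y x))"
      unfolding y_def by (rule continuous_on_compose2[OF c2]) (auto intro!: continuous_intros)
    have "torus_mean (\<lambda>x. u (y x)) = torus_mean (\<lambda>x. u (S1 (S2 x)))"
      unfolding y_def by (rule torus_mean_translate[OF c2 per(2)])
    also have "\<dots> = torus_mean (\<lambda>x. u (S1 x))"
      unfolding S2_def by (rule torus_mean_shear[OF c1 per(1) Hc Hp]) simp
    also have "\<dots> = torus_mean u"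
      unfolding S1_def by (rule torus_mean_shear[OF uc up Hc Hp]) simp
    finally have mean: "torus_mean (\<lambda>x. u (y x)) = torus_mean u" .
    \<comment> \<open>The linear part grows by about 2 h |p|^2 + h (p . W) while \<open>f\<close>
      grows by at most about h (c + |p|^2). In the mean the drift term and the increment of
      \<open>u\<close> vanish, leaving 0 <= c - |p|^2 + O(h).\<close>
    have pw: "u (y x) + (-1) * u x + h * (p \<bullet> W x) \<le> h * (c - (norm p)\<^sup>2) + h\<^sup>2 * K" for x
    proof -
      let ?v = "W x + 2 *\<^sub>R p" and ?y0 = "x + (2 * h) *\<^sub>R p"
      let ?y1 = "S2 ?y0"
      define a where "a = profile (?y1 $ 1 + ?y1 $ 2) - profile (x $ 1 + x $ 2)"
      define b where "b = profile (?y0 $ 1 - ?y0 $ 2) - profile (x $ 1 - x $ 2)"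
      have sum2: "\<bar>z $ 1 + z $ 2\<bar> \<le> 2 * norm z" "\<bar>z $ 1 - z $ 2\<bar> \<le> 2 * norm z" for z :: "real^2"
        using component_le_norm_cart[of z 1] component_le_norm_cart[of z 2] by linarith+
      have n0: "norm (?y0 - x) \<le> h * D" unfolding D_def using h by (simp add: algebra_simps)
      have "norm (?y1 - ?y0) \<le> \<bar>H (?y0 $ 1 + -1 * ?y0 $ 2)\<bar> + \<bar>H (?y0 $ 1 + -1 * ?y0 $ 2)\<bar>"
        using norm_vec2_le[of "?y1 - ?y0"] unfolding S2_def by simp
      also have "\<dots> \<le> 2 * (h * (pi * \<bar>A\<bar>))"
        unfolding H_def using mult_left_mono[OF profile_bound, of h "?y0 $ 1 + -1 * ?y0 $ 2"] h by (simp add: abs_mult)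
      finally have "norm (?y1 - x) \<le> h * D"
        using norm_triangle_ineq[of "?y1 - ?y0" "?y0 - x"] h unfolding D_def by (simp add: algebra_simps)
      then have a: "\<bar>a\<bar> \<le> 2 * pi\<^sup>2 * \<bar>A\<bar> * (2 * (h * D))"
        unfolding a_def using sum2(1)[of "?y1 - x"]
        by (intro order_trans[OF profile_lipschitz] mult_left_mono) (auto simp: algebra_simps)
      have b: "\<bar>b\<bar> \<le> 2 * pi\<^sup>2 * \<bar>A\<bar> * (2 * (h * D))"
        unfolding b_def using sum2(2)[of "?y0 - x"] n0
        by (intro order_trans[OF profile_lipschitz] mult_left_mono) (auto simp: algebra_simps)
      have "y x - (x + h *\<^sub>R ?v) = pt (- (h * a) - h * b) (h * a - h * b)"
        unfolding y_def S1_def a_def b_def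
        by (simp add: vec_eq_iff forall_2 W_components H_def S2_def algebra_simps)
      then have "norm (y x - (x + h *\<^sub>R ?v)) \<le> \<bar>- (h * a) - h * b\<bar> + \<bar>h * a - h * b\<bar>"
        using norm_vec2_le[of "y x - (x + h *\<^sub>R ?v)"] by simp
      also have "\<dots> \<le> 2 * \<bar>h * a\<bar> + 2 * \<bar>h * b\<bar>" by linarith
      also have "\<dots> = h * (2 * \<bar>a\<bar> + 2 * \<bar>b\<bar>)" using h by (simp add: abs_mult algebra_simps)
      also have "\<dots> \<le> h * (?L * (h * D))" using a b h by (intro mult_left_mono) auto
      finally have close: "norm (y x - (x + h *\<^sub>R ?v)) \<le> h\<^sup>2 * (?L * D)"
        by (simp add: power2_eq_square algebra_simps)
      have v: "norm ?v \<le> V" unfolding V_def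
        using norm_triangle_ineq[of "W x" "2 *\<^sub>R p"] W_bound[of x] by simp
      \<comment> \<open>\<open>?v\<close> is the characteristic velocity of the momentum
        \<open>p\<close>, and this is the Fenchel inequality: the cost is at most c + |v - W|^2 / 4,
        where v - W = 2 p.\<close>
      have costv: "cost c x ?v \<le> c + (norm p)\<^sup>2"
      proof -
        have "sqrt (c + (norm (W x))\<^sup>2 / 4) * norm ?v \<le> (2 * (sqrt (c + (norm (W x))\<^sup>2 / 4))\<^sup>2 + (norm ?v)\<^sup>2 / 2) / 2"
          by (rule mult_le_weighted_squares) simp
        also have "\<dots> = c + (norm (W x))\<^sup>2 / 4 + (norm ?v)\<^sup>2 / 4" using c by (simp add: field_simps)
        also have "(norm ?v)\<^sup>2 = (norm (W x))\<^sup>2 + 4 * (W x \<bullet> p) + 4 * (norm p)\<^sup>2"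
          by (simp add: power2_norm_eq_inner inner_add_left inner_add_right inner_commute)
        finally have "sqrt (c + (norm (W x))\<^sup>2 / 4) * norm ?v
          \<le> c + (norm (W x))\<^sup>2 / 2 + W x \<bullet> p + (norm p)\<^sup>2" by (simp add: field_simps)
        moreover have "W x \<bullet> ?v = (norm (W x))\<^sup>2 + 2 * (W x \<bullet> p)"
          by (simp add: power2_norm_eq_inner inner_add_right)
        ultimately show ?thesis unfolding cost_def by linarith
      qed
      have "f (x + h *\<^sub>R ?v) - f x \<le> cost c x (h *\<^sub>R ?v) + ?L * (norm (h *\<^sub>R ?v))\<^sup>2"
        using dominatedD[OF fd, of "x + h *\<^sub>R ?v" x] by simp
      also have "cost c x (h *\<^sub>R ?v) \<le> h * (c + (norm p)\<^sup>2)"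
        using costv h by (simp add: cost_scale mult_left_mono)
      also have "?L * (norm (h *\<^sub>R ?v))\<^sup>2 \<le> ?L * (h\<^sup>2 * V\<^sup>2)"
        using power_mono[OF v norm_ge_zero, of 2] by (intro mult_left_mono) (auto simp: power_mult_distrib mult_left_mono)
      finally have 1: "f (x + h *\<^sub>R ?v) - f x \<le> h * (c + (norm p)\<^sup>2) + ?L * (h\<^sup>2 * V\<^sup>2)" by simp
      have 2: "f (y x) - f (x + h *\<^sub>R ?v) \<le> cost_max c * (h\<^sup>2 * (?L * D))"
        using dominated_lip_le[OF c fd, of "y x" "x + h *\<^sub>R ?v"] mult_left_mono[OF close cost_max_nonneg[OF c]] by linarith
      have "\<bar>p \<bullet> (y x - (x + h *\<^sub>R ?v))\<bar> \<le> norm p * (h\<^sup>2 * (?L * D))"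
        by (rule order_trans[OF Cauchy_Schwarz_ineq2 mult_left_mono[OF close]]) simp
      then have "p \<bullet> (x + h *\<^sub>R ?v) - p \<bullet> y x \<le> norm p * (h\<^sup>2 * (?L * D))"
        by (simp only: inner_diff_right abs_le_iff) linarith
      moreover have "p \<bullet> (x + h *\<^sub>R ?v) = p \<bullet> x + h * (p \<bullet> W x) + 2 * h * (norm p)\<^sup>2"
        by (simp add: power2_norm_eq_inner inner_add_right algebra_simps)
      ultimately have 3: "p \<bullet> x - p \<bullet> y x + h * (p \<bullet> W x) + 2 * h * (norm p)\<^sup>2 \<le> norm p * (h\<^sup>2 * (?L * D))"
        by linarith
      have "u (y x) + (-1) * u x + h * (p \<bullet> W x)
        = (f (x + h *\<^sub>R ?v) - f x) + (f (y x) - f (x + h *\<^sub>R ?v))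
          + (p \<bullet> x - p \<bullet> y x + h * (p \<bullet> W x) + 2 * h * (norm p)\<^sup>2) - 2 * h * (norm p)\<^sup>2"
        unfolding u_def by simp
      also have "\<dots> \<le> (h * (c + (norm p)\<^sup>2) + ?L * (h\<^sup>2 * V\<^sup>2)) + cost_max c * (h\<^sup>2 * (?L * D))
          + norm p * (h\<^sup>2 * (?L * D)) - 2 * h * (norm p)\<^sup>2"
        using 1 2 3 by linarith
      also have "\<dots> = h * (c - (norm p)\<^sup>2) + h\<^sup>2 * K" unfolding K_def by (simp add: algebra_simps)
      finally show ?thesis .
    qed
    have lin1: "torus_mean (\<lambda>x. u (y x) + (-1) * u x) = torus_mean (\<lambda>x. u (y x)) + (-1) * torus_mean u"
      by (rule torus_mean_linear[OF c3 uc])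
    have cc: "continuous_on UNIV (\<lambda>x. u (y x) + (-1) * u x)" by (intro continuous_intros c3 uc)
    have "torus_mean (\<lambda>x. u (y x) + (-1) * u x + h * (p \<bullet> W x)) = 0"
      using torus_mean_linear[OF cc Wc, of h] lin1 mean Wmean by simp
    moreover have "torus_mean (\<lambda>x. u (y x) + (-1) * u x + h * (p \<bullet> W x)) \<le> h * (c - (norm p)\<^sup>2) + h\<^sup>2 * K"
      by (rule torus_mean_le[OF _ pw]) (intro continuous_on_add[OF cc] continuous_intros Wc)
    ultimately have "0 \<le> h * ((c - (norm p)\<^sup>2) + h * K)" by (simp add: power2_eq_square algebra_simps)
    then have "0 \<le> (c - (norm p)\<^sup>2) + h * K" using h by (simp add: zero_le_mult_iff)
    then show ?thesis by linarith
  qed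
  have "(norm p)\<^sup>2 - c \<le> 0"
  proof (rule field_le_epsilon)
    fix e :: real assume e: "0 < e"
    have K0: "0 < \<bar>K\<bar> + 1" by simp
    have "(norm p)\<^sup>2 - c \<le> e / (\<bar>K\<bar> + 1) * K" by (rule key) (use e K0 in simp)
    also have "\<dots> \<le> e / (\<bar>K\<bar> + 1) * (\<bar>K\<bar> + 1)" using e by (intro mult_left_mono) auto
    finally show "(norm p)\<^sup>2 - c \<le> 0 + e" using K0 by simp
  qed
  then show "(norm p)\<^sup>2 \<le> c" by simp
qed

text \<open>Averages an admissible function with its reflection in x2, whose momentum is (a, -
  b).\<close>

lemma crit_axis_le: "crit (pt a 0) \<le> crit (pt a b)"
proof -
  obtain f where f: "admissible (crit (pt a b)) (pt a b) f" by (rule crit_attained)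
  have "reflect2 (pt a b) = pt a (- b)" unfolding reflect2_def by simp
  then have "admissible (crit (pt a b)) (pt a (- b)) (\<lambda>x. f (reflect2 x))"
    using admissible_reflect(2)[OF f] by simp
  from admissible_convex[OF crit_nonneg crit_nonneg, of "1/2" _ _ f, OF _ _ f this]
  have "admissible (crit (pt a b)) (pt a 0) (\<lambda>x. 1/2 * f x + (1 - 1/2) * f (reflect2 x))"
    by (simp add: pt_arith)
  then show ?thesis using crit_le crit_nonneg by blast
qed

end

section \<open>Flat pieces of the level curve\<close>

text \<open>Supplies the continuity of \<open>crit\<close>, hence a minimiser of the quotient on a
  compact interval.\<close>

lemma (in drift) crit_convex: "convex_on UNIV crit"
proof (rule convex_onI)
  fix t :: real and p q :: "real^2" assume t: "0 < t" "t < 1"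
  obtain f where f: "admissible (crit p) p f" by (rule crit_attained)
  obtain g where g: "admissible (crit q) q g" by (rule crit_attained)
  have "admissible (t * crit q + (1 - t) * crit p) (t *\<^sub>R q + (1 - t) *\<^sub>R p) (\<lambda>x. t * g x + (1 - t) * f x)"
    by (rule admissible_convex[OF crit_nonneg crit_nonneg _ _ g f]) (use t in auto)
  moreover have "0 \<le> t * crit q + (1 - t) * crit p" using t crit_nonneg[of p] crit_nonneg[of q] by simp
  ultimately have "crit (t *\<^sub>R q + (1 - t) *\<^sub>R p) \<le> t * crit q + (1 - t) * crit p" by (rule crit_le)
  then show "crit ((1 - t) *\<^sub>R p + t *\<^sub>R q) \<le> (1 - t) * crit p + t * crit q"
    by (simp add: add.commute)
qed simp

text \<open>The ray through (1 / k, t) meets the line x1 = l0 at the parameter l = k l0. There the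
  quotient in the burning velocity equals 1, and \<open>low\<close> bounds it by 1 from below for
  all l. Positivity of \<open>crit\<close> identifies it with the effective Hamiltonian.\<close>

lemma (in drift) flat_piece_if_crit_flat:
  assumes k: "0 < k" and l0: "0 < l0" and \<mu>: "0 < \<mu>"
    and pos: "\<And>a b. 0 < a \<Longrightarrow> 0 < crit (pt a b)"
    and low: "\<And>a b. 0 < a \<Longrightarrow> k * a \<le> 1 + crit (pt a b)"
    and flat: "\<And>s. 0 \<le> s \<Longrightarrow> s \<le> \<mu> \<Longrightarrow> 1 + crit (pt l0 s) \<le> k * l0"
  shows "contains_flat_piece {p. effective_burning_velocity W p = 1}"
proof -
  have one: "effective_burning_velocity W (pt (1 / k) t) = 1" if t: "0 \<le> t" "t \<le> \<mu> / (k * l0)" for t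
    unfolding effective_burning_velocity_def
  proof (rule cInf_eq_minimum)
    have H: "effective_Hamiltonian W (l *\<^sub>R pt (1 / k) t) = crit (pt (l / k) (l * t))" if "0 < l" for l
      using effective_Hamiltonian_eq_crit[OF pos[of "l / k" "l * t"]] that k by (simp add: pt_arith)
    have ge: "1 \<le> (1 + effective_Hamiltonian W (l *\<^sub>R pt (1 / k) t)) / l" if "0 < l" for l
      using low[of "l / k" "l * t"] that k unfolding H[OF that] by (simp add: pos_le_divide_eq)
    then show "1 \<le> x" if "x \<in> (\<lambda>l. (1 + effective_Hamiltonian W (l *\<^sub>R pt (1 / k) t)) / l) ` {0<..}" for x
      using that by auto
    have kl: "0 < k * l0" using k l0 by simp
    have "k * l0 * t \<le> \<mu>" using t(2) kl by (simp add: pos_le_divide_eq mult.commute)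
    then have "1 + crit (pt (k * l0 / k) (k * l0 * t)) \<le> k * l0"
      using flat[of "k * l0 * t"] t(1) kl k by simp
    then have "(1 + effective_Hamiltonian W ((k * l0) *\<^sub>R pt (1 / k) t)) / (k * l0) \<le> 1"
      unfolding H[OF kl] using kl by (simp add: pos_divide_le_eq)
    then have "(1 + effective_Hamiltonian W ((k * l0) *\<^sub>R pt (1 / k) t)) / (k * l0) = 1"
      using ge[OF kl] by simp
    then show "1 \<in> (\<lambda>l. (1 + effective_Hamiltonian W (l *\<^sub>R pt (1 / k) t)) / l) ` {0<..}"
      by (intro image_eqI[where x = "k * l0"]) (simp_all only: greaterThan_iff kl)
  qed
  let ?a = "pt (1 / k) 0" and ?b = "pt (1 / k) (\<mu> / (k * l0))"
  have pos': "0 < \<mu> / (k * l0)" using \<mu> k l0 by simp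
  have "?a $ 2 \<noteq> ?b $ 2" using \<mu> k l0 by simp
  then have "?a \<noteq> ?b" by metis
  moreover have "closed_segment ?a ?b \<subseteq> {p. effective_burning_velocity W p = 1}"
  proof
    fix x assume "x \<in> closed_segment ?a ?b"
    then obtain s where s: "0 \<le> s" "s \<le> 1" "x = (1 - s) *\<^sub>R ?a + s *\<^sub>R ?b"
      unfolding closed_segment_def by auto
    have "x = pt (1 / k) (s * (\<mu> / (k * l0)))"
      unfolding s(3) pt_arith distrib_right[symmetric] by simp
    moreover have "0 \<le> s * (\<mu> / (k * l0))" "s * (\<mu> / (k * l0)) \<le> \<mu> / (k * l0)"
      using s(1,2) pos' mult_right_mono[of s 1 "\<mu> / (k * l0)"] by (simp_all only: mult_nonneg_nonneg less_imp_le mult_1)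
    ultimately show "x \<in> {p. effective_burning_velocity W p = 1}"
      using one by simp
  qed
  ultimately show ?thesis unfolding contains_flat_piece_def by blast
qed

context cellular
begin

lemma cellular_flat_piece: "contains_flat_piece {p. effective_burning_velocity W p = 1}"
proof -
  let ?E = "\<lambda>l. crit (pt l 0)" and ?\<phi> = "\<lambda>l. (1 + crit (pt l 0)) / l"
  have sq: "l\<^sup>2 \<le> ?E l" for l using crit_ge_norm_sq[of "pt l 0"] by simp
  have "continuous_on UNIV crit" by (rule convex_on_continuous[OF open_UNIV crit_convex])
  then have Ec: "continuous_on S ?E" for S
    by (rule continuous_on_compose_pt) (auto intro: continuous_intros)
  \<comment> \<open>Outside \<open>{1/b..b}\<close> the quotient exceeds its value \<open>b\<close>
    at 1: beyond \<open>b\<close> because \<open>crit\<close> is at least l^2, and before 1 / b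
    because the numerator is at least 1.\<close>
  define b where "b = ?\<phi> 1"
  have b: "2 \<le> b" unfolding b_def using sq[of 1] by simp
  have "continuous_on {1/b..b} ?\<phi>" using b by (intro continuous_intros Ec) auto
  moreover have one: "1 \<in> {1/b..b}" using b by (simp add: pos_divide_le_eq)
  then have "{1/b..b} \<noteq> {}" by blast
  ultimately obtain l0 where l0: "l0 \<in> {1/b..b}" "\<And>l. l \<in> {1/b..b} \<Longrightarrow> ?\<phi> l0 \<le> ?\<phi> l"
    using continuous_attains_inf[of "{1/b..b}" ?\<phi>] by auto
  have l0p: "0 < l0" using l0(1) b by (auto intro: less_le_trans[of _ "1/b"])
  have l0b: "?\<phi> l0 \<le> b" using l0(2)[OF one] unfolding b_def .
  define k where "k = ?\<phi> l0"
  have kE: "k * l0 = 1 + ?E l0" unfolding k_def using l0p by simp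
  have k: "0 < k" unfolding k_def using l0p crit_nonneg[of "pt l0 0"] by (simp add: add_pos_nonneg)
  have kmin: "k * l \<le> 1 + ?E l" if l: "0 < l" for l
  proof (cases "l \<in> {1/b..b}")
    case True
    then show ?thesis using l0(2)[OF True] l unfolding k_def[symmetric] by (simp add: pos_le_divide_eq)
  next
    case False
    then consider "b < l" | "l * b < 1" using b l by (auto simp: not_le pos_divide_le_eq pos_less_divide_eq)
    then show ?thesis
    proof cases
      case 1
      have "k * l \<le> l * l" using l0b 1 l unfolding k_def[symmetric] by (intro mult_right_mono) auto
      then show ?thesis using sq[of l] by (simp add: power2_eq_square)
    next
      case 2
      have "k * l \<le> b * l" using l0b l unfolding k_def[symmetric] by (intro mult_right_mono) auto
      then show ?thesis using 2 crit_nonneg[of "pt l 0"] by (simp add: mult.commute)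
    qed
  qed
  obtain f0 where f0: "admissible (?E l0) (pt l0 0) f0" by (rule crit_attained)
  obtain \<mu> f where \<mu>: "0 < \<mu>" and f: "admissible (?E l0) (pt l0 \<mu>) f"
    using admissible_tilted[OF l0p sq f0] by blast
  show ?thesis
  proof (rule flat_piece_if_crit_flat[OF k l0p \<mu>])
    show "0 < crit (pt a b)" if "0 < a" for a b
    proof -
      have "0 < a\<^sup>2" using that by simp
      then show ?thesis using crit_ge_norm_sq[of "pt a b"] zero_le_power2[of b]
        unfolding norm_vec2_sq vector_2 by linarith
    qed
    show "k * a \<le> 1 + crit (pt a b)" if "0 < a" for a b
      using kmin[OF that] crit_axis_le[of a b] by simp
    fix s assume s: "0 \<le> s" "s \<le> \<mu>"
    \<comment> \<open>Interpolating between the untilted and the tilted function covers the whole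
      vertical segment without raising the level.\<close>
    define t where "t = s / \<mu>"
    have t: "0 \<le> t" "t \<le> 1" "t * \<mu> = s" unfolding t_def using s \<mu> by auto
    have "crit (t *\<^sub>R pt l0 \<mu> + (1 - t) *\<^sub>R pt l0 0) \<le> t * ?E l0 + (1 - t) * ?E l0"
      by (rule crit_le[OF admissible_convex[OF crit_nonneg crit_nonneg t(1,2) f f0]])
        (use t crit_nonneg[of "pt l0 0"] in \<open>simp add: algebra_simps\<close>)
    moreover have "t *\<^sub>R pt l0 \<mu> + (1 - t) *\<^sub>R pt l0 0 = pt l0 s"
      unfolding pt_arith using t(3) by (simp add: algebra_simps)
    ultimately have "crit (pt l0 s) \<le> ?E l0" by (simp add: algebra_simps)
    then show "1 + crit (pt l0 s) \<le> k * l0" unfolding kE by simp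
  qed
qed

end

section \<open>Components of the cellular flow\<close>

lemma cellular_flow_components:
  "cellular_flow x $ 1 = - (2 * pi * sin (2 * pi * x $ 1) * cos (2 * pi * x $ 2))"
  "cellular_flow x $ 2 = 2 * pi * cos (2 * pi * x $ 1) * sin (2 * pi * x $ 2)"
proof -
  have p: "((\<lambda>x::real^2. x $ i) has_derivative (\<lambda>h. h $ i)) (at x)" for i
    using bounded_linear.has_derivative[OF bounded_linear_vec_nth has_derivative_ident] .
  have s: "((\<lambda>x::real^2. sin (2 * pi * x $ i)) has_derivative (\<lambda>h. h $ i * (cos (2 * pi * x $ i) * (2 * pi)))) (at x)" for i
    by (rule DERIV_compose_FDERIV[OF _ p]) (auto intro!: derivative_eq_intros)
  have "frechet_derivative cellular_stream (at x) = (\<lambda>h. sin (2 * pi * x $ 1) * (h $ 2 * (cos (2 * pi * x $ 2) * (2 * pi)))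
      + h $ 1 * (cos (2 * pi * x $ 1) * (2 * pi)) * sin (2 * pi * x $ 2))"
    unfolding cellular_stream_def[abs_def]
    by (rule frechet_derivative_at[symmetric, OF has_derivative_mult[OF s s]])
  then show "cellular_flow x $ 1 = - (2 * pi * sin (2 * pi * x $ 1) * cos (2 * pi * x $ 2))"
    "cellular_flow x $ 2 = 2 * pi * cos (2 * pi * x $ 1) * sin (2 * pi * x $ 2)"
    unfolding cellular_flow_def partial_deriv_def by (simp_all add: axis_def)
qed

lemma (in cellular) W_eq: "W = (\<lambda>x. A *\<^sub>R cellular_flow x)"
  by (simp add: fun_eq_iff vec_eq_iff forall_2 W_trig cellular_flow_components)

section \<open>Shear flows\<close>

lemma periodic_reduce:
  fixes h :: "real \<Rightarrow> 'b"
  assumes "\<And>t. h (t + 1) = h t"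
  shows "h t = h (frac t)"
proof -
  have n: "h (t + real n) = h t" for n t
  proof (induction n)
    case (Suc n)
    then show ?case using assms[of "t + real n"] by (simp add: algebra_simps)
  qed simp
  show ?thesis
  proof (cases "0 \<le> \<lfloor>t\<rfloor>")
    case True
    then show ?thesis using n[of "frac t" "nat \<lfloor>t\<rfloor>"] by (simp add: frac_def)
  next
    case False
    then show ?thesis using n[of t "nat (- \<lfloor>t\<rfloor>)"] by (simp add: frac_def)
  qed
qed

lemma periodic_attains_max:
  fixes h :: "real \<Rightarrow> real"
  assumes "continuous_on UNIV h" "\<And>t. h (t + 1) = h t"
  obtains t0 where "\<And>t. h t \<le> h t0"
proof -
  have "continuous_on {0..1} h" using assms(1) continuous_on_subset by blast
  then obtain t0 where t0: "\<forall>t\<in>{0..1}. h t \<le> h t0"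
    using continuous_attains_sup[of "{0..1}" h] by force
  have "h t \<le> h t0" for t
    using bspec[OF t0, of "frac t"] periodic_reduce[of h t, OF assms(2)] frac_ge_0[of t] frac_lt_1[of t] by simp
  then show ?thesis using that by blast
qed

lemma smooth_periodic_lipschitz:
  assumes sm: "smooth_real v" and per: "\<And>t. v (t + 1) = v t"
  obtains D where "0 \<le> D" "\<And>s t. \<bar>v s - v t\<bar> \<le> D * \<bar>s - t\<bar>"
proof -
  have d0: "v differentiable (at x)" and d1: "deriv v differentiable (at x)" for x
    using sm[unfolded smooth_real_def, rule_format, of 0 x] sm[unfolded smooth_real_def, rule_format, of 1 x] by auto
  have der: "(v has_real_derivative deriv v x) (at x)" for x
    using d0[of x] by (simp add: DERIV_deriv_iff_real_differentiable)
  have "deriv v (t + 1) = deriv v t" for t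
  proof -
    have "((\<lambda>x. v (x + 1)) has_real_derivative deriv v (t + 1)) (at t)"
      using der[of "t + 1"] by (simp add: DERIV_shift)
    then show ?thesis using per DERIV_imp_deriv by fastforce
  qed
  moreover have "continuous_on UNIV (deriv v)"
    using d1 by (simp add: continuous_at_imp_continuous_on differentiable_imp_continuous_within)
  ultimately obtain t0 where t0: "\<And>t. \<bar>deriv v t\<bar> \<le> \<bar>deriv v t0\<bar>"
    using periodic_attains_max[of "\<lambda>t. \<bar>deriv v t\<bar>"] by (auto intro: continuous_intros)
  have "\<bar>v s - v t\<bar> \<le> \<bar>deriv v t0\<bar> * \<bar>s - t\<bar>" for s t
    using field_differentiable_bound[of UNIV v "deriv v" "\<bar>deriv v t0\<bar>" s t] der t0 by simp
  then show ?thesis using that[of "\<bar>deriv v t0\<bar>"] by simp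
qed

text \<open>The profile includes the amplitude; having mean zero without vanishing, it has a
  positive maximum \<open>m\<close> for either sign. Minimising (1 + l^2 + m l) / l gives l = 1 and
  the value 2 + m.\<close>

lemma shear_flat_piece:
  fixes a :: "real \<Rightarrow> real"
  assumes per: "\<And>t. a (t + 1) = a t" and D: "0 \<le> D" "\<And>s t. \<bar>a s - a t\<bar> \<le> D * \<bar>s - t\<bar>"
    and mean: "integral {0..1} a = 0" and nz: "a t1 \<noteq> 0"
  shows "contains_flat_piece {p. effective_burning_velocity (\<lambda>x. pt (a (x $ 2)) 0) p = 1}"
proof -
  have cont: "continuous_on UNIV a"
  proof (rule lipschitz_on_continuous_on[of D], rule lipschitz_onI)
    show "dist (a x) (a y) \<le> D * dist x y" for x y using D(2)[of x y] by (simp add: dist_real_def)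
  qed (rule D(1))
  then have cont01: "continuous_on {0..1} a" using continuous_on_subset by blast
  obtain t0 where t0: "\<And>t. a t \<le> a t0" using periodic_attains_max[OF cont per] by blast
  define m where "m = a t0"
  have am: "a t \<le> m" for t using t0 unfolding m_def .
  have m0: "0 < m"
  proof (rule ccontr)
    assume "\<not> 0 < m"
    then have le: "a t \<le> 0" for t using am[of t] by simp
    have "integral {0..1} (\<lambda>t. - a t) = 0" using mean by simp
    then have "\<forall>t\<in>{0..1}. - a t = 0"
      by (subst (asm) integral_eq_0_iff) (use le cont01 in \<open>auto intro: continuous_intros\<close>)
    then have "a (frac t1) = 0" using frac_ge_0[of t1] frac_lt_1[of t1] by auto
    then show False using nz periodic_reduce[of a t1, OF per] by argo
  qed
  have "continuous_on UNIV (\<lambda>t. \<bar>a t\<bar>)" by (intro continuous_intros cont)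
  then obtain tb where tb: "\<And>t. \<bar>a t\<bar> \<le> \<bar>a tb\<bar>"
    using periodic_attains_max[of "\<lambda>t. \<bar>a t\<bar>"] per by metis
  let ?W = "\<lambda>x::real^2. pt (a (x $ 2)) 0"
  interpret drift ?W D "\<bar>a tb\<bar>"
  proof
    fix x y :: "real^2"
    have "\<bar>x $ 2 - y $ 2\<bar> \<le> norm (x - y)" using component_le_norm_cart[of "x - y" 2] by simp
    then have "D * \<bar>x $ 2 - y $ 2\<bar> \<le> D * norm (x - y)" using D(1) by (intro mult_left_mono) auto
    then show "norm (?W x - ?W y) \<le> D * norm (x - y)" using D(2)[of "x $ 2" "y $ 2"] by (simp add: pt_arith)
    show "norm (?W x) \<le> \<bar>a tb\<bar>" using tb by simp
  next
    show "torus_periodic ?W"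
      unfolding torus_periodic_def
    proof (intro allI)
      fix x :: "real^2" and i :: 2
      show "?W (x + axis i 1) = ?W x" using exhaust_2[of i] per by (auto simp: axis_def)
    qed
  qed
  let ?g = "\<lambda>t. sqrt (m - a t)"
  have gc: "continuous_on UNIV ?g" by (intro continuous_intros cont)
  \<comment> \<open>The mean of the vertical slope sqrt (m - a) that exhausts the level 1 + m when
    the horizontal slope is 1.\<close>
  define I where "I = integral {0..1} ?g"
  have I0: "0 < I"
  proof -
    have c01: "continuous_on {0..1} ?g" using gc continuous_on_subset by blast
    have "0 \<le> I" unfolding I_def by (rule integral_nonneg[OF integrable_continuous_real[OF c01]]) (use am in auto)
    moreover have "I \<noteq> 0"
    proof
      assume "I = 0"
      then have "\<forall>t\<in>{0..1}. ?g t = 0"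
        unfolding I_def by (subst (asm) integral_eq_0_iff) (use am c01 in auto)
      \<comment> \<open>Then \<open>a\<close> would be constantly \<open>m > 0\<close> on the
        period, against its zero mean.\<close>
      then have "integral {0..1} a = integral {0..1} (\<lambda>t::real. m)" by (intro integral_cong) auto
      then show False using mean m0 by simp
    qed
    ultimately show ?thesis by simp
  qed
  have "\<exists>F. \<forall>t. - \<infinity> < ereal t \<longrightarrow> ereal t < \<infinity> \<longrightarrow> (F has_vector_derivative ?g t) (at t)"
    by (rule einterval_antiderivative) (use gc in \<open>auto simp: continuous_on_eq_continuous_at\<close>)
  then obtain G where G: "\<And>t. (G has_real_derivative ?g t) (at t)"
    by (auto simp: has_real_derivative_iff_has_vector_derivative)
  have GI: "G (t + 1) = G t + I" for t
  proof -
    have "((\<lambda>u. ?g (t + 1 * u)) has_integral G (t + 1) - G (t + 0)) {0..1}"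
    proof (rule fundamental_theorem_of_calculus)
      fix u :: real
      have "((\<lambda>u. G (t + u)) has_real_derivative ?g (t + u)) (at u)"
        using G[of "u + t", unfolded DERIV_shift] by (simp add: add.commute)
      then show "((\<lambda>u. G (t + u)) has_vector_derivative ?g (t + 1 * u)) (at u within {0..1})"
        using has_vector_derivative_at_within has_real_derivative_iff_has_vector_derivative by (metis mult_1)
    qed simp
    then have "G (t + 1) - G t = integral {0..1} (\<lambda>u. ?g (t + 1 * u))" by (simp add: integral_unique)
    also have "\<dots> = I" unfolding I_def by (rule integral_periodic[OF gc]) (use per in auto)
    finally show ?thesis by simp
  qed
  have lower: "l\<^sup>2 + m * l \<le> crit (pt l b)" if l: "0 < l" for l b
  proof (rule crit_greatest)
    fix c f assume c: "0 \<le> c" and f: "admissible c (pt l b) f"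
    have fd: "dominated c f" and fe: "equivariant (pt l b) f" using f unfolding admissible_def by auto
    \<comment> \<open>The segment follows the streamline x2 = t0, where the field is constantly
      \<open>m\<close> and so the cost is constant too.\<close>
    have "f (pt 0 t0 + pt 1 0) - f (pt 0 t0) \<le> sqrt (c + m\<^sup>2 / 4) - m / 2"
    proof (rule dominated_along[OF c fd])
      show "cost c (pt 0 t0 + t *\<^sub>R pt 1 0) (pt 1 0) \<le> sqrt (c + m\<^sup>2 / 4) - m / 2" for t
        unfolding cost_def m_def by (simp add: pt_arith inner_vec2)
    qed
    moreover have "pt 1 0 = axis 1 1" by (simp add: vec_eq_iff forall_2 axis_def)
    then have "f (pt 0 t0 + pt 1 0) = f (pt 0 t0) + l" using fe unfolding equivariant_def by simp
    ultimately have "l + m / 2 \<le> sqrt (c + m\<^sup>2 / 4)" by simp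
    then have "(l + m / 2)\<^sup>2 \<le> (sqrt (c + m\<^sup>2 / 4))\<^sup>2" using l m0 by (intro power_mono) auto
    then show "l\<^sup>2 + m * l \<le> c" using c by (simp add: power2_sum power_divide algebra_simps)
  qed
  have upper: "crit (pt 1 s) \<le> 1 + m" if s: "0 \<le> s" "s \<le> I" for s
  proof -
    define k where "k = s / I"
    have k: "0 \<le> k" "k \<le> 1" "k * I = s" unfolding k_def using s I0 by auto
    \<comment> \<open>With vertical slope k sqrt (m - a) and \<open>k \<le> 1\<close>, the energy is
      1 + k^2 (m - a) + a, at most 1 + m.\<close>
    define f where "f x = x $ 1 + k * G (x $ 2)" for x :: "real^2"
    have p: "((\<lambda>x::real^2. x $ i) has_derivative (\<lambda>h. h $ i)) (at x)" for i x
      using bounded_linear.has_derivative[OF bounded_linear_vec_nth has_derivative_ident] .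
    have grad: "GDERIV f x :> pt 1 (k * ?g (x $ 2))" for x
      unfolding gderiv_def f_def
      by (rule has_derivative_eq_rhs[OF has_derivative_add[OF p has_derivative_mult_right[OF DERIV_compose_FDERIV[OF G p]]]])
        (simp add: fun_eq_iff inner_vec2 algebra_simps)
    have "dominated_on (1 + m) UNIV f"
    proof (rule gradient_dominated_on[OF _ convex_UNIV grad])
      fix x :: "real^2"
      have "k\<^sup>2 * (m - a (x $ 2)) \<le> 1 * (m - a (x $ 2))"
        using k am[of "x $ 2"] by (intro mult_right_mono) (auto simp: power_le_one)
      then show "(norm (pt 1 (k * ?g (x $ 2))))\<^sup>2 + ?W x \<bullet> pt 1 (k * ?g (x $ 2)) \<le> 1 + m"
        unfolding norm_vec2_sq inner_vec2 using am[of "x $ 2"] by (simp add: power_mult_distrib)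
    qed (use m0 in simp)
    then have "dominated (1 + m) f" using dominated_iff_on[of "1 + m" f] m0 by simp
    moreover have "equivariant (pt 1 s) f"
      unfolding equivariant_def f_def
    proof (intro allI)
      fix x :: "real^2" and i :: 2
      show "(x + axis i 1) $ 1 + k * G ((x + axis i 1) $ 2) = x $ 1 + k * G (x $ 2) + pt 1 s $ i"
        using exhaust_2[of i] GI[of "x $ 2"] k(3) by (auto simp: axis_def distrib_left)
    qed
    ultimately show ?thesis using crit_le[of "1 + m"] m0 unfolding admissible_def by simp
  qed
  show ?thesis
  proof (rule flat_piece_if_crit_flat[of "2 + m" 1 I])
    show "0 < crit (pt l b)" if "0 < l" for l b
    proof -
      have "0 < l\<^sup>2 + m * l" using that m0 by (simp add: add_pos_pos)
      then show ?thesis using lower[OF that, of b] by linarith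
    qed
    show "(2 + m) * l \<le> 1 + crit (pt l b)" if "0 < l" for l b
    proof -
      have "0 \<le> (l - 1)\<^sup>2" by simp
      then have "2 * l \<le> 1 + l\<^sup>2" by (simp add: power2_diff)
      then show ?thesis using lower[OF that, of b] by (simp add: distrib_right)
    qed
    show "1 + crit (pt 1 s) \<le> (2 + m) * 1" if "0 \<le> s" "s \<le> I" for s
      using upper[OF that] by simp
  qed (use m0 I0 in auto)
qed

theorem theorem1p3:
  fixes V :: "real^2 \<Rightarrow> real^2" and A :: real
  assumes "shear_flow V \<or> V = cellular_flow"
    and "A \<noteq> 0"
  shows "contains_flat_piece {p. effective_burning_velocity (\<lambda>x. A *\<^sub>R V x) p = 1}"
  using assms(1)
proof
  assume "shear_flow V"
  then obtain v t1 where v: "smooth_real v" "\<And>t. v (t + 1) = v t" "integral {0..1} v = 0" "v t1 \<noteq> 0"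
    and V: "V = (\<lambda>x. pt (v (x $ 2)) 0)"
    unfolding shear_flow_def by blast
  obtain D where D: "0 \<le> D" "\<And>s t. \<bar>v s - v t\<bar> \<le> D * \<bar>s - t\<bar>"
    using smooth_periodic_lipschitz[OF v(1,2)] by blast
  have "contains_flat_piece {p. effective_burning_velocity (\<lambda>x. pt (A * v (x $ 2)) 0) p = 1}"
  proof (rule shear_flat_piece[of "\<lambda>t. A * v t" "\<bar>A\<bar> * D" t1])
    show "\<bar>A * v s - A * v t\<bar> \<le> \<bar>A\<bar> * D * \<bar>s - t\<bar>" for s t
      using mult_left_mono[OF D(2)[of s t], of "\<bar>A\<bar>"]
      by (simp add: mult.assoc flip: right_diff_distrib abs_mult)
  qed (use v D assms(2) in auto)
  then show ?thesis unfolding V pt_arith by simp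
next
  assume V: "V = cellular_flow"
  interpret cellular A by unfold_locales (rule assms(2))
  show ?thesis using cellular_flat_piece unfolding W_eq V .
qed

end
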